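(* For all $(\alpha,\gamma,\nu)\in\Lambda_P(\bar u,\bar\tau)$, we have $\alpha>0$. Moreover, there exists a unique Pontryagin multiplier $(\alpha,\gamma,\nu)\in\Lambda_P(\bar u,\bar\tau)$ such that $\alpha=1$.
   Context: **Time crisis problem and standing assumptions.** Fix $T>0$, positive integers $n,m,l$ and $x_0\in\mathbb{R}^n$; $|\cdot|$ is the Euclidean norm. $U\subset\mathbb{R}^m$ is non-empty and closed; $f:\mathbb{R}^n\times\mathbb{R}^m\to\mathbb{R}^n$ is of class $C^2$; there are $c_1,c_2>0$ with $|f(x,u)|\le c_1|x|+c_2$ for all $x\in\mathbb{R}^n$, $u\in U$; for every $x$ the set $\{f(x,u):u\in U\}$ is non-empty, compact and convex; $\phi:\mathbb{R}^n\to\mathbb{R}$ is of class $C^2$; $K\subset\mathbb{R}^n$ is closed with non-empty interior, $K^c$ is its complement and $\mathds{1}_{K^c}$ the indicator function of $K^c$ (value $1$ on $K^c$, $0$ on $K$). Let $\mathcal{U}$ be the set of measurable $u:[0,T]\to U$ and, for $u\in\mathcal{U}$, let $x_u$ be the unique solution on $[0,T]$ of $\dot x=f(x,u)$, $x(0)=x_0$. The time crisis problem is to minimize over $u\in\mathcal{U}$ the cost $J_T(u)=\phi(x_u(T))+\int_0^T\mathds{1}_{K^c}(x_u(t))\,dt$. Fix a global minimizer $\bar u\in\mathcal{U}$ and set $\bar x=x_{\bar u}$. It is assumed that: - There is $c:\mathbb{R}^m\to\mathbb{R}^l$ of class $C^2$ with $U=\{u: c_i(u)\le 0,\ 1\le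 i\le l\}$, and there are $\varepsilon,\delta>0$ such that, with $I(t)=\{i: c_i(\bar u(t))\ge-\delta\}$, one has $\varepsilon|\xi|\le\big|\sum_{i\in I(t)}\xi_i\nabla c_i(\bar u(t))\big|$ for all $\xi\in\mathbb{R}^{I(t)}$, for a.e. $t\in(0,T)$. - There is $g:\mathbb{R}^n\to\mathbb{R}$ of class $C^1$ with $K=\{x: g(x)\le 0\}$. - $\bar x$ has exactly one crossing time $\bar\tau\in(0,T)$; it is a transverse crossing time from $K$ to $K^c$: there is $\eta>0$ with $\bar x(t)\in K$ for $t\in(\bar\tau-\eta,\bar\tau]$ and $\bar x(t)\in K^c$ for $t\in(\bar\tau,\bar\tau+\eta)$; $\bar u$ is left- and right-continuous at $\bar\tau$ (one-sided limits $\bar u(\bar\tau^\pm)$ exist); and $\dot{\bar x}(\bar\tau^\pm)\cdot\nabla g(\bar x(\bar\tau))\ne0$, where $\dot{\bar x}(\bar\tau^\pm)=f(\bar x(\bar\tau),\bar u(\bar\tau^\pm))$. Moreover $g(\bar x(t))\neq0$ for all $t\in[0,T]\setminus\{\bar\tau\}$ (so $x_0\in\mathrm{Int}(K)$). **Hamiltonians.** $H(x,p,u)=p\cdot f(x,u)$ and $H^a(x,p,u,\nu)=p\cdot f(x,u)+\nu\cdot c(u)$, for $x,p\in\mathbb{R}^n$, $u\in\mathbb{R}^m$, $\nu\in\mathbb{R}^l$. Set $\rho_{\bar\tau}(t)=1/\bar\tau$ for $t\in(0,\bar\tau)$ and $\rho_{\bar\tau}(t)=-1/(T-\bar\tau)$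 for $t\in(\bar\tau,T)$. **Lagrange multipliers.** $\Lambda_L(\bar u,\bar\tau)$ is the set of non-zero triplets $(\alpha,\gamma,\nu)\in[0,\infty)\times\mathbb{R}\times L^\infty(0,T;\mathbb{R}^l)$ such that: (i) $\nu(t)\ge0$ and $\nu(t)\cdot c(\bar u(t))=0$ for a.e. $t$; (ii) there is $p:[0,T]\to\mathbb{R}^n$, absolutely continuous on $[0,\bar\tau)$ and on $(\bar\tau,T]$, with $\dot p(t)=-\nabla_xH(\bar x(t),p(t),\bar u(t))$ for a.e. $t$, $p(T)=\alpha\nabla\phi(\bar x(T))$, and jump condition $p(\bar\tau^+)-p(\bar\tau^-)=\gamma\nabla g(\bar x(\bar\tau))$; (iii) $\nabla_uH^a(\bar x(t),p(t),\bar u(t),\nu(t))=0$ for a.e. $t$; (iv) $\int_0^T\rho_{\bar\tau}(t)H(\bar x(t),p(t),\bar u(t))\,dt=\alpha$. The function $p$ (the costate) is uniquely determined by $(\alpha,\gamma,\nu)$. **Pontryagin multipliers.** $\Lambda_P(\bar u,\bar\tau)$ is the set of $(\alpha,\gamma,\nu)\in\Lambda_L(\bar u,\bar\tau)$ whose costate $p$ satisfies $H(\bar x(t),p(t),\bar u(t))\le H(\bar x(t),p(t),u)$ for all $u\in U$, for a.e. $t\in(0,T)$.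
   Formalization: The minimizer ū is additionally assumed essentially bounded on (0,T), while competing controls remain arbitrary measurable; for unbounded U an unbounded ū may admit no non-zero absolutely continuous costate, so Λ_P can be empty and existence with α=1 fails. *)

theory Defs
  imports "HOL-Analysis.Analysis"
begin

section \<open>Smooth functions, gradients, absolute continuity\<close>

definition class_C1 :: "('a::real_normed_vector \<Rightarrow> 'b::real_normed_vector) \<Rightarrow> bool" where
  "class_C1 f \<longleftrightarrow>
     (\<exists>f'. (\<forall>x. (f has_derivative blinfun_apply (f' x)) (at x)) \<and> continuous_on UNIV f')"

definition class_C2 :: "('a::real_normed_vector \<Rightarrow> 'b::real_normed_vector) \<Rightarrow> bool" where
  "class_C2 f \<longleftrightarrow>
     (\<exists>f'. (\<forall>x. (f has_derivative blinfun_apply (f' x)) (at x)) \<and> class_C1 f')"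

definition gradient :: "('a::real_inner \<Rightarrow> real) \<Rightarrow> 'a \<Rightarrow> 'a" where
  "gradient f x = (THE D. GDERIV f x :> D)"

text \<open>The set \<open>D\<close> is a finite family of non-overlapping compact intervals \<open>[a, b]\<close> contained in
  \<open>S\<close>, each represented by the pair \<open>(a, b)\<close> of its endpoints.\<close>

definition abs_continuous_on :: "real set \<Rightarrow> (real \<Rightarrow> 'a::real_normed_vector) \<Rightarrow> bool" where
  "abs_continuous_on S x \<longleftrightarrow>
     (\<forall>\<epsilon>>0. \<exists>\<delta>>0. \<forall>D. finite D \<longrightarrow>
        (\<forall>(a, b)\<in>D. a \<le> b \<and> {a..b} \<subseteq> S) \<longrightarrow>
        pairwise (\<lambda>(a, b) (c, d). {a<..<b} \<inter> {c<..<d} = {}) D \<longrightarrow>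
        (\<Sum>(a, b)\<in>D. b - a) < \<delta> \<longrightarrow>
        (\<Sum>(a, b)\<in>D. norm (x b - x a)) < \<epsilon>)"

section \<open>The time crisis problem\<close>

definition admissible_controls :: "'u::euclidean_space set \<Rightarrow> real \<Rightarrow> (real \<Rightarrow> 'u) set" where
  "admissible_controls U T =
     {u. u \<in> borel_measurable (lebesgue_on {0..T}) \<and> (\<forall>t\<in>{0..T}. u t \<in> U)}"

text \<open>Caratheodory solutions of \<open>x' = f(x, u)\<close>, \<open>x(0) = x0\<close> on \<open>[0, T]\<close>.  Only the values
  on \<open>[0, T]\<close> matter.\<close>

definition is_state ::
  "('x::euclidean_space \<times> 'u::euclidean_space \<Rightarrow> 'x) \<Rightarrow> real \<Rightarrow> 'x \<Rightarrow> (real \<Rightarrow> 'u) \<Rightarrow> (real \<Rightarrow> 'x) \<Rightarrow> bool"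
where
  "is_state f T x0 u x \<longleftrightarrow>
     abs_continuous_on {0..T} x \<and>
     (AE t in lebesgue_on {0<..<T}. (x has_vector_derivative f (x t, u t)) (at t)) \<and>
     x 0 = x0"

definition crisis_cost :: "('x::euclidean_space \<Rightarrow> real) \<Rightarrow> 'x set \<Rightarrow> real \<Rightarrow> (real \<Rightarrow> 'x) \<Rightarrow> real" where
  "crisis_cost \<phi> K T x = \<phi> (x T) + (LINT t:{0..T}|lebesgue. indicator (- K) (x t))"

text \<open>The cost of a control \<open>u\<close> is \<open>crisis_cost \<phi> K T x\<close> for its state \<open>x\<close>.  The state is
  quantified rather than selected by a description operator, so that no junk value is compared
  if an unbounded control does not determine its state uniquely.\<close>

definition is_global_minimizer ::
  "('x::euclidean_space \<times> 'u::euclidean_space \<Rightarrow> 'x) \<Rightarrow> ('x \<Rightarrow> real) \<Rightarrow> 'x set \<Rightarrow> 'u set \<Rightarrow> real \<Rightarrow> 'x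
    \<Rightarrow> (real \<Rightarrow> 'u) \<Rightarrow> (real \<Rightarrow> 'x) \<Rightarrow> bool"
where
  "is_global_minimizer f \<phi> K U T x0 ub xb \<longleftrightarrow>
     ub \<in> admissible_controls U T \<and> is_state f T x0 ub xb \<and>
     (\<forall>u\<in>admissible_controls U T. \<forall>x. is_state f T x0 u x \<longrightarrow>
        crisis_cost \<phi> K T xb \<le> crisis_cost \<phi> K T x)"

definition crossing_out :: "'x set \<Rightarrow> real \<Rightarrow> (real \<Rightarrow> 'x) \<Rightarrow> real \<Rightarrow> bool" where
  "crossing_out K T x \<tau> \<longleftrightarrow>
     (\<exists>\<eta>>0. 0 \<le> \<tau> - \<eta> \<and> \<tau> + \<eta> \<le> T \<and>
        (\<forall>t\<in>{\<tau> - \<eta><..\<tau>}. x t \<in> K) \<and> (\<forall>t\<in>{\<tau><..<\<tau> + \<eta>}. x t \<in> - K))"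

definition crossing_in :: "'x set \<Rightarrow> real \<Rightarrow> (real \<Rightarrow> 'x) \<Rightarrow> real \<Rightarrow> bool" where
  "crossing_in K T x \<tau> \<longleftrightarrow>
     (\<exists>\<eta>>0. 0 \<le> \<tau> - \<eta> \<and> \<tau> + \<eta> \<le> T \<and>
        (\<forall>t\<in>{\<tau> - \<eta><..<\<tau>}. x t \<in> - K) \<and> (\<forall>t\<in>{\<tau>..<\<tau> + \<eta>}. x t \<in> K))"

definition crossing_time :: "'x set \<Rightarrow> real \<Rightarrow> (real \<Rightarrow> 'x) \<Rightarrow> real \<Rightarrow> bool" where
  "crossing_time K T x \<tau> \<longleftrightarrow> crossing_out K T x \<tau> \<or> crossing_in K T x \<tau>"

text \<open>Vectors indexed by the (time-dependent) subset \<open>I\<close> of constraint indices are represented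
  by vectors in \<open>real ^ 'l\<close> vanishing outside \<open>I\<close>; this preserves the Euclidean norm.\<close>

definition constraint_qualification ::
  "('u::euclidean_space \<Rightarrow> real ^ 'l) \<Rightarrow> real \<Rightarrow> (real \<Rightarrow> 'u) \<Rightarrow> bool"
where
  "constraint_qualification c T ub \<longleftrightarrow>
     (\<exists>\<epsilon>>0. \<exists>\<delta>>0. AE t in lebesgue_on {0<..<T}.
        let I = {i. c (ub t) $ i \<ge> - \<delta>} in
        \<forall>\<xi> :: real ^ 'l. (\<forall>i. i \<notin> I \<longrightarrow> \<xi> $ i = 0) \<longrightarrow>
          \<epsilon> * norm \<xi> \<le> norm (\<Sum>i\<in>I. \<xi> $ i *\<^sub>R gradient (\<lambda>u. c u $ i) (ub t)))"

section \<open>Hamiltonians and multipliers\<close>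

definition Ham :: "('x::real_inner \<times> 'u \<Rightarrow> 'x) \<Rightarrow> 'x \<Rightarrow> 'x \<Rightarrow> 'u \<Rightarrow> real" where
  "Ham f x p u = p \<bullet> f (x, u)"

definition Ham_aug ::
  "('x::real_inner \<times> 'u \<Rightarrow> 'x) \<Rightarrow> ('u \<Rightarrow> real ^ 'l) \<Rightarrow> 'x \<Rightarrow> 'x \<Rightarrow> 'u \<Rightarrow> real ^ 'l \<Rightarrow> real"
where
  "Ham_aug f c x p u \<nu> = p \<bullet> f (x, u) + \<nu> \<bullet> c u"

definition rho :: "real \<Rightarrow> real \<Rightarrow> real \<Rightarrow> real" where
  "rho T \<tau> t = (if t < \<tau> then 1 / \<tau> else - 1 / (T - \<tau>))"

text \<open>Besides its role in the multiplier space \<open>L\<^sup>\<infinity>\<close>, essential boundedness is required of the optimal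
  control: measurable controls with values in an unbounded set \<open>U\<close> can be optimal while the
  adjoint equation has no non-zero absolutely continuous solution.  The competing controls are not
  required to be bounded.\<close>

definition essentially_bounded :: "real \<Rightarrow> (real \<Rightarrow> 'a::real_normed_vector) \<Rightarrow> bool" where
  "essentially_bounded T h \<longleftrightarrow> (\<exists>M. AE t in lebesgue_on {0<..<T}. norm (h t) \<le> M)"

definition is_costate ::
  "('x::euclidean_space \<times> 'u::euclidean_space \<Rightarrow> 'x) \<Rightarrow> ('x \<Rightarrow> real) \<Rightarrow> ('x \<Rightarrow> real) \<Rightarrow> real
    \<Rightarrow> (real \<Rightarrow> 'u) \<Rightarrow> (real \<Rightarrow> 'x) \<Rightarrow> real \<Rightarrow> real \<Rightarrow> real \<Rightarrow> (real \<Rightarrow> 'x) \<Rightarrow> bool"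
where
  "is_costate f \<phi> g T ub xb \<tau> \<alpha> \<gamma> p \<longleftrightarrow>
     abs_continuous_on {0..<\<tau>} p \<and> abs_continuous_on {\<tau><..T} p \<and>
     (AE t in lebesgue_on {0<..<T}.
        (p has_vector_derivative - gradient (\<lambda>x. Ham f x (p t) (ub t)) (xb t)) (at t)) \<and>
     p T = \<alpha> *\<^sub>R gradient \<phi> (xb T) \<and>
     (\<exists>pm pp. (p \<longlongrightarrow> pm) (at_left \<tau>) \<and> (p \<longlongrightarrow> pp) (at_right \<tau>) \<and>
        pp - pm = \<gamma> *\<^sub>R gradient g (xb \<tau>))"

text \<open>Elements of \<open>L\<^sup>\<infinity>(0, T)\<close> are represented by measurable, essentially bounded functions;
  accordingly, the zero multiplier and equality of multipliers are understood up to null sets.\<close>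

definition lagrange_costate ::
  "('x::euclidean_space \<times> 'u::euclidean_space \<Rightarrow> 'x) \<Rightarrow> ('x \<Rightarrow> real) \<Rightarrow> ('u \<Rightarrow> real ^ 'l)
    \<Rightarrow> ('x \<Rightarrow> real) \<Rightarrow> real \<Rightarrow> (real \<Rightarrow> 'u) \<Rightarrow> (real \<Rightarrow> 'x) \<Rightarrow> real
    \<Rightarrow> real \<Rightarrow> real \<Rightarrow> (real \<Rightarrow> real ^ 'l) \<Rightarrow> (real \<Rightarrow> 'x) \<Rightarrow> bool"
where
  "lagrange_costate f \<phi> c g T ub xb \<tau> \<alpha> \<gamma> \<nu> p \<longleftrightarrow>
     is_costate f \<phi> g T ub xb \<tau> \<alpha> \<gamma> p \<and>
     (AE t in lebesgue_on {0<..<T}.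
        gradient (\<lambda>u. Ham_aug f c (xb t) (p t) u (\<nu> t)) (ub t) = 0) \<and>
     (LINT t:{0..T}|lebesgue. rho T \<tau> t * Ham f (xb t) (p t) (ub t)) = \<alpha>"

definition lagrange_multipliers ::
  "('x::euclidean_space \<times> 'u::euclidean_space \<Rightarrow> 'x) \<Rightarrow> ('x \<Rightarrow> real) \<Rightarrow> ('u \<Rightarrow> real ^ 'l)
    \<Rightarrow> ('x \<Rightarrow> real) \<Rightarrow> real \<Rightarrow> (real \<Rightarrow> 'u) \<Rightarrow> (real \<Rightarrow> 'x) \<Rightarrow> real
    \<Rightarrow> (real \<times> real \<times> (real \<Rightarrow> real ^ 'l)) set"
where
  "lagrange_multipliers f \<phi> c g T ub xb \<tau> =
     {(\<alpha>, \<gamma>, \<nu>).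
        \<alpha> \<ge> 0 \<and>
        \<nu> \<in> borel_measurable (lebesgue_on {0<..<T}) \<and> essentially_bounded T \<nu> \<and>
        \<not> (\<alpha> = 0 \<and> \<gamma> = 0 \<and> (AE t in lebesgue_on {0<..<T}. \<nu> t = 0)) \<and>
        (AE t in lebesgue_on {0<..<T}. (\<forall>i. 0 \<le> \<nu> t $ i) \<and> \<nu> t \<bullet> c (ub t) = 0) \<and>
        (\<exists>p. lagrange_costate f \<phi> c g T ub xb \<tau> \<alpha> \<gamma> \<nu> p)}"

definition pontryagin_multipliers ::
  "('x::euclidean_space \<times> 'u::euclidean_space \<Rightarrow> 'x) \<Rightarrow> ('x \<Rightarrow> real) \<Rightarrow> ('u \<Rightarrow> real ^ 'l)
    \<Rightarrow> ('x \<Rightarrow> real) \<Rightarrow> 'u set \<Rightarrow> real \<Rightarrow> (real \<Rightarrow> 'u) \<Rightarrow> (real \<Rightarrow> 'x) \<Rightarrow> real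
    \<Rightarrow> (real \<times> real \<times> (real \<Rightarrow> real ^ 'l)) set"
where
  "pontryagin_multipliers f \<phi> c g U T ub xb \<tau> =
     {(\<alpha>, \<gamma>, \<nu>). (\<alpha>, \<gamma>, \<nu>) \<in> lagrange_multipliers f \<phi> c g T ub xb \<tau> \<and>
        (\<exists>p. lagrange_costate f \<phi> c g T ub xb \<tau> \<alpha> \<gamma> \<nu> p \<and>
          (AE t in lebesgue_on {0<..<T}.
             \<forall>u\<in>U. Ham f (xb t) (p t) (ub t) \<le> Ham f (xb t) (p t) u))}"

end

theory Submission
  imports Defs
begin

text \<open>
  Replacing the control by a constant on a short interval before time \<open>s\<close> (a needle) changes the state
  to first order by the solution of the linearized equation, which is never solved: it is tested
  against solutions of the adjoint equation.  Let \<open>P\<close> and \<open>Q\<close> be the adjoint solutions with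
  \<open>P T = \<nabla>\<phi>\<close> and \<open>Q \<tau> = \<nabla>g\<close>.  A needle at \<open>s < \<tau>\<close> with velocity increment \<open>y\<close> moves the crossing
  time by about \<open>- e * (Q s \<bullet> y) / (\<nabla>g \<bullet> f um)\<close>; keeping in addition the jump of the control at the
  new crossing time, the change of the cost is \<open>e * ((P s - \<gamma> *\<^sub>R Q s) \<bullet> y)\<close> with one particular \<open>\<gamma>\<close>.
  Optimality thus gives the minimum condition for \<open>P - \<gamma> *\<^sub>R Q\<close> before \<open>\<tau>\<close> and for \<open>P\<close> after \<open>\<tau>\<close>.

  Conversely, the costate of any multiplier is \<open>\<alpha> *\<^sub>R P - \<gamma> *\<^sub>R Q\<close> before and \<open>\<alpha> *\<^sub>R P\<close> after \<open>\<tau>\<close>.  By the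
  minimum condition the Hamiltonian is constant on both intervals, so condition (iv) only involves
  its one-sided values at \<open>\<tau>\<close> and, by transversality, determines \<open>\<gamma>\<close> as \<open>\<alpha>\<close> times a fixed number.
  The qualification condition then determines \<open>\<nu>\<close>, and \<open>\<alpha> = 0\<close> would make the whole triple vanish.
\<close>

section \<open>Absolutely continuous functions\<close>

text \<open>The obstacle is that the crossing time of a perturbed trajectory is hard to compute. Two
  devices avoid computing it. First, optimality is tested against an upper bound of the perturbed
  cost, so it suffices that the perturbed trajectory stays in \<open>K\<close> up to a guessed time
  \<open>\<tau> - \<theta> * e\<close>. A strict inequality on \<theta> leaves a margin for this,
  and the sharp value of \<theta> is reached by a limit at the end. Second, the jump of the control
  is moved along with the guessed time. If the jump stayed at \<tau>, an early crossing would happen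
  at velocity \<open>f (xb \<tau>, um)\<close> and a late one at velocity
  \<open>f (xb \<tau>, up)\<close>, so the shift would have different rates in the two directions.
  With the moved jump both signs of \<theta> obey one linear formula, and a single \<gamma> serves
  for all needles. Since \<open>U\<close> may be unbounded, all estimates are relative to a bound
  \<open>M\<close> on the controls, which can be enlarged to admit any given needle value.\<close>

lemma AE_lebesgue_on_iff_negligible:
  assumes "S \<in> sets lebesgue"
  shows "(AE t in lebesgue_on S. P t) \<longleftrightarrow> negligible {t \<in> S. \<not> P t}"
proof
  assume "AE t in lebesgue_on S. P t"
  then have "AE t in lebesgue. t \<in> S \<longrightarrow> P t"
    using assms by (simp add: AE_restrict_space_iff)
  then obtain N where "N \<in> null_sets lebesgue" "{t. \<not> (t \<in> S \<longrightarrow> P t)} \<subseteq> N"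
    by (auto simp: eventually_ae_filter)
  then have "negligible N" "{t \<in> S. \<not> P t} \<subseteq> N"
    by (auto simp: negligible_iff_null_sets)
  then show "negligible {t \<in> S. \<not> P t}"
    by (rule negligible_subset)
next
  assume "negligible {t \<in> S. \<not> P t}"
  then have "{t \<in> S. \<not> P t} \<in> null_sets lebesgue"
    by (simp add: negligible_iff_null_sets)
  then have "AE t in lebesgue. t \<in> S \<longrightarrow> P t"
    by (rule AE_I') auto
  then show "AE t in lebesgue_on S. P t"
    using assms by (simp add: AE_restrict_space_iff)
qed

lemma AE_lebesgue_on_subset:
  assumes "AE t in lebesgue_on S. P t" "R \<subseteq> S" "S \<in> sets lebesgue" "R \<in> sets lebesgue"
  shows "AE t in lebesgue_on R. P t"
  using assms unfolding AE_lebesgue_on_iff_negligible[OF assms(3)] AE_lebesgue_on_iff_negligible[OF assms(4)]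
  by (rule_tac negligible_subset) auto

lemma AE_lebesgue_on_mem:
  assumes "S \<in> sets lebesgue"
  shows "AE t in lebesgue_on S. t \<in> S"
  using assms by (subst AE_lebesgue_on_iff_negligible) auto

section \<open>Elementary properties of absolute continuity\<close>

lemma abs_continuous_onE:
  assumes "abs_continuous_on S x" "e > 0"
  obtains d where "d > 0" "\<forall>D. finite D \<longrightarrow> (\<forall>(a, b)\<in>D. a \<le> b \<and> {a..b} \<subseteq> S) \<longrightarrow>
        pairwise (\<lambda>(a, b) (c, d). {a<..<b} \<inter> {c<..<d} = {}) D \<longrightarrow>
        (\<Sum>(a, b)\<in>D. b - a) < d \<longrightarrow> (\<Sum>(a, b)\<in>D. norm (x b - x a)) < e"
  using assms unfolding abs_continuous_on_def by blast

lemma abs_continuous_on_subset: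
  assumes "abs_continuous_on S x" "R \<subseteq> S"
  shows "abs_continuous_on R x"
  unfolding abs_continuous_on_def
proof (intro allI impI)
  fix e :: real assume "e > 0"
  obtain d where d: "d > 0" "\<forall>D. finite D \<longrightarrow> (\<forall>(a, b)\<in>D. a \<le> b \<and> {a..b} \<subseteq> S) \<longrightarrow>
        pairwise (\<lambda>(a, b) (c, d). {a<..<b} \<inter> {c<..<d} = {}) D \<longrightarrow>
        (\<Sum>(a, b)\<in>D. b - a) < d \<longrightarrow> (\<Sum>(a, b)\<in>D. norm (x b - x a)) < e"
    using abs_continuous_onE[OF assms(1) \<open>e > 0\<close>] .
  show "\<exists>d>0. \<forall>D. finite D \<longrightarrow> (\<forall>(a, b)\<in>D. a \<le> b \<and> {a..b} \<subseteq> R) \<longrightarrow>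
        pairwise (\<lambda>(a, b) (c, d). {a<..<b} \<inter> {c<..<d} = {}) D \<longrightarrow>
        (\<Sum>(a, b)\<in>D. b - a) < d \<longrightarrow> (\<Sum>(a, b)\<in>D. norm (x b - x a)) < e"
  proof (intro exI[of _ d] conjI allI impI d(1))
    fix D assume D: "finite D" "\<forall>(a, b)\<in>D. a \<le> b \<and> {a..b} \<subseteq> R"
      "pairwise (\<lambda>(a, b) (c, d). {a<..<b} \<inter> {c<..<d} = {}) D" "(\<Sum>(a, b)\<in>D. b - a) < d"
    have "\<forall>(a, b)\<in>D. a \<le> b \<and> {a..b} \<subseteq> S"
      using D(2) assms(2) by fast
    with D d(2) show "(\<Sum>(a, b)\<in>D. norm (x b - x a)) < e" by blast
  qed
qed

lemma lipschitz_on_imp_abs_continuous_on: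
  fixes x :: "real \<Rightarrow> 'a::real_normed_vector"
  assumes "C-lipschitz_on S x"
  shows "abs_continuous_on S x"
  unfolding abs_continuous_on_def
proof (intro allI impI)
  fix e :: real assume "e > 0"
  have C: "C \<ge> 0" using assms by (rule lipschitz_on_nonneg)
  show "\<exists>d>0. \<forall>D. finite D \<longrightarrow> (\<forall>(a, b)\<in>D. a \<le> b \<and> {a..b} \<subseteq> S) \<longrightarrow>
        pairwise (\<lambda>(a, b) (c, d). {a<..<b} \<inter> {c<..<d} = {}) D \<longrightarrow>
        (\<Sum>(a, b)\<in>D. b - a) < d \<longrightarrow> (\<Sum>(a, b)\<in>D. norm (x b - x a)) < e"
  proof (intro exI[of _ "e / (C + 1)"] conjI allI impI)
    fix D :: "(real \<times> real) set"
    assume D: "finite D" "\<forall>(a, b)\<in>D. a \<le> b \<and> {a..b} \<subseteq> S" "(\<Sum>(a, b)\<in>D. b - a) < e / (C + 1)"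
    have "(\<Sum>(a, b)\<in>D. norm (x b - x a)) \<le> (\<Sum>(a, b)\<in>D. C * (b - a))"
    proof (rule sum_mono, clarify)
      fix a b assume "(a, b) \<in> D"
      then have "a \<le> b" "{a..b} \<subseteq> S" using D(2) by auto
      then have "a \<le> b" "a \<in> S" "b \<in> S" by auto
      then show "norm (x b - x a) \<le> C * (b - a)"
        using lipschitz_onD[OF assms, of b a] by (simp add: dist_norm)
    qed
    also have "\<dots> = C * (\<Sum>(a, b)\<in>D. b - a)"
      by (simp add: sum_distrib_left case_prod_beta)
    also have "\<dots> \<le> C * (e / (C + 1))"
      using C D(3) by (intro mult_left_mono) auto
    also have "\<dots> < e" using C \<open>e > 0\<close> by (simp add: field_simps)
    finally show "(\<Sum>(a, b)\<in>D. norm (x b - x a)) < e" .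
  qed (use C \<open>e > 0\<close> in auto)
qed

lemma abs_continuous_on_imp_uniformly_continuous:
  assumes "abs_continuous_on {a..b} x" "e > 0"
  obtains d where "d > 0" "\<And>s t. a \<le> s \<Longrightarrow> s \<le> t \<Longrightarrow> t \<le> b \<Longrightarrow> t - s < d \<Longrightarrow> norm (x t - x s) < e"
proof -
  obtain d where d: "d > 0" "\<forall>D. finite D \<longrightarrow> (\<forall>(u, v)\<in>D. u \<le> v \<and> {u..v} \<subseteq> {a..b}) \<longrightarrow>
        pairwise (\<lambda>(a, b) (c, d). {a<..<b} \<inter> {c<..<d} = {}) D \<longrightarrow>
        (\<Sum>(a, b)\<in>D. b - a) < d \<longrightarrow> (\<Sum>(a, b)\<in>D. norm (x b - x a)) < e"
    using abs_continuous_onE[OF assms] .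
  show thesis
  proof (rule that[OF d(1)])
    fix s t assume "a \<le> s" "s \<le> t" "t \<le> b" "t - s < d"
    then show "norm (x t - x s) < e" using d(2)[rule_format, of "{(s, t)}"] by simp
  qed
qed

lemma abs_continuous_on_imp_continuous_on:
  fixes x :: "real \<Rightarrow> 'a::real_normed_vector"
  assumes "abs_continuous_on {a..b} x"
  shows "continuous_on {a..b} x"
  unfolding continuous_on_iff
proof (intro ballI allI impI)
  fix s e :: real assume s: "s \<in> {a..b}" and "e > 0"
  obtain d where d: "d > 0" "\<And>s t. a \<le> s \<Longrightarrow> s \<le> t \<Longrightarrow> t \<le> b \<Longrightarrow> t - s < d \<Longrightarrow> norm (x t - x s) < e"
    using abs_continuous_on_imp_uniformly_continuous[OF assms \<open>e > 0\<close>] by blast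
  have "dist (x t) (x s) < e" if "t \<in> {a..b}" "dist t s < d" for t
    using d(2)[of s t] d(2)[of t s] that s
    by (cases "s \<le> t") (auto simp: dist_norm norm_minus_commute dist_real_def)
  with d(1) show "\<exists>d>0. \<forall>t\<in>{a..b}. dist t s < d \<longrightarrow> dist (x t) (x s) < e" by blast
qed

text \<open>The gauge of the tags in the exceptional null set comes from the fact that the indicator
  function of that set has integral zero; absolute continuity then controls their contribution.\<close>

lemma abs_continuous_on_has_integral:
  fixes x :: "real \<Rightarrow> 'a::euclidean_space"
  assumes ac: "abs_continuous_on {a..b} x" and "a \<le> b"
    and der: "AE t in lebesgue_on {a<..<b}. (x has_vector_derivative h t) (at t)"
  shows "(h has_integral (x b - x a)) {a..b}"
proof -
  \<comment> \<open>The endpoints join the exceptional set because derivatives are assumed at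
    interior points only.\<close>
  define N where "N = {t \<in> {a<..<b}. \<not> (x has_vector_derivative h t) (at t)} \<union> {a, b}"
  have N: "negligible N"
    using der unfolding N_def by (simp add: AE_lebesgue_on_iff_negligible negligible_Un)
  define h0 where "h0 t = (if t \<in> N then 0 else h t)" for t
  have "(h0 has_integral (x b - x a)) (cbox a b)"
    unfolding has_integral
  proof (intro allI impI)
    fix e :: real assume e: "e > 0"
    \<comment> \<open>The tags outside \<open>N\<close> may use up half of the tolerance over the
      total length \<open>b - a\<close>; the extra 2 keeps the denominator positive when
      \<open>a = b\<close>.\<close>
    define e' where "e' = e / (2 * (b - a) + 2)"
    have e': "e' > 0" using e \<open>a \<le> b\<close> by (simp add: e'_def)
    have "\<exists>d>0. \<forall>u. \<bar>u - t\<bar> < d \<longrightarrow> norm (x u - x t - (u - t) *\<^sub>R h t) \<le> e' * \<bar>u - t\<bar>"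
      if "t \<in> {a..b} - N" for t
    proof -
      have "(x has_vector_derivative h t) (at t)" using that by (auto simp: N_def)
      then show ?thesis
        using e' unfolding has_vector_derivative_def has_derivative_at_alt by (auto simp: mult.commute)
    qed
    then obtain d where d: "\<And>t. t \<in> {a..b} - N \<Longrightarrow> d t > 0"
      "\<And>t u. t \<in> {a..b} - N \<Longrightarrow> \<bar>u - t\<bar> < d t \<Longrightarrow> norm (x u - x t - (u - t) *\<^sub>R h t) \<le> e' * \<bar>u - t\<bar>"
      by metis
    obtain \<delta> where \<delta>: "\<delta> > 0" "\<forall>D. finite D \<longrightarrow> (\<forall>(u, v)\<in>D. u \<le> v \<and> {u..v} \<subseteq> {a..b}) \<longrightarrow>
        pairwise (\<lambda>(a, b) (c, d). {a<..<b} \<inter> {c<..<d} = {}) D \<longrightarrow>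
        (\<Sum>(a, b)\<in>D. b - a) < \<delta> \<longrightarrow> (\<Sum>(a, b)\<in>D. norm (x b - x a)) < e / 2"
      using abs_continuous_onE[OF ac half_gt_zero[OF e]] .
    have "((indicator N :: real \<Rightarrow> real) has_integral 0) (cbox a b)"
      using N by (simp add: negligible_def)
    then have "\<exists>g. gauge g \<and> (\<forall>D. D tagged_division_of (cbox a b) \<and> g fine D \<longrightarrow>
        norm ((\<Sum>(t, k)\<in>D. measure lborel k *\<^sub>R (indicator N t :: real)) - 0) < \<delta>)"
      using \<delta>(1) unfolding has_integral by (elim allE[of _ \<delta>]) simp
    then obtain g where g: "gauge g" "\<forall>D. D tagged_division_of (cbox a b) \<and> g fine D \<longrightarrow>
        norm ((\<Sum>(t, k)\<in>D. measure lborel k *\<^sub>R (indicator N t :: real)) - 0) < \<delta>"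
      by blast
    define G where "G t = (if t \<in> {a..b} - N then g t \<inter> ball t (d t) else g t)" for t
    have "gauge G"
      using g(1) d(1) by (auto simp: G_def gauge_def)
    moreover have "norm ((\<Sum>(t, k)\<in>D. measure lborel k *\<^sub>R h0 t) - (x b - x a)) < e"
      if D: "D tagged_division_of (cbox a b)" "G fine D" for D
    proof -
      have fin: "finite D" using D(1) by auto
      have gD: "g fine D" using D(2) by (force simp: fine_def G_def split: if_splits)
      have KK: "Inf k \<le> t \<and> t \<le> Sup k \<and> a \<le> Inf k \<and> Sup k \<le> b \<and> k = {Inf k..Sup k}"
        if tk: "(t, k) \<in> D" for t k
      proof -
        obtain u v where uv: "k = cbox u v" using tagged_division_ofD(4)[OF D(1) tk] by blast
        have "t \<in> k" "k \<subseteq> cbox a b" using tagged_division_ofD(2,3)[OF D(1) tk] by auto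
        then show ?thesis unfolding uv by auto
      qed
      have K: "Inf k \<le> t \<and> t \<le> Sup k \<and> a \<le> Inf k \<and> Sup k \<le> b" if "(t, k) \<in> D" for t k
        using KK[OF that] by blast
      have Keq: "k = {Inf k..Sup k}" if "(t, k) \<in> D" for t k
        using KK[OF that] by blast
      have Kc: "measure lborel k = Sup k - Inf k" if "(t, k) \<in> D" for t k
      proof -
        have "measure lborel {Inf k..Sup k} = Sup k - Inf k"
          using K[OF that] by (intro content_real) linarith
        then show ?thesis using Keq[OF that] by simp
      qed
      have "(\<Sum>(t, k)\<in>D. measure lborel k *\<^sub>R h0 t) - (x b - x a)
          = (\<Sum>(t, k)\<in>D. measure lborel k *\<^sub>R h0 t - (x (Sup k) - x (Inf k)))"
        using additive_tagged_division_1[OF \<open>a \<le> b\<close>, of D x] D(1)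
        by (simp add: sum_subtractf case_prod_beta)
      also have "norm \<dots> \<le> (\<Sum>(t, k)\<in>D. norm (measure lborel k *\<^sub>R h0 t - (x (Sup k) - x (Inf k))))"
        by (rule order.trans[OF norm_sum]) (simp add: case_prod_beta)
      also have "\<dots> \<le> (\<Sum>(t, k)\<in>D. e' * measure lborel k + indicator N t * norm (x (Sup k) - x (Inf k)))"
      proof (rule sum_mono, clarify)
        fix t k assume tk: "(t, k) \<in> D"
        note k = K[OF tk]
        note c = Kc[OF tk]
        show "norm (measure lborel k *\<^sub>R h0 t - (x (Sup k) - x (Inf k)))
            \<le> e' * measure lborel k + indicator N t * norm (x (Sup k) - x (Inf k))"
        proof (cases "t \<in> N")
          case True
          moreover have "0 \<le> e' * (Sup k - Inf k)" using e' k by (intro mult_nonneg_nonneg) linarith+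
          ultimately show ?thesis by (simp add: h0_def c norm_minus_commute)
        next
          case False
          then have t: "t \<in> {a..b} - N" using k by auto
          \<comment> \<open>Straddling: both endpoints are compared with the tag, which lies between
            them, so the two errors add up to \<open>e'\<close> times the length of
            \<open>k\<close>.\<close>
          have "k \<subseteq> ball t (d t)" using D(2) tk t by (fastforce simp: fine_def G_def)
          moreover have "Sup k \<in> k" "Inf k \<in> k"
            using k by (subst (2) Keq[OF tk], simp)+
          ultimately have "\<bar>Sup k - t\<bar> < d t" "\<bar>Inf k - t\<bar> < d t"
            by (auto simp: subset_iff dist_real_def abs_minus_commute)
          then have "norm (x (Sup k) - x t - (Sup k - t) *\<^sub>R h t) \<le> e' * (Sup k - t)"
            "norm (x (Inf k) - x t - (Inf k - t) *\<^sub>R h t) \<le> e' * (t - Inf k)"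
            using d(2)[OF t, of "Sup k"] d(2)[OF t, of "Inf k"] k by auto
          then have "norm ((x (Inf k) - x t - (Inf k - t) *\<^sub>R h t) - (x (Sup k) - x t - (Sup k - t) *\<^sub>R h t))
              \<le> e' * (t - Inf k) + e' * (Sup k - t)"
            by (rule_tac order.trans[OF norm_triangle_ineq4]) linarith
          moreover have "(x (Inf k) - x t - (Inf k - t) *\<^sub>R h t) - (x (Sup k) - x t - (Sup k - t) *\<^sub>R h t)
              = (Sup k - Inf k) *\<^sub>R h t - (x (Sup k) - x (Inf k))"
            by (simp add: algebra_simps)
          ultimately show ?thesis using False by (simp add: h0_def c algebra_simps)
        qed
      qed
      also have "\<dots> = e' * (\<Sum>(t, k)\<in>D. measure lborel k)
          + (\<Sum>(t, k)\<in>D. indicator N t * norm (x (Sup k) - x (Inf k)))"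
        by (simp add: sum.distrib sum_distrib_left case_prod_beta)
      also have "(\<Sum>(t, k)\<in>D. measure lborel k) = b - a"
        using additive_content_tagged_division[of D a b] D(1) \<open>a \<le> b\<close> by simp
      also have "(\<Sum>(t, k)\<in>D. indicator N t * norm (x (Sup k) - x (Inf k))) < e / 2"
      proof -
        define D1 where "D1 = {i \<in> D. fst i \<in> N}"
        define q where "q = (\<lambda>(t::real, k). (Inf k, Sup k :: real))"
        have D1: "finite D1" "D1 \<subseteq> D" using fin by (auto simp: D1_def indicator_def)
        have overlap: "{Inf k<..<Sup k} \<inter> {Inf l<..<Sup l} = {}"
          if "(t, k) \<in> D" "(s, l) \<in> D" "(t, k) \<noteq> (s, l)" for t k s l
        proof -
          have "k = {Inf k..Sup k}" "l = {Inf l..Sup l}" using Keq that by blast+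
          then have "interior k = {Inf k<..<Sup k}" "interior l = {Inf l<..<Sup l}"
            by (metis interior_atLeastAtMost_real)+
          then show ?thesis using tagged_division_ofD(5)[OF D(1) that] by simp
        qed
        \<comment> \<open>Absolute continuity speaks of a set of endpoint pairs, whereas a division
          is a set of tagged intervals. Distinct tagged intervals with equal endpoints are
          degenerate, so passing to the image under \<open>q\<close> loses only zero
          summands.\<close>
        have nontriv: "Inf k = Sup k"
          if "(t, k) \<in> D" "(s, l) \<in> D" "(t, k) \<noteq> (s, l)" "Inf k = Inf l" "Sup k = Sup l" for t k s l
        proof (rule ccontr)
          assume "Inf k \<noteq> Sup k"
          then have "Inf k < Sup k" using K[OF that(1)] by linarith
          then obtain z where "Inf k < z" "z < Sup k" using dense by blast
          then show False using overlap[OF that(1-3)] that(4,5) by auto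
        qed
        have q0: "fst (q i) = snd (q i)" if "i \<in> D1" "j \<in> D1" "i \<noteq> j" "q i = q j" for i j
        proof -
          obtain t k s l where ij: "i = (t, k)" "j = (s, l)" by (cases i, cases j)
          then have "(t, k) \<in> D" "(s, l) \<in> D" "(t, k) \<noteq> (s, l)" using that D1(2) by blast+
          moreover have "Inf k = Inf l" "Sup k = Sup l" using that(4) ij by (simp_all add: q_def)
          ultimately show ?thesis using nontriv[of t k s l] ij by (simp add: q_def)
        qed
        have 1: "(\<Sum>(u, v)\<in>q ` D1. v - u) = (\<Sum>(t, k)\<in>D1. Sup k - Inf k)"
        proof (subst sum.reindex_nontrivial[OF D1(1)])
          fix i j assume "i \<in> D1" "j \<in> D1" "i \<noteq> j" "q i = q j"
          then show "(case q i of (u, v) \<Rightarrow> v - u) = 0"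
            using q0[of i j] by (simp add: case_prod_beta)
        qed (simp add: q_def case_prod_beta)
        have 2: "(\<Sum>(u, v)\<in>q ` D1. norm (x v - x u)) = (\<Sum>(t, k)\<in>D1. norm (x (Sup k) - x (Inf k)))"
        proof (subst sum.reindex_nontrivial[OF D1(1)])
          fix i j assume "i \<in> D1" "j \<in> D1" "i \<noteq> j" "q i = q j"
          then show "(case q i of (u, v) \<Rightarrow> norm (x v - x u)) = 0"
            using q0[of i j] by (simp add: case_prod_beta)
        qed (simp add: q_def case_prod_beta)
        have "(\<Sum>(t, k)\<in>D1. Sup k - Inf k) = (\<Sum>(t, k)\<in>D. measure lborel k *\<^sub>R (indicator N t :: real))"
        proof (rule sum.mono_neutral_cong_left[OF fin D1(2)])
          show "\<forall>i\<in>D - D1. (case i of (t, k) \<Rightarrow> measure lborel k *\<^sub>R (indicator N t :: real)) = 0"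
            by (auto simp: D1_def indicator_def)
          fix i assume i: "i \<in> D1"
          obtain t k where tk: "i = (t, k)" by fastforce
          have "measure lborel k = Sup k - Inf k" using Kc[of t k] i tk D1(2) by auto
          then show "(case i of (t, k) \<Rightarrow> Sup k - Inf k) = (case i of (t, k) \<Rightarrow> measure lborel k *\<^sub>R (indicator N t :: real))"
            using i tk by (auto simp: D1_def indicator_def)
        qed
        also have "\<dots> < \<delta>" using g(2)[rule_format, OF conjI[OF D(1) gD]] by simp
        finally have 3: "(\<Sum>(u, v)\<in>q ` D1. v - u) < \<delta>" using 1 by simp
        have "(\<Sum>(u, v)\<in>q ` D1. norm (x v - x u)) < e / 2"
        proof (rule \<delta>(2)[rule_format])
          show "finite (q ` D1)" using D1(1) by simp
          fix i assume i: "i \<in> q ` D1"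
          then obtain t k where tk: "(t, k) \<in> D" "i = (Inf k, Sup k)" using D1(2) by (auto simp: q_def)
          then show "case i of (u, v) \<Rightarrow> u \<le> v \<and> {u..v} \<subseteq> {a..b}"
            using K[OF tk(1)] by auto
        next
          show "pairwise (\<lambda>(a, b) (c, d). {a<..<b} \<inter> {c<..<d} = {}) (q ` D1)"
            unfolding pairwise_def
          proof (intro ballI impI)
            fix i j assume ij: "i \<in> q ` D1" "j \<in> q ` D1" "i \<noteq> j"
            then obtain t k where tk: "(t, k) \<in> D" "i = (Inf k, Sup k)" using D1(2) by (auto simp: q_def)
            from ij obtain s l where sl: "(s, l) \<in> D" "j = (Inf l, Sup l)" using D1(2) by (auto simp: q_def)
            from tk sl show "(case i of (a, b) \<Rightarrow> \<lambda>(c, d). {a<..<b} \<inter> {c<..<d} = {}) j"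
              using overlap[of t k s l] ij(3) by auto
          qed
        qed (rule 3)
        moreover have "(\<Sum>(t, k)\<in>D1. norm (x (Sup k) - x (Inf k)))
            = (\<Sum>(t, k)\<in>D. indicator N t * norm (x (Sup k) - x (Inf k)))"
          by (rule sum.mono_neutral_cong_left[OF fin D1(2)]) (auto simp: D1_def indicator_def)
        ultimately show ?thesis using 2 by simp
      qed
      also have "e' * (b - a) + e / 2 \<le> e"
        using e \<open>a \<le> b\<close> by (simp add: e'_def field_simps)
      finally show ?thesis by simp
    qed
    ultimately show "\<exists>\<gamma>. gauge \<gamma> \<and> (\<forall>D. D tagged_division_of cbox a b \<and> \<gamma> fine D \<longrightarrow>
        norm ((\<Sum>(t, k)\<in>D. measure lborel k *\<^sub>R h0 t) - (x b - x a)) < e)"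
      by (intro exI[of _ G]) simp
  qed
  then have "(h0 has_integral (x b - x a)) {a..b}" by simp
  then show ?thesis
    by (rule has_integral_spike[OF N, rotated]) (auto simp: h0_def)
qed

text \<open>Henstock's lemma bounds the total length of disjoint intervals on which the difference
  quotient is bad; a Vitali covering by such intervals exhausts the bad points.\<close>

lemma has_vector_derivative_integral_AE:
  fixes h :: "real \<Rightarrow> 'a::euclidean_space"
  assumes h: "h integrable_on {a..b}"
  shows "AE t in lebesgue_on {a<..<b}. ((\<lambda>t. integral {a..t} h) has_vector_derivative h t) (at t)"
proof -
  define F where "F t = integral {a..t} h" for t
  \<comment> \<open>\<open>B k\<close> collects the points where the error quotient exceeds
    \<open>1 / (k + 1)\<close> at arbitrarily small scales; outside all of these sets the derivative
    exists.\<close>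
  define B where "B k = {t \<in> {a<..<b}. \<forall>d>0. \<exists>s\<in>{a..b}. 0 < \<bar>s - t\<bar> \<and> \<bar>s - t\<bar> < d \<and>
      \<bar>s - t\<bar> < real (Suc k) * norm (F s - F t - (s - t) *\<^sub>R h t)}" for k
  have "negligible (B k)" for k
    unfolding negligible_outer_le
  proof (intro allI impI)
    fix e :: real assume "e > 0"
    then have "e / real (Suc k) > 0" by simp
    then obtain g where g: "gauge g" "\<And>p. p tagged_partial_division_of cbox a b \<Longrightarrow> g fine p \<Longrightarrow>
        (\<Sum>(t, l)\<in>p. norm (measure lborel l *\<^sub>R h t - integral l h)) < e / real (Suc k)"
      using Henstock_lemma[of h a b "e / real (Suc k)"] h by auto
    \<comment> \<open>The interval between \<open>t\<close> and \<open>s\<close> is rewritten as a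
      closed ball with center \<open>c\<close> and radius \<open>r\<close>, the shape used in the
      Vitali covering.\<close>
    define I where "I = (\<lambda>(t::real, s). {min t s..max t s})"
    define c where "c = (\<lambda>(t::real, s). (t + s) / 2)"
    define r where "r = (\<lambda>(t::real, s). \<bar>s - t\<bar> / 2)"
    have I_eq: "I i = cball (c i) (r i)" for i
      by (cases i) (auto simp: I_def c_def r_def cball_eq_atLeastAtMost min_def max_def field_simps)
    have content_I: "measure lborel (I (t, s)) = \<bar>s - t\<bar>" "measure lebesgue (I (t, s)) = \<bar>s - t\<bar>" for t s
      by (auto simp: I_def min_def max_def)
    define K where "K = {(t, s). t \<in> B k \<and> s \<in> {a..b} \<and> 0 < \<bar>s - t\<bar> \<and> I (t, s) \<subseteq> g t \<and>
      \<bar>s - t\<bar> < real (Suc k) * norm (F s - F t - (s - t) *\<^sub>R h t)}"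
    have pos: "0 < r i" if "i \<in> K" for i using that by (auto simp: K_def r_def)
    have cover: "\<exists>i. i \<in> K \<and> t \<in> cball (c i) (r i) \<and> r i < d" if "t \<in> B k" "0 < d" for t d
    proof -
      obtain q where q: "q > 0" "ball t q \<subseteq> g t"
        using g(1) openE[of "g t" t] unfolding gauge_def by blast
      have "min q d > 0" using q(1) that(2) by simp
      then have "\<exists>s\<in>{a..b}. 0 < \<bar>s - t\<bar> \<and> \<bar>s - t\<bar> < min q d \<and>
          \<bar>s - t\<bar> < real (Suc k) * norm (F s - F t - (s - t) *\<^sub>R h t)"
        using that(1) unfolding B_def mem_Collect_eq by fast
      then obtain s where s: "s \<in> {a..b}" "0 < \<bar>s - t\<bar>" "\<bar>s - t\<bar> < q" "\<bar>s - t\<bar> < d"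
          "\<bar>s - t\<bar> < real (Suc k) * norm (F s - F t - (s - t) *\<^sub>R h t)" by auto
      have "I (t, s) \<subseteq> ball t q"
        using s(3) by (auto simp: I_def dist_real_def)
      then have "(t, s) \<in> K" using s q(2) that(1) by (auto simp: K_def)
      moreover have "t \<in> cball (c (t, s)) (r (t, s))" unfolding I_eq[symmetric] by (auto simp: I_def)
      moreover have "r (t, s) < d" using s by (auto simp: r_def)
      ultimately show ?thesis by blast
    qed
    obtain C where C: "countable C" "C \<subseteq> K"
      "pairwise (\<lambda>i j. disjnt (cball (c i) (r i)) (cball (c j) (r j))) C"
      "negligible (B k - (\<Union>i\<in>C. cball (c i) (r i)))"
      by (rule Vitali_covering_theorem_cballs[of K r "B k" c, OF pos cover])
    have bound: "measure lebesgue (\<Union>i\<in>C'. I i) \<le> e" if C': "C' \<subseteq> C" "finite C'" for C'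
    proof -
      define p where "p = (\<lambda>i. (fst i, I i)) ` C'"
      have disj: "I i \<inter> I j = {}" if "i \<in> C'" "j \<in> C'" "i \<noteq> j" for i j
        using C(3) C'(1) that by (auto simp: pairwise_def I_eq disjnt_def)
      have ne: "I i \<noteq> {}" for i by (cases i) (auto simp: I_def)
      have inj: "inj_on (\<lambda>i. (fst i, I i)) C'"
        using disj ne by (intro inj_onI) (metis Pair_inject inf.idem)
      have pE: "\<exists>s. (t, s) \<in> C' \<and> l = I (t, s)" if "(t, l) \<in> p" for t l
        using that by (auto simp: p_def)
      have p: "p tagged_partial_division_of cbox a b"
        unfolding tagged_partial_division_of_def
      proof (intro conjI allI impI)
        show "finite p" using C'(2) by (simp add: p_def)
        fix t l assume tl: "(t, l) \<in> p"
        then obtain s where s: "(t, s) \<in> C'" "l = I (t, s)" by (auto simp: p_def)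
        then have "(t, s) \<in> K" using C(2) C'(1) by blast
        then show "t \<in> l" "l \<subseteq> cbox a b" "\<exists>u v. l = cbox u v"
          unfolding s(2) by (auto simp: K_def I_def B_def min_def max_def)
      next
        fix t l t' l' assume tl': "(t, l) \<in> p \<and> (t', l') \<in> p \<and> (t, l) \<noteq> (t', l')"
        from tl' obtain s where s: "(t, s) \<in> C'" "l = I (t, s)" using pE by blast
        from tl' obtain s' where "(t', s') \<in> C'" "l' = I (t', s')" using pE by blast
        then obtain j where j: "j \<in> C'" "l' = I j" "t' = fst j" by (metis fst_conv)
        moreover have "j \<noteq> (t, s)" using tl' j s(2) by auto
        ultimately show "interior l \<inter> interior l' = {}"
          using disj[of "(t, s)" j] s interior_subset by blast
      qed
      have "measure lebesgue (\<Union>i\<in>C'. I i) \<le> (\<Sum>i\<in>C'. measure lebesgue (I i))"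
        using C'(2) by (intro measure_UNION_le) (auto simp: I_eq)
      also have "\<dots> \<le> (\<Sum>i\<in>C'. real (Suc k) * norm (measure lborel (I i) *\<^sub>R h (fst i) - integral (I i) h))"
      proof (rule sum_mono)
        fix i assume i: "i \<in> C'"
        obtain t s where ts: "i = (t, s)" by (cases i)
        have tsK: "(t, s) \<in> K" using i ts C(2) C'(1) by blast
        then have t: "a < t" "t < b" "a \<le> s" "s \<le> b" by (auto simp: K_def B_def)
        have "norm (F s - F t - (s - t) *\<^sub>R h t) = norm (\<bar>s - t\<bar> *\<^sub>R h t - integral (I (t, s)) h)"
        proof (cases "t \<le> s")
          case True
          have "integral {a..t} h + integral {t..s} h = integral {a..s} h"
            using True t h by (intro Henstock_Kurzweil_Integration.integral_combine) (auto intro: integrable_on_subinterval)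
          then have "F s - F t = integral {t..s} h" by (simp add: F_def algebra_simps)
          then show ?thesis using True by (simp add: I_def norm_minus_commute)
        next
          case False
          have "integral {a..s} h + integral {s..t} h = integral {a..t} h"
            using False t h by (intro Henstock_Kurzweil_Integration.integral_combine) (auto intro: integrable_on_subinterval)
          then have "F t = F s + integral {s..t} h" by (simp add: F_def)
          then show ?thesis using False by (simp add: I_def algebra_simps)
        qed
        then show "measure lebesgue (I i) \<le> real (Suc k) * norm (measure lborel (I i) *\<^sub>R h (fst i) - integral (I i) h)"
          using tsK by (simp add: ts content_I K_def)
      qed
      also have "\<dots> = real (Suc k) * (\<Sum>(t, l)\<in>p. norm (measure lborel l *\<^sub>R h t - integral l h))"
        unfolding p_def by (simp add: sum.reindex[OF inj] sum_distrib_left)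
      \<comment> \<open>Henstock's lemma was invoked with the tolerance \<open>e / (k + 1)\<close>,
        which cancels the factor coming from \<open>B k\<close>.\<close>
      also have "\<dots> \<le> real (Suc k) * (e / real (Suc k))"
      proof (intro mult_left_mono less_imp_le g(2)[OF p])
        show "g fine p"
          using C'(1) C(2) by (force simp: fine_def p_def K_def)
      qed simp
      finally show ?thesis by simp
    qed
    have meas: "I i \<in> lmeasurable" for i by (simp add: I_eq)
    have "(\<Union>i\<in>C. I i) \<in> lmeasurable" "measure lebesgue (\<Union>i\<in>C. I i) \<le> e"
      using fmeasurable_UN_bound[OF C(1) meas bound] measure_UN_bound[OF C(1) meas bound] by auto
    moreover have "measure lebesgue ((B k - (\<Union>i\<in>C. I i)) \<union> (\<Union>i\<in>C. I i)) \<le>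
        measure lebesgue (B k - (\<Union>i\<in>C. I i)) + measure lebesgue (\<Union>i\<in>C. I i)"
      using C(4) calculation(1) by (intro measure_Un_le) (auto simp: I_eq negligible_imp_sets)
    moreover have "measure lebesgue (B k - (\<Union>i\<in>C. I i)) = 0"
      using C(4) by (simp add: I_eq negligible_imp_measure0)
    moreover have "(B k - (\<Union>i\<in>C. I i)) \<in> lmeasurable"
      using C(4) by (simp add: I_eq negligible_imp_measurable)
    moreover have "(B k - (\<Union>i\<in>C. I i)) \<union> (\<Union>i\<in>C. I i) \<in> lmeasurable"
      using calculation by (intro fmeasurable.Un)
    ultimately show "\<exists>T. B k \<subseteq> T \<and> T \<in> lmeasurable \<and> measure lebesgue T \<le> e"
      by (intro exI[of _ "(B k - (\<Union>i\<in>C. I i)) \<union> (\<Union>i\<in>C. I i)"]) auto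
  qed
  then have neg: "negligible (\<Union>k. B k)" by (intro negligible_countable_Union) auto
  have "(F has_vector_derivative h t) (at t)" if t: "t \<in> {a<..<b} - (\<Union>k. B k)" for t
    unfolding has_vector_derivative_def has_derivative_at_alt
  proof (intro conjI allI impI)
    fix e :: real assume "e > 0"
    then obtain k where k: "inverse (real (Suc k)) < e" using reals_Archimedean by blast
    from t have "t \<notin> B k" by blast
    then have "\<not> (\<forall>d>0. \<exists>s\<in>{a..b}. 0 < \<bar>s - t\<bar> \<and> \<bar>s - t\<bar> < d \<and>
        \<bar>s - t\<bar> < real (Suc k) * norm (F s - F t - (s - t) *\<^sub>R h t))"
      using t unfolding B_def mem_Collect_eq by simp
    then obtain d where d: "d > 0" "\<not> (\<exists>s\<in>{a..b}. 0 < \<bar>s - t\<bar> \<and> \<bar>s - t\<bar> < d \<and>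
        \<bar>s - t\<bar> < real (Suc k) * norm (F s - F t - (s - t) *\<^sub>R h t))"
      unfolding not_all not_imp by (elim exE conjE) (rule that)
    show "\<exists>d>0. \<forall>s. norm (s - t) < d \<longrightarrow> norm (F s - F t - (s - t) *\<^sub>R h t) \<le> e * norm (s - t)"
    proof (intro exI[of _ "min d (min (t - a) (b - t))"] conjI allI impI)
      show "0 < min d (min (t - a) (b - t))" using d(1) t by auto
      fix s assume s: "norm (s - t) < min d (min (t - a) (b - t))"
      show "norm (F s - F t - (s - t) *\<^sub>R h t) \<le> e * norm (s - t)"
      proof (cases "s = t")
        case False
        have "real (Suc k) * norm (F s - F t - (s - t) *\<^sub>R h t) \<le> \<bar>s - t\<bar>"
        proof (rule ccontr)
          assume "\<not> ?thesis"
          moreover have "s \<in> {a..b}" "\<bar>s - t\<bar> < d" using s by auto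
          ultimately show False using d(2) False by (meson not_le zero_less_abs_iff right_minus_eq)
        qed
        then have "norm (F s - F t - (s - t) *\<^sub>R h t) \<le> inverse (real (Suc k)) * \<bar>s - t\<bar>"
          by (simp add: field_simps)
        also have "\<dots> \<le> e * \<bar>s - t\<bar>" using k by (intro mult_right_mono) auto
        finally show ?thesis by simp
      qed simp
    qed
  qed (simp add: bounded_linear_scaleR_left)
  then have "{t \<in> {a<..<b}. \<not> (F has_vector_derivative h t) (at t)} \<subseteq> (\<Union>k. B k)"
    by blast
  then have "negligible {t \<in> {a<..<b}. \<not> (F has_vector_derivative h t) (at t)}"
    by (rule negligible_subset[OF neg])
  then show ?thesis
    by (simp add: AE_lebesgue_on_iff_negligible F_def[abs_def])
qed

section \<open>Gronwall estimates, monotonicity and Caratheodory equations\<close>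

lemma integral_diff_interval:
  fixes h :: "real \<Rightarrow> 'a::euclidean_space"
  assumes "h integrable_on {a..b}" "a \<le> s" "s \<le> t" "t \<le> b"
  shows "integral {a..t} h - integral {a..s} h = integral {s..t} h"
proof -
  have "integral {a..s} h + integral {s..t} h = integral {a..t} h"
    using assms by (intro Henstock_Kurzweil_Integration.integral_combine) (auto intro: integrable_on_subinterval)
  then show ?thesis by (simp add: algebra_simps)
qed

lemma has_integral_exp_weight:
  fixes L D s t :: real
  assumes "L > 0"
  obtains I where "((\<lambda>r. L * D * exp (2 * L * \<bar>r - s\<bar>)) has_integral I) {min s t..max s t}"
    "D \<ge> 0 \<Longrightarrow> I \<le> D / 2 * exp (2 * L * \<bar>t - s\<bar>)"
proof (cases "s \<le> t")
  case True
  have "((\<lambda>r. L * D * exp (2 * L * (r - s))) has_integral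
      D / 2 * exp (2 * L * (t - s)) - D / 2 * exp (2 * L * (s - s))) {s..t}"
    using True by (intro fundamental_theorem_of_calculus)
      (auto intro!: derivative_eq_intros simp: has_real_derivative_iff_has_vector_derivative[symmetric])
  then have "((\<lambda>r. L * D * exp (2 * L * \<bar>r - s\<bar>)) has_integral
      D / 2 * exp (2 * L * (t - s)) - D / 2) {min s t..max s t}"
    using True by (simp add: min_def max_def) (rule has_integral_eq[rotated], assumption, simp)
  then show ?thesis using True by (intro that) auto
next
  case False
  have "((\<lambda>r. L * D * exp (2 * L * (s - r))) has_integral
      (- (D / 2) * exp (2 * L * (s - s))) - (- (D / 2) * exp (2 * L * (s - t)))) {t..s}"
    using False by (intro fundamental_theorem_of_calculus)
      (auto intro!: derivative_eq_intros simp: has_real_derivative_iff_has_vector_derivative[symmetric])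
  then have "((\<lambda>r. L * D * exp (2 * L * \<bar>r - s\<bar>)) has_integral
      D / 2 * exp (2 * L * (s - t)) - D / 2) {min s t..max s t}"
    using False by (simp add: min_def max_def) (rule has_integral_eq[rotated], assumption, simp)
  then show ?thesis using False by (intro that) auto
qed

text \<open>With \<open>D\<close> the maximum of the function divided by its exponential weight, the
  integral inequality turns into \<open>D \<le> c + D / 2\<close>, hence
  \<open>D \<le> 2 * c\<close>. The factor 2 is the price of this short argument, which treats times
  before and after \<open>s\<close> alike.\<close>

lemma gronwall_crude:
  fixes \<phi> :: "real \<Rightarrow> real"
  assumes cont: "continuous_on {a..b} \<phi>" and s: "s \<in> {a..b}" and L: "L > 0" and "c \<ge> 0"
    and le: "\<And>t. t \<in> {a..b} \<Longrightarrow> \<phi> t \<le> c + L * integral {min s t..max s t} \<phi>"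
    and t: "t \<in> {a..b}"
  shows "\<phi> t \<le> 2 * c * exp (2 * L * \<bar>t - s\<bar>)"
proof -
  have "continuous_on {a..b} (\<lambda>r. \<phi> r * exp (- (2 * L * \<bar>r - s\<bar>)))" "{a..b} \<noteq> {}"
    using t by (auto intro!: continuous_intros cont)
  then obtain q where q: "q \<in> {a..b}"
    "\<forall>r\<in>{a..b}. \<phi> r * exp (- (2 * L * \<bar>r - s\<bar>)) \<le> \<phi> q * exp (- (2 * L * \<bar>q - s\<bar>))"
    using continuous_attains_sup[OF compact_Icc] by blast
  define D where "D = max 0 (\<phi> q * exp (- (2 * L * \<bar>q - s\<bar>)))"
  have "D \<ge> 0" by (simp add: D_def)
  have D: "\<phi> r \<le> D * exp (2 * L * \<bar>r - s\<bar>)" if "r \<in> {a..b}" for r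
  proof -
    have "\<phi> r * exp (- (2 * L * \<bar>r - s\<bar>)) \<le> D" using q(2)[rule_format, OF that] by (simp add: D_def le_max_iff_disj)
    then have "\<phi> r * exp (- (2 * L * \<bar>r - s\<bar>)) * exp (2 * L * \<bar>r - s\<bar>) \<le> D * exp (2 * L * \<bar>r - s\<bar>)"
      by (intro mult_right_mono) auto
    then show ?thesis by (simp add: mult.assoc exp_add[symmetric])
  qed
  have bound: "\<phi> t \<le> c + D / 2 * exp (2 * L * \<bar>t - s\<bar>)" if t: "t \<in> {a..b}" for t
  proof -
    obtain I where I: "((\<lambda>r. L * D * exp (2 * L * \<bar>r - s\<bar>)) has_integral I) {min s t..max s t}"
      "I \<le> D / 2 * exp (2 * L * \<bar>t - s\<bar>)"
      using \<open>D \<ge> 0\<close> by (rule_tac has_integral_exp_weight[OF L, of D s t]) blast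
    have sub: "{min s t..max s t} \<subseteq> {a..b}" using s t by auto
    have "\<phi> integrable_on {min s t..max s t}"
      by (intro integrable_continuous_real continuous_on_subset[OF cont] sub)
    then have "((\<lambda>r. L * \<phi> r) has_integral L * integral {min s t..max s t} \<phi>) {min s t..max s t}"
      by (intro has_integral_mult_right) (simp add: has_integral_integral)
    then have "L * integral {min s t..max s t} \<phi> \<le> I"
    proof (rule has_integral_le[OF _ I(1)])
      fix x assume "x \<in> {min s t..max s t}"
      then have "\<phi> x \<le> D * exp (2 * L * \<bar>x - s\<bar>)" using D sub by blast
      then show "L * \<phi> x \<le> L * D * exp (2 * L * \<bar>x - s\<bar>)" using L by (simp add: mult.assoc)
    qed
    then show ?thesis using le[OF t] I(2) by linarith
  qed
  have "D \<le> 2 * c"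
  proof (cases "D = 0")
    case False
    then have Dq: "D = \<phi> q * exp (- (2 * L * \<bar>q - s\<bar>))" by (auto simp: D_def max_def)
    also have "\<dots> \<le> (c + D / 2 * exp (2 * L * \<bar>q - s\<bar>)) * exp (- (2 * L * \<bar>q - s\<bar>))"
      by (intro mult_right_mono bound q(1)) simp
    also have "\<dots> = c * exp (- (2 * L * \<bar>q - s\<bar>)) + D / 2"
      by (simp add: distrib_right mult.assoc exp_add[symmetric])
    also have "\<dots> \<le> c * 1 + D / 2"
      using L \<open>c \<ge> 0\<close> by (intro add_right_mono mult_left_mono) auto
    finally show ?thesis by simp
  qed (use \<open>c \<ge> 0\<close> in auto)
  then have "D * exp (2 * L * \<bar>t - s\<bar>) \<le> 2 * c * exp (2 * L * \<bar>t - s\<bar>)"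
    by (intro mult_right_mono) auto
  then show ?thesis using D[OF t] by linarith
qed

text \<open>Let \<open>c\<close> be the last point with \<open>k c \<le> k a\<close>. If it lay
  before \<open>b\<close>, the local assumption at \<open>c\<close> would provide a later such
  point.\<close>

lemma right_nonincreasing_imp_le:
  fixes k :: "real \<Rightarrow> real"
  assumes "a \<le> b" "continuous_on {a..b} k"
    and right: "\<And>t. a \<le> t \<Longrightarrow> t < b \<Longrightarrow> \<exists>d>0. \<forall>s. t < s \<longrightarrow> s < t + d \<longrightarrow> s \<le> b \<longrightarrow> k s \<le> k t"
  shows "k b \<le> k a"
proof -
  define S where "S = {t \<in> {a..b}. k t \<le> k a}"
  have "S = {a..b} \<inter> k -` {..k a}" by (auto simp: S_def)
  then have "closed S"
    using continuous_closed_preimage[OF assms(2) closed_atLeastAtMost closed_atMost] by simp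
  then have "compact S" "S \<noteq> {}" using \<open>a \<le> b\<close>
    by (auto simp: S_def compact_eq_bounded_closed intro: bounded_subset[OF bounded_closed_interval[of a b]])
  then obtain c where c: "c \<in> S" "\<forall>t\<in>S. t \<le> c"
    using compact_attains_sup by metis
  have "c = b"
  proof (rule ccontr)
    assume "c \<noteq> b"
    then have "a \<le> c" "c < b" using c(1) by (auto simp: S_def)
    then obtain d where d: "d > 0" "\<forall>s. c < s \<longrightarrow> s < c + d \<longrightarrow> s \<le> b \<longrightarrow> k s \<le> k c"
      using right by blast
    define s where "s = min b (c + d / 2)"
    have "c < s" "s < c + d" "s \<le> b" using d(1) \<open>c < b\<close> by (auto simp: s_def)
    moreover from this have "k s \<le> k c" using d(2) by blast
    ultimately have "s \<in> S" using c(1) \<open>a \<le> c\<close> by (auto simp: S_def)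
    then show False using c(2) \<open>c < s\<close> by fastforce
  qed
  then show ?thesis using c(1) by (simp add: S_def)
qed

text \<open>The exceptional null set is covered by an open set \<open>V\<close> of small measure; the auxiliary
  function \<open>C * measure (V \<inter> {a..t})\<close> absorbs the growth there.\<close>

lemma lipschitz_on_right_dini_nonpos_imp_le:
  fixes m :: "real \<Rightarrow> real"
  assumes "a \<le> b" and lip: "C-lipschitz_on {a..b} m" and N: "negligible N"
    and dini: "\<And>t e. t \<in> {a<..<b} - N \<Longrightarrow> e > 0 \<Longrightarrow>
      \<exists>d>0. \<forall>s. t < s \<longrightarrow> s < t + d \<longrightarrow> s \<le> b \<longrightarrow> m s - m t \<le> e * (s - t)"
  shows "m b \<le> m a"
proof (rule field_le_epsilon)
  fix e :: real assume "e > 0"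
  have C: "C \<ge> 0" using lip by (rule lipschitz_on_nonneg)
  \<comment> \<open>The final estimate splits \<open>e\<close> equally: \<open>e1\<close> is the
    slope tolerated at good points, and \<open>e2\<close> bounds the measure of
    \<open>V\<close>.\<close>
  define e1 where "e1 = e / (2 * (b - a + 1))"
  define e2 where "e2 = e / (2 * (C + 1))"
  have e12: "e1 > 0" "e2 > 0" using \<open>e > 0\<close> \<open>a \<le> b\<close> C by (auto simp: e1_def e2_def)
  \<comment> \<open>The endpoints are covered as well, because the Dini condition is available at
    interior points only.\<close>
  have N': "negligible (N \<union> {a, b})" using N by (simp add: negligible_Un)
  then have "N \<union> {a, b} \<in> sets lebesgue" by (rule negligible_imp_sets)
  then obtain V where V: "open V" "N \<union> {a, b} \<subseteq> V" "(V - (N \<union> {a, b})) \<in> lmeasurable"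
      "emeasure lebesgue (V - (N \<union> {a, b})) < ennreal e2"
    using sets_lebesgue_outer_open[OF _ e12(2)] by metis
  have Vm: "V \<in> lmeasurable" "measure lebesgue V < e2"
  proof -
    have eq: "V = (V - (N \<union> {a, b})) \<union> (N \<union> {a, b})" using V(2) by blast
    have nm: "N \<union> {a, b} \<in> lmeasurable" "measure lebesgue (N \<union> {a, b}) = 0"
      using N' by (auto simp: negligible_imp_measurable negligible_imp_measure0)
    show 1: "V \<in> lmeasurable" by (subst eq) (intro fmeasurable.Un V(3) nm(1))
    have "measure lebesgue V \<le> measure lebesgue (V - (N \<union> {a, b})) + measure lebesgue (N \<union> {a, b})"
      using measure_Un_le[of "V - (N \<union> {a, b})" lebesgue "N \<union> {a, b}"] V(3) nm(1) eq by auto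
    moreover have "measure lebesgue (V - (N \<union> {a, b})) < e2"
      using V(3,4) e12(2) by (simp add: emeasure_eq_measure2 ennreal_less_iff)
    ultimately show "measure lebesgue V < e2" using nm(2) by simp
  qed
  define \<psi> where "\<psi> t = measure lebesgue (V \<inter> {a..t})" for t
  have VI: "V \<inter> {s..t} \<in> lmeasurable" for s t using Vm(1) by (intro fmeasurable_Int_fmeasurable) auto
  have \<psi>_diff: "\<psi> t - \<psi> s = measure lebesgue (V \<inter> {s<..t})" if "a \<le> s" "s \<le> t" for s t
  proof -
    have "V \<inter> {s<..t} = (V \<inter> {a..t}) - (V \<inter> {a..s})" using that by auto
    moreover have "measure lebesgue ((V \<inter> {a..t}) - (V \<inter> {a..s})) = \<psi> t - \<psi> s"
      unfolding \<psi>_def using that by (intro measurable_measure_Diff VI fmeasurableD) auto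
    ultimately show ?thesis by simp
  qed
  have \<psi>_le: "0 \<le> \<psi> t - \<psi> s \<and> \<psi> t - \<psi> s \<le> t - s" if "a \<le> s" "s \<le> t" for s t
  proof -
    have "measure lebesgue (V \<inter> {s<..t}) \<le> measure lebesgue {s..t}"
      using Vm(1) by (intro measure_mono_fmeasurable) (auto simp: fmeasurableD)
    then show ?thesis using \<psi>_diff[OF that] that by simp
  qed
  have cont_\<psi>: "continuous_on {a..b} \<psi>"
  proof (rule lipschitz_on_continuous_on[of 1], rule lipschitz_onI)
    fix s t assume "s \<in> {a..b}" "t \<in> {a..b}"
    then show "dist (\<psi> s) (\<psi> t) \<le> 1 * dist s t"
      using \<psi>_le[of s t] \<psi>_le[of t s] by (cases "s \<le> t") (auto simp: dist_real_def)
  qed simp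
  \<comment> \<open>Outside \<open>V\<close> the Dini bound with slope \<open>e1\<close> makes
    \<open>k\<close> nonincreasing to the right. Inside \<open>V\<close> the function
    \<open>\<psi>\<close> has slope one, and \<open>C * \<psi>\<close> absorbs the Lipschitz growth
    of \<open>m\<close>.\<close>
  define k where "k t = m t - e1 * (t - a) - C * \<psi> t" for t
  have "k b \<le> k a"
  proof (rule right_nonincreasing_imp_le[OF \<open>a \<le> b\<close>])
    show "continuous_on {a..b} k" unfolding k_def
      by (intro continuous_intros cont_\<psi> lipschitz_on_continuous_on[OF lip])
    fix t assume t: "a \<le> t" "t < b"
    show "\<exists>d>0. \<forall>s. t < s \<longrightarrow> s < t + d \<longrightarrow> s \<le> b \<longrightarrow> k s \<le> k t"
    proof (cases "t \<in> V")
      case True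
      then obtain d where d: "d > 0" "ball t d \<subseteq> V" using V(1) openE by blast
      have "k s \<le> k t" if s: "t < s" "s < t + d" "s \<le> b" for s
      proof -
        have "{t<..s} \<subseteq> ball t d" using s by (auto simp: dist_real_def)
        then have "V \<inter> {t<..s} = {t<..s}" using d(2) by blast
        then have "\<psi> s - \<psi> t = s - t" using \<psi>_diff[of t s] t s by simp
        moreover have "m s - m t \<le> C * (s - t)"
          using lipschitz_onD[OF lip, of s t] s t by (auto simp: dist_real_def)
        ultimately have "m s - m t \<le> C * (\<psi> s - \<psi> t)" by simp
        moreover have "0 \<le> e1 * (s - t)" using e12 s by simp
        ultimately show ?thesis by (simp add: k_def algebra_simps)
      qed
      then show ?thesis using d(1) by blast
    next
      case False
      then have "t \<in> {a<..<b} - N" using V(2) t by (cases "t = a") auto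
      then obtain d where d: "d > 0" "\<forall>s. t < s \<longrightarrow> s < t + d \<longrightarrow> s \<le> b \<longrightarrow> m s - m t \<le> e1 * (s - t)"
        using dini e12(1) by blast
      have "k s \<le> k t" if s: "t < s" "s < t + d" "s \<le> b" for s
      proof -
        have "0 \<le> C * (\<psi> s - \<psi> t)" using \<psi>_le[of t s] C t s by simp
        then show ?thesis using d(2)[rule_format, OF s] by (simp add: k_def algebra_simps)
      qed
      then show ?thesis using d(1) by blast
    qed
  qed
  then have "m b - m a \<le> e1 * (b - a) + C * (\<psi> b - \<psi> a)" by (simp add: k_def algebra_simps)
  also have "\<dots> \<le> e1 * (b - a) + C * e2"
  proof (intro add_left_mono mult_left_mono C)
    have "\<psi> b \<le> measure lebesgue V" unfolding \<psi>_def
      using Vm(1) by (intro measure_mono_fmeasurable) (auto simp: fmeasurableD VI)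
    moreover have "0 \<le> \<psi> a" by (simp add: \<psi>_def)
    ultimately show "\<psi> b - \<psi> a \<le> e2" using Vm(2) by linarith
  qed
  also have "\<dots> \<le> e / 2 + e / 2"
  proof (rule add_mono)
    have "e1 * (b - a) \<le> e1 * (b - a + 1)" using e12(1) by (intro mult_left_mono) auto
    also have "\<dots> = e / 2"
    proof -
      have "b - a + 1 \<noteq> 0" using \<open>a \<le> b\<close> by simp
      then show ?thesis unfolding e1_def times_divide_eq_left by (rule mult_divide_mult_cancel_right)
    qed
    finally show "e1 * (b - a) \<le> e / 2" .
    have "C * e2 \<le> e2 * (C + 1)" using e12(2) by (simp add: algebra_simps)
    also have "\<dots> = e / 2"
    proof -
      have "C + 1 \<noteq> 0" using C by simp
      then show ?thesis unfolding e2_def times_divide_eq_left by (rule mult_divide_mult_cancel_right)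
    qed
    finally show "C * e2 \<le> e / 2" .
  qed
  finally show "m b \<le> m a + e" by simp
qed

text \<open>Only upward increments from \<open>t\<close> are controlled, but on both sides of
  \<open>t\<close>. To the right this makes \<open>m\<close> nonincreasing; after reflecting time it
  makes \<open>m\<close> nondecreasing. Such a one-signed bound is what a minimum of functions
  inherits from a function touching it from above.\<close>

lemma lipschitz_on_dini_nonpos_imp_const:
  fixes m :: "real \<Rightarrow> real"
  assumes lip: "C-lipschitz_on {a..b} m" and N: "negligible N"
    and dini: "\<And>t e. t \<in> {a<..<b} - N \<Longrightarrow> e > 0 \<Longrightarrow>
      \<exists>d>0. \<forall>s. \<bar>s - t\<bar> < d \<longrightarrow> s \<in> {a..b} \<longrightarrow> m s - m t \<le> e * \<bar>s - t\<bar>"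
    and uv: "u \<in> {a..b}" "v \<in> {a..b}"
  shows "m u = m v"
proof -
  have *: "m u = m v" if uv: "a \<le> u" "u \<le> v" "v \<le> b" for u v
  proof (rule antisym)
    have lip1: "C-lipschitz_on {u..v} m" by (rule lipschitz_on_subset[OF lip]) (use uv in auto)
    have d1: "\<exists>d>0. \<forall>s. \<bar>s - t\<bar> < d \<longrightarrow> s \<in> {a..b} \<longrightarrow> m s - m t \<le> e * \<bar>s - t\<bar>"
      if "t \<in> {u<..<v} - N" "e > 0" for t e
      using dini[of t e] that uv by auto
    show "m v \<le> m u"
    proof (rule lipschitz_on_right_dini_nonpos_imp_le[OF uv(2) lip1 N])
      fix t e :: real assume te: "t \<in> {u<..<v} - N" "e > 0"
      then obtain d where d: "d > 0" "\<forall>s. \<bar>s - t\<bar> < d \<longrightarrow> s \<in> {a..b} \<longrightarrow> m s - m t \<le> e * \<bar>s - t\<bar>"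
        using d1 by blast
      have "m s - m t \<le> e * (s - t)" if "t < s" "s < t + d" "s \<le> v" for s
        using d(2)[rule_format, of s] that te uv by auto
      then show "\<exists>d>0. \<forall>s. t < s \<longrightarrow> s < t + d \<longrightarrow> s \<le> v \<longrightarrow> m s - m t \<le> e * (s - t)"
        using d(1) by blast
    qed
    have lip2: "C-lipschitz_on {-v..-u} (\<lambda>t. m (- t))"
    proof (rule lipschitz_onI)
      fix s t assume "s \<in> {-v..-u}" "t \<in> {-v..-u}"
      then show "dist (m (- s)) (m (- t)) \<le> C * dist s t"
        using lipschitz_onD[OF lip1, of "- s" "- t"] by (auto simp: dist_real_def abs_minus_commute)
    qed (rule lipschitz_on_nonneg[OF lip])
    have N2: "negligible (uminus ` N)"
      by (rule negligible_locally_Lipschitz_image[OF _ N])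
        (simp, rule exI[of _ UNIV], rule exI[of _ 1], simp add: abs_minus_commute)
    have "m (- (- u)) \<le> m (- (- v))"
    proof (rule lipschitz_on_right_dini_nonpos_imp_le[OF _ lip2 N2])
      fix t e :: real assume te: "t \<in> {-v<..<-u} - uminus ` N" "e > 0"
      have "- t \<notin> N" using te(1) by (metis DiffD2 image_eqI minus_minus)
      then have "- t \<in> {u<..<v} - N" using te(1) by auto
      then obtain d where d: "d > 0" "\<forall>s. \<bar>s - (- t)\<bar> < d \<longrightarrow> s \<in> {a..b} \<longrightarrow> m s - m (- t) \<le> e * \<bar>s - (- t)\<bar>"
        using d1 te(2) by blast
      have "m (- s) - m (- t) \<le> e * (s - t)" if "t < s" "s < t + d" "s \<le> - u" for s
        using d(2)[rule_format, of "- s"] that te uv by auto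
      then show "\<exists>d>0. \<forall>s. t < s \<longrightarrow> s < t + d \<longrightarrow> s \<le> - u \<longrightarrow> m (- s) - m (- t) \<le> e * (s - t)"
        using d(1) by (intro exI[of _ d]) simp
    qed (use uv(2) in simp)
    then show "m u \<le> m v" by simp
  qed
  show ?thesis
  proof (cases "u \<le> v")
    case True
    then show ?thesis by (intro *) (use uv in auto)
  next
    case False
    then show ?thesis by (intro *[symmetric]) (use uv in auto)
  qed
qed

section \<open>Bounded measurable integrands and Caratheodory equations\<close>

lemma AE_lebesgue_on_Ioo: "AE t in lebesgue_on {a<..<b::real}. a < t \<and> t < b"
  by (rule AE_lebesgue_on_mem[of "{a<..<b}", unfolded greaterThanLessThan_iff]) simp

lemma integrable_on_bounded_measurable:
  fixes h :: "real \<Rightarrow> 'a::euclidean_space"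
  assumes "h \<in> borel_measurable (lebesgue_on {a..b})" "\<And>t. t \<in> {a..b} \<Longrightarrow> norm (h t) \<le> B"
  shows "h integrable_on {a..b}"
  by (rule measurable_bounded_by_integrable_imp_integrable[where g = "\<lambda>_. B"]) (use assms in auto)

lemma continuous_on_Icc_bounded:
  fixes x :: "real \<Rightarrow> 'a::real_normed_vector"
  assumes "continuous_on {a..b} x"
  obtains B where "\<forall>t\<in>{a..b}. norm (x t) \<le> B" "B \<ge> 0"
proof -
  have "bounded (x ` {a..b})"
    by (intro compact_imp_bounded compact_continuous_image assms compact_Icc)
  then obtain B where "\<forall>t\<in>{a..b}. norm (x t) \<le> B" by (auto simp: bounded_iff)
  then have "\<forall>t\<in>{a..b}. norm (x t) \<le> max B 0" by (auto simp: le_max_iff_disj)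
  then show thesis using that[of "max B 0"] by simp
qed

lemma lipschitz_on_integral:
  fixes h :: "real \<Rightarrow> 'a::euclidean_space"
  assumes h: "h integrable_on {a..b}" and B: "\<And>t. t \<in> {a..b} \<Longrightarrow> norm (h t) \<le> B" and "B \<ge> 0"
  shows "B-lipschitz_on {a..b} (\<lambda>t. integral {a..t} h)"
proof (rule lipschitz_onI)
  have *: "norm (integral {a..t} h - integral {a..s} h) \<le> B * (t - s)" if "a \<le> s" "s \<le> t" "t \<le> b" for s t
  proof -
    have "h integrable_on {s..t}" by (rule integrable_on_subinterval[OF h]) (use that in auto)
    then have "norm (integral (cbox s t) h) \<le> B * measure lborel (cbox s t)"
      using B that \<open>B \<ge> 0\<close> by (intro has_integral_bound[of B h]) (auto simp: has_integral_integral)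
    then show ?thesis using that by (simp add: integral_diff_interval[OF h that])
  qed
  fix s t assume st: "s \<in> {a..b}" "t \<in> {a..b}"
  show "dist (integral {a..s} h) (integral {a..t} h) \<le> B * dist s t"
    using *[of s t] *[of t s] st by (cases "s \<le> t") (auto simp: dist_norm norm_minus_commute)
qed (rule \<open>B \<ge> 0\<close>)

text \<open>Picard iteration is a contraction for the norm weighted by \<open>exp (2 * L * \<bar>t - t0\<bar>)\<close>.\<close>

lemma caratheodory_solution:
  fixes F :: "real \<Rightarrow> 'a \<Rightarrow> 'a::euclidean_space"
  assumes t0: "t0 \<in> {a..b}"
    and meas: "\<And>x. continuous_on {a..b} x \<Longrightarrow> (\<lambda>t. F t (x t)) \<in> borel_measurable (lebesgue_on {a..b})"
    and bound: "\<And>t. t \<in> {a..b} \<Longrightarrow> norm (F t 0) \<le> M"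
    and lip: "\<And>t x y. t \<in> {a..b} \<Longrightarrow> norm (F t x - F t y) \<le> L * norm (x - y)"
  obtains x C where "C-lipschitz_on {a..b} x" "x t0 = x0"
    "AE t in lebesgue_on {a<..<b}. (x has_vector_derivative F t (x t)) (at t)"
proof -
  \<comment> \<open>The exponential weight requires a positive Lipschitz constant.\<close>
  define K where "K = max L 1"
  have K: "K > 0" "norm (F t x - F t y) \<le> K * norm (x - y)" if "t \<in> {a..b}" for t x y
  proof -
    have "L * norm (x - y) \<le> K * norm (x - y)" by (intro mult_right_mono) (auto simp: K_def)
    then show "norm (F t x - F t y) \<le> K * norm (x - y)" using lip[OF that, of x y] by linarith
  qed (simp add: K_def)
  have K0: "K > 0" by (simp add: K_def)
  have M0: "M \<ge> 0" using bound[OF t0] norm_ge_zero order.trans by blast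
  have growth: "norm (F t x) \<le> M + K * norm x" if "t \<in> {a..b}" for t x
    using K(2)[OF that, of x 0] bound[OF that] norm_triangle_ineq2[of "F t x" "F t 0"] by simp
  define I where "I x t = integral {a..t} (\<lambda>s. F s (x s))" for x :: "real \<Rightarrow> 'a" and t
  have int: "(\<lambda>t. F t (x t)) integrable_on {a..b}" if cx: "continuous_on {a..b} x" for x
  proof -
    obtain B where B: "\<forall>t\<in>{a..b}. norm (x t) \<le> B" "B \<ge> 0" using continuous_on_Icc_bounded[OF cx] .
    show ?thesis
    proof (rule integrable_on_bounded_measurable[OF meas[OF cx]])
      fix t assume t: "t \<in> {a..b}"
      have "K * norm (x t) \<le> K * B" using B t K0 by (intro mult_left_mono) auto
      then show "norm (F t (x t)) \<le> M + K * B" using growth[OF t, of "x t"] by linarith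
    qed
  qed
  define w where "w t = exp (2 * K * \<bar>t - t0\<bar>)" for t
  have w: "w t > 0" "continuous_on S w" for t S by (auto simp: w_def[abs_def] intro!: continuous_intros)
  define G where "G y t = x0 + (I (\<lambda>s. w s *\<^sub>R y s) t - I (\<lambda>s. w s *\<^sub>R y s) t0)" for y t
  \<comment> \<open>Bounded continuous functions live on the whole line, so times are clamped to
    \<open>{a..b}\<close>.\<close>
  define cl where "cl t = max a (min b t)" for t
  have cl: "cl t \<in> {a..b}" "continuous_on S cl" for t S
    using t0 by (auto simp: cl_def[abs_def] intro!: continuous_intros)
  have cl_id: "cl t = t" if "t \<in> {a..b}" for t using that by (auto simp: cl_def)
  \<comment> \<open>The variable of the fixed-point problem is \<open>x / w\<close>, so that the
    plain supremum norm acts as the weighted norm.\<close>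
  define \<Phi> where "\<Phi> y = Bcontfun (\<lambda>t. (1 / w (cl t)) *\<^sub>R G (apply_bcontfun y) (cl t))" for y
  have cy: "continuous_on S (\<lambda>s. w s *\<^sub>R apply_bcontfun y s)" for S and y :: "real \<Rightarrow>\<^sub>C 'a"
    by (rule continuous_on_scaleR[OF w(2)]) (rule continuous_on_apply_bcontfun)
  have app: "apply_bcontfun (\<Phi> y) t = (1 / w (cl t)) *\<^sub>R G (apply_bcontfun y) (cl t)" for y t
  proof -
    define H where "H t = (1 / w t) *\<^sub>R G (apply_bcontfun y) t" for t
    have "continuous_on {a..b} (\<lambda>t. I (\<lambda>s. w s *\<^sub>R apply_bcontfun y s) t)"
      unfolding I_def by (intro indefinite_integral_continuous_1 int cy)
    then have cH: "continuous_on {a..b} H" unfolding H_def G_def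
      by (intro continuous_intros w(2)) (use w(1) in \<open>auto simp: less_imp_neq[symmetric]\<close>)
    have "continuous_on UNIV (H \<circ> cl)"
      by (intro continuous_on_compose cl continuous_on_subset[OF cH]) (use cl(1) in auto)
    moreover have "bounded (range (H \<circ> cl))"
    proof (rule bounded_subset)
      show "bounded (H ` {a..b})" by (intro compact_imp_bounded compact_continuous_image cH compact_Icc)
      show "range (H \<circ> cl) \<subseteq> H ` {a..b}" using cl(1) by auto
    qed
    ultimately have "H \<circ> cl \<in> bcontfun" by (simp add: bcontfun_def)
    then show ?thesis
      unfolding \<Phi>_def by (subst Bcontfun_inverse) (auto simp: H_def o_def)
  qed
  have "dist (\<Phi> y) (\<Phi> z) \<le> 1 / 2 * dist y z" for y z
  proof (rule dist_bound)
    fix q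
    define t where "t = cl q"
    have t: "t \<in> {a..b}" using cl(1) by (simp add: t_def)
    define \<delta> where "\<delta> s = F s (w s *\<^sub>R apply_bcontfun y s) - F s (w s *\<^sub>R apply_bcontfun z s)" for s
    define D where "D = dist y z"
    have \<delta>int: "\<delta> integrable_on {a..b}"
      unfolding \<delta>_def by (intro integrable_diff int cy)
    have \<delta>le: "norm (\<delta> s) \<le> K * D * exp (2 * K * \<bar>s - t0\<bar>)" if "s \<in> {a..b}" for s
    proof -
      have "norm (\<delta> s) \<le> K * norm (w s *\<^sub>R apply_bcontfun y s - w s *\<^sub>R apply_bcontfun z s)"
        unfolding \<delta>_def by (rule K(2)[OF that])
      also have "\<dots> = K * (w s * dist (apply_bcontfun y s) (apply_bcontfun z s))"
        using w(1)[of s] by (simp add: dist_norm scaleR_diff_right[symmetric])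
      also have "\<dots> \<le> K * (w s * D)"
        unfolding D_def using K0 w(1)[of s] by (intro mult_left_mono dist_bounded) auto
      finally show ?thesis by (simp add: w_def mult_ac)
    qed
    obtain J where J: "((\<lambda>r. K * D * exp (2 * K * \<bar>r - t0\<bar>)) has_integral J) {min t0 t..max t0 t}"
      "J \<le> D / 2 * exp (2 * K * \<bar>t - t0\<bar>)"
      using zero_le_dist[of y z, folded D_def] by (rule_tac has_integral_exp_weight[OF K0, of D t0 t]) blast
    have sub: "{min t0 t..max t0 t} \<subseteq> {a..b}" using t t0 by auto
    have "norm (integral {min t0 t..max t0 t} \<delta>) \<le> integral {min t0 t..max t0 t} (\<lambda>r. K * D * exp (2 * K * \<bar>r - t0\<bar>))"
      by (rule integral_norm_bound_integral[OF integrable_on_subinterval[OF \<delta>int sub] has_integral_integrable[OF J(1)]])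
        (rule \<delta>le, use sub in blast)
    also have "\<dots> \<le> D / 2 * w t"
      using J integral_unique[OF J(1)] by (simp add: D_def w_def)
    finally have 1: "norm (integral {min t0 t..max t0 t} \<delta>) \<le> D / 2 * w t" .
    have Id: "I (\<lambda>s. w s *\<^sub>R apply_bcontfun y s) s - I (\<lambda>s. w s *\<^sub>R apply_bcontfun z s) s = integral {a..s} \<delta>"
      if "s \<in> {a..b}" for s
      unfolding I_def \<delta>_def
      by (intro Henstock_Kurzweil_Integration.integral_diff[symmetric] integrable_on_subinterval[OF int[OF cy]])
        (use that in auto)
    have "G y t - G z t = integral {a..t} \<delta> - integral {a..t0} \<delta>"
      using Id[OF t] Id[OF t0] by (simp add: G_def algebra_simps)
    also have "norm \<dots> = norm (integral {min t0 t..max t0 t} \<delta>)"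
      using integral_diff_interval[OF \<delta>int, of t0 t] integral_diff_interval[OF \<delta>int, of t t0] t t0
      by (cases "t0 \<le> t") (auto simp: norm_minus_commute)
    finally have "norm (G y t - G z t) \<le> D / 2 * w t" using 1 by simp
    moreover have "norm ((1 / w t) *\<^sub>R X) \<le> D / 2" if "norm X \<le> D / 2 * w t" for X :: 'a
      using w(1)[of t] that by (simp add: field_simps)
    ultimately have "norm ((1 / w t) *\<^sub>R (G y t - G z t)) \<le> D / 2" by blast
    then show "dist (apply_bcontfun (\<Phi> y) q) (apply_bcontfun (\<Phi> z) q) \<le> 1 / 2 * dist y z"
      unfolding app t_def[symmetric] dist_norm scaleR_diff_right[symmetric] D_def by simp
  qed
  then obtain y where y: "\<Phi> y = y"
    using banach_fix_type[of "1 / 2" \<Phi>] by auto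
  define x where "x t = w t *\<^sub>R apply_bcontfun y t" for t
  have cx: "continuous_on {a..b} x" unfolding x_def by (rule cy)
  have x: "x t = x0 + (I x t - I x t0)" if "t \<in> {a..b}" for t
  proof -
    have "apply_bcontfun y t = (1 / w t) *\<^sub>R G (apply_bcontfun y) t"
      using app[of y t] y cl_id[OF that] by simp
    then have "x t = G (apply_bcontfun y) t" using w(1)[of t] by (simp add: x_def)
    then show ?thesis by (simp add: G_def x_def[abs_def])
  qed
  obtain B where B: "\<forall>t\<in>{a..b}. norm (x t) \<le> B" "B \<ge> 0" using continuous_on_Icc_bounded[OF cx] .
  have lipI: "(M + K * B)-lipschitz_on {a..b} (I x)"
    unfolding I_def[abs_def]
  proof (rule lipschitz_on_integral[OF int[OF cx]])
    fix t assume t: "t \<in> {a..b}"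
    have "K * norm (x t) \<le> K * B" using B t K0 by (intro mult_left_mono) auto
    then show "norm (F t (x t)) \<le> M + K * B" using growth[OF t, of "x t"] by linarith
  qed (use M0 K0 B in auto)
  have "(M + K * B)-lipschitz_on {a..b} x"
  proof (rule lipschitz_onI)
    fix s t assume st: "s \<in> {a..b}" "t \<in> {a..b}"
    show "dist (x s) (x t) \<le> (M + K * B) * dist s t"
      using lipschitz_onD[OF lipI st] unfolding x[OF st(1)] x[OF st(2)] by (simp add: dist_norm)
  qed (rule lipschitz_on_nonneg[OF lipI])
  moreover have "x t0 = x0" using x[OF t0] by simp
  moreover have "AE t in lebesgue_on {a<..<b}. (x has_vector_derivative F t (x t)) (at t)"
    using has_vector_derivative_integral_AE[OF int[OF cx]] AE_lebesgue_on_Ioo[of a b]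
  proof eventually_elim
    case (elim t)
    have "((\<lambda>t. x0 + (I x t - I x t0)) has_vector_derivative F t (x t)) (at t)"
      using elim(1) unfolding I_def by (auto intro!: derivative_eq_intros)
    then show ?case
      by (rule has_vector_derivative_transform_within_open[of _ _ _ "{a<..<b}"])
        (use elim(2) x in auto)
  qed
  ultimately show thesis by (rule that)
qed

lemma continuous_on_borel_measurable_lebesgue_on_Icc:
  fixes x :: "real \<Rightarrow> 'a::euclidean_space"
  assumes "continuous_on {a..b} x"
  shows "x \<in> borel_measurable (lebesgue_on {a..b})"
  using assms by (intro continuous_imp_measurable_on_sets_lebesgue) auto

text \<open>A homogeneous differential inequality propagates from any time \<open>s\<close> to any
  time \<open>t\<close>, forward or backward. A zero at one time forces the zero function, which is
  the source of uniqueness for costates.\<close>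

lemma abs_continuous_solution_bound:
  fixes d :: "real \<Rightarrow> 'a::euclidean_space"
  assumes ac: "abs_continuous_on {a..b} d"
    and der: "AE t in lebesgue_on {a<..<b}. (d has_vector_derivative G t) (at t)"
    and G: "AE t in lebesgue_on {a<..<b}. norm (G t) \<le> L * norm (d t)" and L: "L > 0"
    and st: "s \<in> {a..b}" "t \<in> {a..b}"
  shows "norm (d t) \<le> 2 * norm (d s) * exp (2 * L * \<bar>t - s\<bar>)"
proof (rule gronwall_crude[of a b "\<lambda>t. norm (d t)", OF _ st(1) L _ _ st(2)])
  have cont: "continuous_on {a..b} d" using ac by (rule abs_continuous_on_imp_continuous_on)
  then show "continuous_on {a..b} (\<lambda>t. norm (d t))" by (intro continuous_intros)
  define N where "N = {t \<in> {a<..<b}. \<not> norm (G t) \<le> L * norm (d t)} \<union> {a, b}"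
  have N: "negligible N" using G by (simp add: N_def AE_lebesgue_on_iff_negligible negligible_Un)
  \<comment> \<open>Clearing \<open>G\<close> on the null set makes
    \<open>norm (H t) \<le> L * norm (d t)\<close> hold at every point, as the comparison of
    integrals requires.\<close>
  define H where "H t = (if t \<in> N then 0 else G t)" for t
  have *: "norm (d v - d u) \<le> L * integral {u..v} (\<lambda>t. norm (d t))" if uv: "a \<le> u" "u \<le> v" "v \<le> b" for u v
  proof -
    have "abs_continuous_on {u..v} d" by (rule abs_continuous_on_subset[OF ac]) (use uv in auto)
    moreover have "AE t in lebesgue_on {u<..<v}. (d has_vector_derivative G t) (at t)"
      by (rule AE_lebesgue_on_subset[OF der]) (use uv in auto)
    ultimately have "(G has_integral (d v - d u)) {u..v}"
      using uv by (intro abs_continuous_on_has_integral) auto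
    then have H: "(H has_integral (d v - d u)) {u..v}"
      by (rule has_integral_spike[OF N, rotated]) (auto simp: H_def)
    have "(\<lambda>t. L * norm (d t)) integrable_on {u..v}"
      by (intro integrable_continuous_real continuous_intros continuous_on_subset[OF cont]) (use uv in auto)
    then have "norm (integral {u..v} H) \<le> integral {u..v} (\<lambda>t. L * norm (d t))"
      using H uv L by (intro integral_norm_bound_integral) (auto simp: H_def N_def integrable_on_def)
    then show ?thesis using integral_unique[OF H] by simp
  qed
  fix t assume t: "t \<in> {a..b}"
  have "norm (d t - d s) \<le> L * integral {min s t..max s t} (\<lambda>t. norm (d t))"
    using *[of s t] *[of t s] st(1) t by (cases "s \<le> t") (auto simp: norm_minus_commute)
  then show "norm (d t) \<le> norm (d s) + L * integral {min s t..max s t} (\<lambda>t. norm (d t))"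
    using norm_triangle_ineq2[of "d t" "d s"] by linarith
qed simp

section \<open>Perturbed trajectories and the adjoint equation\<close>

lemma abs_continuous_on_has_integral_subinterval:
  fixes x :: "real \<Rightarrow> 'a::euclidean_space"
  assumes "abs_continuous_on {a..b} x"
    and "AE t in lebesgue_on {a<..<b}. (x has_vector_derivative h t) (at t)"
    and "a \<le> s" "s \<le> t" "t \<le> b"
  shows "(h has_integral (x t - x s)) {s..t}"
proof (rule abs_continuous_on_has_integral[OF _ assms(4)])
  show "abs_continuous_on {s..t} x"
    by (rule abs_continuous_on_subset[OF assms(1)]) (use assms in auto)
  show "AE r in lebesgue_on {s<..<t}. (x has_vector_derivative h r) (at r)"
    by (rule AE_lebesgue_on_subset[OF assms(2)]) (use assms in auto)
qed

text \<open>On the compact convex set of states of norm at most \<open>R\<close> and controls of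
  norm at most \<open>M\<close>, a bound on the second derivative makes \<open>f'\<close> Lipschitz,
  and the mean value inequality turns this into a quadratic error of the linearization in the state.
  The control is held fixed, because controls will be changed by large amounts on small
  sets.\<close>

lemma C2_local_bounds:
  fixes f :: "'x::euclidean_space \<times> 'u::euclidean_space \<Rightarrow> 'z::euclidean_space"
  assumes f': "\<And>z. (f has_derivative blinfun_apply (f' z)) (at z)" and "class_C1 f'"
  obtains L where "L > 0"
    "\<And>x u. norm x \<le> R \<Longrightarrow> norm u \<le> M \<Longrightarrow> norm (f (x, u)) \<le> L"
    "\<And>x u. norm x \<le> R \<Longrightarrow> norm u \<le> M \<Longrightarrow> norm (f' (x, u)) \<le> L"
    "\<And>x y u. norm x \<le> R \<Longrightarrow> norm y \<le> R \<Longrightarrow> norm u \<le> M \<Longrightarrow> norm (f (y, u) - f (x, u)) \<le> L * norm (y - x)"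
    "\<And>x y u. norm x \<le> R \<Longrightarrow> norm y \<le> R \<Longrightarrow> norm u \<le> M \<Longrightarrow>
      norm (f (y, u) - f (x, u) - f' (x, u) (y - x, 0)) \<le> L * (norm (y - x))\<^sup>2"
proof -
  define S where "S = cball (0::'x) R \<times> cball (0::'u) M"
  have S: "compact S" "convex S" unfolding S_def by (auto intro: compact_Times convex_Times)
  obtain f'' where f'': "\<And>z. (f' has_derivative blinfun_apply (f'' z)) (at z)" "continuous_on UNIV f''"
    using \<open>class_C1 f'\<close> unfolding class_C1_def by blast
  have cf: "continuous_on S f" "continuous_on S f'" "continuous_on S f''"
    using has_derivative_continuous[OF f'] has_derivative_continuous[OF f''(1)] continuous_on_subset[OF f''(2)]
    by (simp_all add: continuous_at_imp_continuous_on)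
  have "\<exists>B. \<forall>z\<in>S. norm (h z) \<le> B" if "continuous_on S h" for h :: "'x \<times> 'u \<Rightarrow> 'w::real_normed_vector"
    using compact_imp_bounded[OF compact_continuous_image[OF that S(1)]] by (auto simp: bounded_iff)
  from this[OF cf(1)] this[OF cf(2)] obtain B0 B1 where B01: "\<forall>z\<in>S. norm (f z) \<le> B0" "\<forall>z\<in>S. norm (f' z) \<le> B1"
    by blast
  have "bounded (f'' ` S)"
    by (rule compact_imp_bounded[OF compact_continuous_image[OF cf(3) S(1)]])
  then obtain B2 where B2: "\<forall>z\<in>S. norm (f'' z) \<le> B2" by (auto simp: bounded_iff)
  define L where "L = max 1 (max B0 (max B1 B2))"
  have L: "L \<ge> 1" "\<And>z. z \<in> S \<Longrightarrow> norm (f z) \<le> L" "\<And>z. z \<in> S \<Longrightarrow> norm (f' z) \<le> L"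
    "\<And>z. z \<in> S \<Longrightarrow> norm (f'' z) \<le> L"
    using B01 B2 by (auto simp: L_def le_max_iff_disj)
  have lip: "norm (f y - f x) \<le> L * norm (y - x)" if "x \<in> S" "y \<in> S" for x y
    by (rule differentiable_bound[OF S(2), of f f'])
      (use f' L(3) that in \<open>auto intro: has_derivative_at_withinI simp: norm_blinfun.rep_eq[symmetric]\<close>)
  have lip': "norm (f' y - f' x) \<le> L * norm (y - x)" if "x \<in> S" "y \<in> S" for x y
    by (rule differentiable_bound[OF S(2), of f' f''])
      (use f''(1) L(4) that in \<open>auto intro: has_derivative_at_withinI simp: norm_blinfun.rep_eq[symmetric]\<close>)
  show thesis
  proof (rule that)
    show "L > 0" using L(1) by simp
    fix x :: 'x and u :: 'u assume xu: "norm x \<le> R" "norm u \<le> M"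
    then have S1: "(x, u) \<in> S" by (simp add: S_def)
    show "norm (f (x, u)) \<le> L" "norm (f' (x, u)) \<le> L" using L(2,3) S1 by auto
    fix y :: 'x assume y: "norm y \<le> R"
    then have S2: "(y, u) \<in> S" using xu by (simp add: S_def)
    show "norm (f (y, u) - f (x, u)) \<le> L * norm (y - x)"
      using lip[OF S1 S2] by (simp add: norm_Pair)
    \<comment> \<open>Subtracting the linear part at \<open>x\<close> leaves a function whose
      derivative at \<open>v\<close> is the difference of \<open>f' (v, u)\<close> and
      \<open>f' (x, u)\<close> in state directions, which is at most \<open>L * norm (y - x)\<close>
      along the segment.\<close>
    define k where "k v = f (v, u) - f' (x, u) (v, 0)" for v
    have "norm (k y - k x) \<le> (L * norm (y - x)) * norm (y - x)"
    proof (rule differentiable_bound[OF convex_closed_segment, of x y k "\<lambda>v h. f' (v, u) (h, 0) - f' (x, u) (h, 0)"])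
      fix v assume v: "v \<in> closed_segment x y"
      have "closed_segment x y \<subseteq> cball 0 R"
        by (rule closed_segment_subset) (use xu y in auto)
      then have S3: "(v, u) \<in> S" using v xu by (auto simp: S_def)
      have "((\<lambda>v. f (v, u)) has_derivative (\<lambda>h. f' (v, u) (h, 0))) (at v)"
        by (rule has_derivative_compose[of "\<lambda>v. (v, u)" "\<lambda>h. (h, 0)", OF _ f']) (auto intro!: derivative_eq_intros)
      moreover have "((\<lambda>v. f' (x, u) (v, 0)) has_derivative (\<lambda>h. f' (x, u) (h, 0))) (at v)"
        by (intro bounded_linear_imp_has_derivative bounded_linear_compose[OF blinfun.bounded_linear_right]
            bounded_linear_Pair bounded_linear_ident bounded_linear_zero)
      ultimately show "(k has_derivative (\<lambda>h. f' (v, u) (h, 0) - f' (x, u) (h, 0))) (at v within closed_segment x y)"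
        unfolding k_def by (rule has_derivative_at_withinI[OF has_derivative_diff])
      show "onorm (\<lambda>h. f' (v, u) (h, 0) - f' (x, u) (h, 0)) \<le> L * norm (y - x)"
      proof (rule onorm_le)
        fix h
        have "norm (f' (v, u) (h, 0) - f' (x, u) (h, 0)) \<le> norm (f' (v, u) - f' (x, u)) * norm (h, 0::'u)"
          unfolding blinfun.diff_left[symmetric] by (rule norm_blinfun)
        also have "norm (f' (v, u) - f' (x, u)) \<le> L * norm ((v, u) - (x, u))" by (rule lip'[OF S1 S3])
        also have "\<dots> = L * norm (v - x)" by (simp add: norm_Pair)
        also have "\<dots> \<le> L * norm (y - x)"
          using segment_bound(1)[OF v] L(1) by (intro mult_left_mono) auto
        finally show "norm (f' (v, u) (h, 0) - f' (x, u) (h, 0)) \<le> L * norm (y - x) * norm h"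
          by (simp add: norm_Pair mult_right_mono)
      qed
    qed auto
    moreover have "k y - k x = f (y, u) - f (x, u) - f' (x, u) (y - x, 0)"
    proof -
      have "f' (x, u) (y - x, 0) = f' (x, u) (y, 0) - f' (x, u) (x, 0)"
        unfolding blinfun.diff_right[symmetric] by simp
      then show ?thesis by (simp add: k_def)
    qed
    ultimately show "norm (f (y, u) - f (x, u) - f' (x, u) (y - x, 0)) \<le> L * (norm (y - x))\<^sup>2"
      by (simp add: power2_eq_square mult.assoc)
  qed
qed

text \<open>The equation is stated by testing against every direction \<open>h\<close>, which avoids
  naming the transpose of the state derivative. These arcs are continuous on the whole interval; the
  jump of a costate arises from using different arcs before and after the crossing.\<close>

definition adjoint_arc ::
  "('x::euclidean_space \<times> 'u::euclidean_space \<Rightarrow> ('x \<times> 'u) \<Rightarrow>\<^sub>L 'x) \<Rightarrow> real \<Rightarrow> (real \<Rightarrow> 'u) \<Rightarrow> (real \<Rightarrow> 'x)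
    \<Rightarrow> (real \<Rightarrow> 'x) \<Rightarrow> bool"
where
  "adjoint_arc f' T ub xb p \<longleftrightarrow> (\<exists>C. C-lipschitz_on {0..T} p) \<and>
    (AE t in lebesgue_on {0<..<T}.
      \<exists>q. (p has_vector_derivative q) (at t) \<and> (\<forall>h. q \<bullet> h = - (p t \<bullet> f' (xb t, ub t) (h, 0))))"

text \<open>\<open>R\<close> bounds the reference trajectory, and the estimates hold up to
  \<open>R + 1\<close>, which leaves one unit of room for perturbed trajectories. \<open>M\<close>
  bounds the controls in use, including needle values, and \<open>L\<close> is one constant for all
  estimates.\<close>

locale reference_trajectory =
  fixes f :: "'x::euclidean_space \<times> 'u::euclidean_space \<Rightarrow> 'x"
    and f' :: "'x \<times> 'u \<Rightarrow> ('x \<times> 'u) \<Rightarrow>\<^sub>L 'x"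
    and U :: "'u set" and T M R L :: real and x0 :: 'x and ub :: "real \<Rightarrow> 'u" and xb :: "real \<Rightarrow> 'x"
  assumes T: "T > 0"
    and f_cont: "continuous_on UNIV f"
    and L: "L > 0"
    and f_bound: "\<And>x u. norm x \<le> R + 1 \<Longrightarrow> norm u \<le> M \<Longrightarrow> norm (f (x, u)) \<le> L"
    and f'_bound: "\<And>x u. norm x \<le> R + 1 \<Longrightarrow> norm u \<le> M \<Longrightarrow> norm (f' (x, u)) \<le> L"
    and f_lip: "\<And>x y u. norm x \<le> R + 1 \<Longrightarrow> norm y \<le> R + 1 \<Longrightarrow> norm u \<le> M \<Longrightarrow>
      norm (f (y, u) - f (x, u)) \<le> L * norm (y - x)"
    and f_rem: "\<And>x y u. norm x \<le> R + 1 \<Longrightarrow> norm y \<le> R + 1 \<Longrightarrow> norm u \<le> M \<Longrightarrow>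
      norm (f (y, u) - f (x, u) - f' (x, u) (y - x, 0)) \<le> L * (norm (y - x))\<^sup>2"
    and ub_meas: "ub \<in> borel_measurable (lebesgue_on {0..T})"
    and ub_U: "\<And>t. t \<in> {0..T} \<Longrightarrow> ub t \<in> U"
    and ub_M: "\<And>t. t \<in> {0..T} \<Longrightarrow> norm (ub t) \<le> M"
    and xb_state: "is_state f T x0 ub xb"
    and xb_R: "\<And>t. t \<in> {0..T} \<Longrightarrow> norm (xb t) \<le> R"
begin

section \<open>The reference trajectory and its perturbations\<close>

lemma R_nonneg: "R \<ge> 0"
  using xb_R[of 0] T norm_ge_zero[of "xb 0"] by (simp del: norm_ge_zero)

lemma measurable_dynamics:
  fixes h :: "'x \<times> 'u \<Rightarrow> 'y::euclidean_space"
  assumes "continuous_on UNIV h" "continuous_on {0..T} x" "w \<in> borel_measurable (lebesgue_on {0..T})"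
  shows "(\<lambda>t. h (x t, w t)) \<in> borel_measurable (lebesgue_on {0..T})"
proof -
  have "h \<in> borel_measurable borel" using assms(1) by (rule borel_measurable_continuous_onI)
  moreover have "x \<in> borel_measurable (lebesgue_on {0..T})"
    using assms(2) by (rule continuous_on_borel_measurable_lebesgue_on_Icc)
  ultimately show ?thesis
    using assms(3) by (intro measurable_compose[of "\<lambda>t. (x t, w t)" _ borel h] borel_measurable_Pair)
qed

lemma xb_continuous: "continuous_on {0..T} xb"
  using xb_state by (auto simp: is_state_def intro: abs_continuous_on_imp_continuous_on)

lemma xb_has_integral:
  assumes "0 \<le> s" "s \<le> t" "t \<le> T"
  shows "((\<lambda>r. f (xb r, ub r)) has_integral (xb t - xb s)) {s..t}"
  using xb_state assms by (intro abs_continuous_on_has_integral_subinterval[of 0 T]) (auto simp: is_state_def)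

lemma xb_lipschitz: "L-lipschitz_on {0..T} xb"
proof (rule lipschitz_onI)
  have *: "norm (xb t - xb s) \<le> L * (t - s)" if "0 \<le> s" "s \<le> t" "t \<le> T" for s t
  proof -
    have "norm (xb t - xb s) \<le> L * measure lborel (cbox s t)"
    proof (rule has_integral_bound)
      show "((\<lambda>r. f (xb r, ub r)) has_integral (xb t - xb s)) (cbox s t)"
        using xb_has_integral[OF that] by simp
      fix r assume "r \<in> cbox s t"
      then have "r \<in> {0..T}" using that by auto
      then show "norm (f (xb r, ub r)) \<le> L" using xb_R[of r] ub_M[of r] by (intro f_bound) auto
    qed (use L in simp)
    then show ?thesis using that by simp
  qed
  fix s t assume "s \<in> {0..T}" "t \<in> {0..T}"
  then show "dist (xb s) (xb t) \<le> L * dist s t"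
    using *[of s t] *[of t s] by (cases "s \<le> t") (auto simp: dist_norm norm_minus_commute)
qed (use L in simp)

text \<open>This is the Gronwall factor \<open>2 * exp (2 * L * T)\<close> times the largest change
  of velocity, \<open>2 * L\<close>, on the perturbed set.\<close>

definition variation_const :: real where
  "variation_const = 4 * L * exp (2 * L * T)"

lemma variation_const_pos: "variation_const > 0"
  using L by (simp add: variation_const_def)

text \<open>The set \<open>E\<close> carries the change of control, and the bound \<open>e\<close>
  on its measure is the small parameter; the values of \<open>w\<close> on \<open>E\<close> may be
  far from those of \<open>ub\<close>. The clause with \<open>E \<inter> {0..t} = {}\<close>
  expresses causality.\<close>

definition variation :: "(real \<Rightarrow> 'u) \<Rightarrow> real set \<Rightarrow> real \<Rightarrow> (real \<Rightarrow> 'x) \<Rightarrow> bool" where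
  "variation w E e x \<longleftrightarrow>
    w \<in> borel_measurable (lebesgue_on {0..T}) \<and> (\<forall>t\<in>{0..T}. w t \<in> U \<and> norm (w t) \<le> M) \<and>
    E \<in> sets lebesgue \<and> (\<forall>t\<in>{0..T} - E. w t = ub t) \<and> measure lebesgue (E \<inter> {0..T}) \<le> e \<and>
    is_state f T x0 w x \<and> (\<exists>C. C-lipschitz_on {0..T} x) \<and>
    (\<forall>t\<in>{0..T}. norm (x t) \<le> R + 1 \<and> norm (x t - xb t) \<le> variation_const * e) \<and>
    (\<forall>t\<in>{0..T}. E \<inter> {0..t} = {} \<longrightarrow> x t = xb t) \<and>
    (\<forall>s t. 0 \<le> s \<longrightarrow> s \<le> t \<longrightarrow> t \<le> T \<longrightarrow> ((\<lambda>r. f (x r, w r)) has_integral (x t - x s)) {s..t})"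

lemma lmeasurable_Int_Icc:
  assumes "E \<in> sets lebesgue"
  shows "E \<inter> {s..t::real} \<in> lmeasurable"
proof -
  have "{s..t} \<inter> E \<in> lmeasurable" using assms by (intro fmeasurable_Int_fmeasurable) auto
  then show ?thesis by (simp add: Int_commute)
qed

lemma indicator_has_integral:
  assumes "E \<in> sets lebesgue"
  shows "((indicator E :: real \<Rightarrow> real) has_integral measure lebesgue (E \<inter> {s..t})) {s..t}"
proof -
  have "E \<inter> {s..t} \<in> lmeasurable" using assms by (rule lmeasurable_Int_Icc)
  then show ?thesis
    by (metis (no_types) integrable_on_indicator integral_indicator integrable_integral)
qed

text \<open>Replacing \<open>x\<close> by its projection onto a large ball makes the dynamics globally Lipschitz;
  the perturbed trajectory stays in the ball, where the projection has no effect.\<close>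

lemma variation_exists:
  assumes w: "w \<in> borel_measurable (lebesgue_on {0..T})" "\<And>t. t \<in> {0..T} \<Longrightarrow> w t \<in> U \<and> norm (w t) \<le> M"
    and E: "E \<in> sets lebesgue" "\<And>t. t \<in> {0..T} - E \<Longrightarrow> w t = ub t" "measure lebesgue (E \<inter> {0..T}) \<le> e"
    and e: "variation_const * e \<le> 1"
  obtains x where "variation w E e x"
proof -
  define \<pi> where "\<pi> = closest_point (cball (0::'x) (R + 1))"
  have ball: "convex (cball (0::'x) (R + 1))" "closed (cball (0::'x) (R + 1))" "cball (0::'x) (R + 1) \<noteq> {}"
    using R_nonneg by auto
  have \<pi>_in: "norm (\<pi> x) \<le> R + 1" for x
    using closest_point_in_set[OF ball(2,3), of x] by (simp add: \<pi>_def)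
  have \<pi>_lip: "norm (\<pi> x - \<pi> y) \<le> norm (x - y)" for x y
    using closest_point_lipschitz[OF ball, of x y] by (simp add: \<pi>_def dist_norm)
  have \<pi>_id: "\<pi> x = x" if "norm x \<le> R + 1" for x
    unfolding \<pi>_def by (rule closest_point_self) (use that in simp)
  have \<pi>_cont: "continuous_on S \<pi>" for S
    unfolding \<pi>_def by (rule continuous_on_closest_point[OF ball])
  define F where "F t x = f (\<pi> x, w t)" for t x
  obtain x C where x: "C-lipschitz_on {0..T} x" "x 0 = x0"
    "AE t in lebesgue_on {0<..<T}. (x has_vector_derivative F t (x t)) (at t)"
  proof (rule caratheodory_solution[of 0 0 T F L L x0])
    fix x :: "real \<Rightarrow> 'x" assume "continuous_on {0..T} x"
    then have "continuous_on {0..T} (\<lambda>t. \<pi> (x t))"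
      by (rule continuous_on_compose2[OF \<pi>_cont]) auto
    then show "(\<lambda>t. F t (x t)) \<in> borel_measurable (lebesgue_on {0..T})"
      unfolding F_def by (rule measurable_dynamics[OF f_cont _ w(1)])
  next
    fix t and x y :: 'x assume t: "t \<in> {0..T}"
    show "norm (F t 0) \<le> L" unfolding F_def using w(2)[OF t] \<pi>_in by (intro f_bound) auto
    have "norm (F t x - F t y) \<le> L * norm (\<pi> x - \<pi> y)"
      unfolding F_def using w(2)[OF t] \<pi>_in by (intro f_lip) auto
    also have "\<dots> \<le> L * norm (x - y)" using L \<pi>_lip by (intro mult_left_mono) auto
    finally show "norm (F t x - F t y) \<le> L * norm (x - y)" .
  qed (use T in auto)
  have cx: "continuous_on {0..T} x" using x(1) by (rule lipschitz_on_continuous_on)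
  have F_int: "((\<lambda>r. F r (x r)) has_integral (x t - x s)) {s..t}" if st: "0 \<le> s" "s \<le> t" "t \<le> T" for s t
    by (rule abs_continuous_on_has_integral_subinterval[OF lipschitz_on_imp_abs_continuous_on[OF x(1)] x(3) st])
  define z where "z t = x t - xb t" for t
  have cz: "continuous_on {0..T} z" unfolding z_def by (intro continuous_intros cx xb_continuous)
  \<comment> \<open>The velocities differ by a Lipschitz term in the state and, on \<open>E\<close>
    only, by a term of full size \<open>2 * L\<close>.\<close>
  have pointwise: "norm (F r (x r) - f (xb r, ub r)) \<le> L * norm (z r) + 2 * L * indicator E r"
    if r: "r \<in> {0..T}" for r
  proof -
    have xbr: "norm (xb r) \<le> R + 1" using xb_R[OF r] by simp
    have "norm (F r (x r) - f (xb r, w r)) \<le> L * norm (\<pi> (x r) - \<pi> (xb r))"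
      unfolding F_def \<pi>_id[OF xbr] using w(2)[OF r] \<pi>_in xbr by (intro f_lip) auto
    also have "\<dots> \<le> L * norm (z r)" using L \<pi>_lip by (intro mult_left_mono) (auto simp: z_def)
    finally have 1: "norm (F r (x r) - f (xb r, w r)) \<le> L * norm (z r)" .
    have 2: "norm (f (xb r, w r) - f (xb r, ub r)) \<le> 2 * L * indicator E r"
    proof (cases "r \<in> E")
      case True
      have "norm (f (xb r, w r)) \<le> L" "norm (f (xb r, ub r)) \<le> L"
        using xbr w(2)[OF r] ub_M[OF r] by (auto intro: f_bound)
      then show ?thesis using True norm_triangle_ineq4[of "f (xb r, w r)" "f (xb r, ub r)"] by simp
    qed (use E(2) r in auto)
    show ?thesis using norm_triangle_ineq[of "F r (x r) - f (xb r, w r)" "f (xb r, w r) - f (xb r, ub r)"] 1 2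
      by simp
  qed
  \<comment> \<open>Counting only the part of \<open>E\<close> before \<open>t\<close> serves twice:
    it yields the global estimate, and it shows that the trajectories coincide as long as
    \<open>E\<close> has not been met.\<close>
  have z_bound: "norm (z t) \<le> variation_const * measure lebesgue (E \<inter> {0..t})" if t: "t \<in> {0..T}" for t
  proof -
    define c where "c = 2 * L * measure lebesgue (E \<inter> {0..t})"
    have c: "c \<ge> 0" using L by (simp add: c_def)
    have "norm (z t) \<le> 2 * c * exp (2 * L * \<bar>t - 0\<bar>)"
    proof (rule gronwall_crude[of 0 t "\<lambda>t. norm (z t)", OF _ _ L c])
      show "continuous_on {0..t} (\<lambda>t. norm (z t))"
        by (intro continuous_intros continuous_on_subset[OF cz]) (use t in auto)
      fix r assume r: "r \<in> {0..t}"
      have "((\<lambda>r. F r (x r) - f (xb r, ub r)) has_integral ((x r - x 0) - (xb r - xb 0))) {0..r}"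
        by (intro has_integral_diff F_int xb_has_integral) (use r t in auto)
      moreover have "(x r - x 0) - (xb r - xb 0) = z r"
        using x(2) xb_state by (simp add: z_def is_state_def)
      ultimately have I: "((\<lambda>r. F r (x r) - f (xb r, ub r)) has_integral z r) {0..r}" by simp
      have zI: "(\<lambda>t. norm (z t)) integrable_on {0..r}"
        by (intro integrable_continuous_real continuous_intros continuous_on_subset[OF cz]) (use r t in auto)
      have J: "((\<lambda>r. L * norm (z r) + 2 * L * indicator E r) has_integral
          (L * integral {0..r} (\<lambda>t. norm (z t)) + 2 * L * measure lebesgue (E \<inter> {0..r}))) {0..r}"
        by (intro has_integral_add has_integral_mult_right indicator_has_integral[OF E(1)]
            integrable_integral[OF zI])
      have "norm (z r) \<le> L * integral {0..r} (\<lambda>t. norm (z t)) + 2 * L * measure lebesgue (E \<inter> {0..r})"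
        using integral_norm_bound_integral[OF has_integral_integrable[OF I] has_integral_integrable[OF J]]
          pointwise integral_unique[OF I] integral_unique[OF J] r t by auto
      also have "2 * L * measure lebesgue (E \<inter> {0..r}) \<le> c"
        unfolding c_def using L r E(1)
        by (intro mult_left_mono measure_mono_fmeasurable) 
          (auto intro: lmeasurable_Int_Icc fmeasurableD)
      finally show "norm (z r) \<le> c + L * integral {min 0 r..max 0 r} (\<lambda>t. norm (z t))"
        using r by simp
    qed (use t in auto)
    also have "\<dots> \<le> 2 * c * exp (2 * L * T)"
      using c L t by (intro mult_left_mono) auto
    finally show ?thesis by (simp add: c_def variation_const_def mult_ac)
  qed
  have meas_le: "measure lebesgue (E \<inter> {0..t}) \<le> e" if "t \<in> {0..T}" for t
  proof -
    have "measure lebesgue (E \<inter> {0..t}) \<le> measure lebesgue (E \<inter> {0..T})"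
      using that E(1) by (intro measure_mono_fmeasurable)
        (auto intro: lmeasurable_Int_Icc fmeasurableD)
    then show ?thesis using E(3) by simp
  qed
  have z_le: "norm (z t) \<le> variation_const * e" if "t \<in> {0..T}" for t
    using z_bound[OF that] mult_left_mono[OF meas_le[OF that], of variation_const] variation_const_pos by linarith
  have x_ball: "norm (x t) \<le> R + 1" if "t \<in> {0..T}" for t
    using z_le[OF that] e xb_R[OF that] norm_triangle_sub[of "x t" "xb t"] by (simp add: z_def)
  have F_eq: "F t (x t) = f (x t, w t)" if "t \<in> {0..T}" for t
    using \<pi>_id[OF x_ball[OF that]] by (simp add: F_def)
  have "variation w E e x" unfolding variation_def
  proof (intro conjI)
    show "is_state f T x0 w x" unfolding is_state_def
    proof (intro conjI lipschitz_on_imp_abs_continuous_on[OF x(1)] x(2))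
      show "AE t in lebesgue_on {0<..<T}. (x has_vector_derivative f (x t, w t)) (at t)"
        using x(3) AE_lebesgue_on_Ioo[of 0 T]
      proof eventually_elim
        case (elim t)
        then show ?case using F_eq[of t] by simp
      qed
    qed
    show "\<forall>t\<in>{0..T}. E \<inter> {0..t} = {} \<longrightarrow> x t = xb t"
    proof (intro ballI impI)
      fix t assume "t \<in> {0..T}" "E \<inter> {0..t} = {}"
      then show "x t = xb t" using z_bound[of t] by (simp add: z_def)
    qed
    show "\<forall>s t. 0 \<le> s \<longrightarrow> s \<le> t \<longrightarrow> t \<le> T \<longrightarrow> ((\<lambda>r. f (x r, w r)) has_integral (x t - x s)) {s..t}"
    proof (intro allI impI)
      fix s t assume st: "0 \<le> s" "s \<le> t" "t \<le> T"
      show "((\<lambda>r. f (x r, w r)) has_integral (x t - x s)) {s..t}"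
        by (rule has_integral_eq[OF _ F_int[OF st]]) (use F_eq st in auto)
    qed
  qed (use w E x(1) x_ball z_le in \<open>auto simp: z_def\<close>)
  then show thesis by (rule that)
qed

lemma lipschitz_on_inner:
  fixes p z :: "real \<Rightarrow> 'x"
  assumes "C-lipschitz_on {a..b} p" "D-lipschitz_on {a..b} z"
  obtains K where "K-lipschitz_on {a..b} (\<lambda>t. p t \<bullet> z t)"
proof -
  obtain P where P: "\<forall>t\<in>{a..b}. norm (p t) \<le> P" "P \<ge> 0"
    using continuous_on_Icc_bounded[OF lipschitz_on_continuous_on[OF assms(1)]] .
  obtain Z where Z: "\<forall>t\<in>{a..b}. norm (z t) \<le> Z" "Z \<ge> 0"
    using continuous_on_Icc_bounded[OF lipschitz_on_continuous_on[OF assms(2)]] .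
  have "(P * D + C * Z)-lipschitz_on {a..b} (\<lambda>t. p t \<bullet> z t)"
  proof (rule lipschitz_onI)
    fix s t assume st: "s \<in> {a..b}" "t \<in> {a..b}"
    have "p s \<bullet> z s - p t \<bullet> z t = p s \<bullet> (z s - z t) + (p s - p t) \<bullet> z t"
      by (simp add: inner_diff_left inner_diff_right)
    moreover have "\<bar>p s \<bullet> (z s - z t)\<bar> \<le> P * (D * dist s t)"
      using P st lipschitz_onD[OF assms(2) st]
      by (intro order.trans[OF Cauchy_Schwarz_ineq2] mult_mono) (auto simp: dist_norm)
    moreover have "\<bar>(p s - p t) \<bullet> z t\<bar> \<le> (C * dist s t) * Z"
      using Z st lipschitz_onD[OF assms(1) st] lipschitz_on_nonneg[OF assms(1)]
      by (intro order.trans[OF Cauchy_Schwarz_ineq2] mult_mono) (auto simp: dist_norm)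
    ultimately show "dist (p s \<bullet> z s) (p t \<bullet> z t) \<le> (P * D + C * Z) * dist s t"
      by (simp add: dist_real_def algebra_simps abs_le_iff)
  qed (use P Z lipschitz_on_nonneg[OF assms(1)] lipschitz_on_nonneg[OF assms(2)] in auto)
  then show thesis by (rule that)
qed

text \<open>Since \<open>p\<close> solves the adjoint equation, the derivative of \<open>p \<bullet> (x - xb)\<close> differs from
  \<open>p \<bullet> (f (xb, w) - f (xb, ub))\<close> by a second-order remainder, plus a first-order one on the set where
  the controls differ.\<close>

lemma first_variation:
  assumes p: "adjoint_arc f' T ub xb p"
  obtains C where "C \<ge> 0" "\<forall>w E e x t. variation w E e x \<longrightarrow> t \<in> {0..T} \<longrightarrow>
    \<bar>p t \<bullet> (x t - xb t) - integral {0..t} (\<lambda>r. p r \<bullet> (f (xb r, w r) - f (xb r, ub r)))\<bar> \<le> C * e\<^sup>2 \<and>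
    (\<lambda>r. p r \<bullet> (f (xb r, w r) - f (xb r, ub r))) integrable_on {0..t}"
proof -
  obtain Cp where Cp: "Cp-lipschitz_on {0..T} p" using p by (auto simp: adjoint_arc_def)
  have cp: "continuous_on {0..T} p" using Cp by (rule lipschitz_on_continuous_on)
  obtain P where P: "\<forall>t\<in>{0..T}. norm (p t) \<le> P" "P \<ge> 0" using continuous_on_Icc_bounded[OF cp] .
  define k where "k = variation_const"
  have k: "k > 0" by (simp add: k_def variation_const_pos)
  \<comment> \<open>The quadratic remainder \<open>P * L * (k * e)\<^sup>2\<close> over a time of at
    most \<open>T\<close> gives the first summand; an error of size \<open>2 * P * L * k * e\<close>
    on a set of measure at most \<open>e\<close> gives the second.\<close>
  define C where "C = P * L * (k\<^sup>2 * T + 2 * k)"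
  have main: "\<bar>p t \<bullet> (x t - xb t) - integral {0..t} (\<lambda>r. p r \<bullet> (f (xb r, w r) - f (xb r, ub r)))\<bar> \<le> C * e\<^sup>2 \<and>
    (\<lambda>r. p r \<bullet> (f (xb r, w r) - f (xb r, ub r))) integrable_on {0..t}"
    if v: "variation w E e x" and t: "t \<in> {0..T}" for w E e x t
  proof -
    obtain Cx where Cx: "Cx-lipschitz_on {0..T} x" using v by (auto simp: variation_def)
    have w: "w \<in> borel_measurable (lebesgue_on {0..T})" "\<And>t. t \<in> {0..T} \<Longrightarrow> norm (w t) \<le> M"
      and E: "E \<in> sets lebesgue" "\<And>t. t \<in> {0..T} - E \<Longrightarrow> w t = ub t" "measure lebesgue (E \<inter> {0..T}) \<le> e"
      and x: "is_state f T x0 w x" "\<And>t. t \<in> {0..T} \<Longrightarrow> norm (x t) \<le> R + 1"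
        "\<And>t. t \<in> {0..T} \<Longrightarrow> norm (x t - xb t) \<le> k * e"
      using v by (auto simp: variation_def k_def)
    have e: "e \<ge> 0" using E(3) measure_nonneg[of lebesgue "E \<inter> {0..T}"] by linarith
    define z where "z t = x t - xb t" for t
    have zlip: "(Cx + L)-lipschitz_on {0..T} z"
      unfolding z_def by (intro lipschitz_on_diff Cx xb_lipschitz)
    \<comment> \<open>This is the derivative of \<open>p \<bullet> z\<close>; its last term comes
      from the adjoint equation.\<close>
    define h where "h r = p r \<bullet> (f (x r, w r) - f (xb r, ub r)) - p r \<bullet> f' (xb r, ub r) (z r, 0)" for r
    obtain K where K: "K-lipschitz_on {0..T} (\<lambda>t. p t \<bullet> z t)"
      by (rule lipschitz_on_inner[OF Cp zlip])
    have "AE r in lebesgue_on {0<..<T}. ((\<lambda>t. p t \<bullet> z t) has_vector_derivative h r) (at r)"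
    proof -
      have 1: "AE r in lebesgue_on {0<..<T}. (x has_vector_derivative f (x r, w r)) (at r)"
        using x(1) by (simp add: is_state_def)
      have 2: "AE r in lebesgue_on {0<..<T}. (xb has_vector_derivative f (xb r, ub r)) (at r)"
        using xb_state by (simp add: is_state_def)
      have 3: "AE r in lebesgue_on {0<..<T}.
          \<exists>q. (p has_vector_derivative q) (at r) \<and> (\<forall>h. q \<bullet> h = - (p r \<bullet> f' (xb r, ub r) (h, 0)))"
        using p by (simp add: adjoint_arc_def)
      from 1 2 3 show ?thesis
      proof eventually_elim
        case (elim r)
        then obtain q where q: "(p has_vector_derivative q) (at r)" "\<forall>h. q \<bullet> h = - (p r \<bullet> f' (xb r, ub r) (h, 0))"
          by blast
        have "(z has_vector_derivative (f (x r, w r) - f (xb r, ub r))) (at r)"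
          unfolding z_def by (intro has_vector_derivative_diff elim(1,2))
        then have "((\<lambda>t. p t \<bullet> z t) has_vector_derivative (p r \<bullet> (f (x r, w r) - f (xb r, ub r)) + q \<bullet> z r)) (at r)"
          by (rule bounded_bilinear.has_vector_derivative[OF bounded_bilinear_inner q(1)])
        then show ?case using q(2) by (simp add: h_def)
      qed
    qed
    then have h: "(h has_integral (p t \<bullet> z t - p 0 \<bullet> z 0)) {0..t}"
      by (rule abs_continuous_on_has_integral_subinterval[OF lipschitz_on_imp_abs_continuous_on[OF K]])
        (use t in auto)
    have z0: "z 0 = 0" using x(1) xb_state by (simp add: z_def is_state_def)
    define g where "g r = p r \<bullet> (f (xb r, w r) - f (xb r, ub r))" for r
    have gint: "g integrable_on {0..t}"
    proof (rule integrable_on_subinterval)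
      show "g integrable_on {0..T}"
      proof (rule integrable_on_bounded_measurable)
        have [measurable]: "p \<in> borel_measurable (lebesgue_on {0..T})"
          "(\<lambda>r. f (xb r, w r)) \<in> borel_measurable (lebesgue_on {0..T})"
          "(\<lambda>r. f (xb r, ub r)) \<in> borel_measurable (lebesgue_on {0..T})"
          by (intro continuous_on_borel_measurable_lebesgue_on_Icc cp
              measurable_dynamics[OF f_cont xb_continuous] w(1) ub_meas)+
        show "g \<in> borel_measurable (lebesgue_on {0..T})" unfolding g_def by measurable
        fix r assume r: "r \<in> {0..T}"
        have "norm (f (xb r, w r)) \<le> L" "norm (f (xb r, ub r)) \<le> L"
          using xb_R[OF r] w(2)[OF r] ub_M[OF r] by (auto intro: f_bound)
        then have "norm (f (xb r, w r) - f (xb r, ub r)) \<le> 2 * L"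
          using norm_triangle_ineq4[of "f (xb r, w r)" "f (xb r, ub r)"] by linarith
        then show "norm (g r) \<le> P * (2 * L)"
          unfolding g_def real_norm_def using P r
          by (intro order.trans[OF Cauchy_Schwarz_ineq2] mult_mono) auto
      qed
    qed (use t in auto)
    have D: "((\<lambda>r. h r - g r) has_integral (p t \<bullet> z t - integral {0..t} g)) {0..t}"
      using has_integral_diff[OF h integrable_integral[OF gint]] z0 by simp
    have B: "((\<lambda>r. P * L * (k * e)\<^sup>2 + P * (2 * L * (k * e)) * indicator E r) has_integral
        (t *\<^sub>R (P * L * (k * e)\<^sup>2) + P * (2 * L * (k * e)) * measure lebesgue (E \<inter> {0..t}))) {0..t}"
      using has_integral_const_real[of "P * L * (k * e)\<^sup>2" 0 t] t
      by (intro has_integral_add has_integral_mult_right indicator_has_integral[OF E(1)]) simp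
    have le: "norm (h r - g r) \<le> P * L * (k * e)\<^sup>2 + P * (2 * L * (k * e)) * indicator E r" if "r \<in> {0..t}" for r
    proof -
      have r: "r \<in> {0..T}" using that t by auto
      have nx: "norm (x r) \<le> R + 1" "norm (xb r) \<le> R + 1" "norm (w r) \<le> M" "norm (ub r) \<le> M"
        using x(2)[OF r] xb_R[OF r] w(2)[OF r] ub_M[OF r] by auto
      have zr: "norm (z r) \<le> k * e" using x(3)[OF r] by (simp add: z_def)
      have "h r - g r = p r \<bullet> (f (x r, w r) - f (xb r, w r) - f' (xb r, ub r) (z r, 0))"
        by (simp add: h_def g_def inner_diff_right)
      then have hg: "norm (h r - g r) \<le> P * norm (f (x r, w r) - f (xb r, w r) - f' (xb r, ub r) (z r, 0))"
        using P r by (auto intro!: order.trans[OF Cauchy_Schwarz_ineq2] mult_right_mono)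
      show ?thesis
      proof (cases "r \<in> E")
        case False
        then have "w r = ub r" using E(2) r by simp
        then have "norm (f (x r, w r) - f (xb r, w r) - f' (xb r, ub r) (z r, 0)) \<le> L * (norm (z r))\<^sup>2"
          using f_rem[OF nx(2) nx(1) nx(4)] by (simp add: z_def)
        also have "\<dots> \<le> L * (k * e)\<^sup>2" using L zr by (intro mult_left_mono power_mono) auto
        finally have "P * norm (f (x r, w r) - f (xb r, w r) - f' (xb r, ub r) (z r, 0)) \<le> P * (L * (k * e)\<^sup>2)"
          using P(2) by (intro mult_left_mono)
        with hg False show ?thesis by (simp add: mult.assoc)
      next
        case True
        have "norm (f (x r, w r) - f (xb r, w r)) \<le> L * norm (z r)"
          using f_lip[OF nx(2) nx(1) nx(3)] by (simp add: z_def)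
        moreover have "norm (f' (xb r, ub r) (z r, 0)) \<le> L * norm (z r)"
          using norm_blinfun[of "f' (xb r, ub r)" "(z r, 0)"]
            mult_right_mono[OF f'_bound[OF nx(2) nx(4)], of "norm (z r)"] by (simp add: norm_Pair)
        moreover have "L * norm (z r) \<le> L * (k * e)" using L zr by (intro mult_left_mono) auto
        ultimately have "norm (f (x r, w r) - f (xb r, w r) - f' (xb r, ub r) (z r, 0)) \<le> 2 * L * (k * e)"
          using norm_triangle_ineq4[of "f (x r, w r) - f (xb r, w r)" "f' (xb r, ub r) (z r, 0)"] by linarith
        then have "P * norm (f (x r, w r) - f (xb r, w r) - f' (xb r, ub r) (z r, 0)) \<le> P * (2 * L * (k * e))"
          using P(2) by (intro mult_left_mono)
        moreover have "0 \<le> P * L * (k * e)\<^sup>2" using P(2) L by simp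
        ultimately show ?thesis using hg True by simp
      qed
    qed
    have "norm (p t \<bullet> z t - integral {0..t} g) \<le>
        t *\<^sub>R (P * L * (k * e)\<^sup>2) + P * (2 * L * (k * e)) * measure lebesgue (E \<inter> {0..t})"
      using integral_norm_bound_integral[OF has_integral_integrable[OF D] has_integral_integrable[OF B] le]
        integral_unique[OF D] integral_unique[OF B] by simp
    also have "\<dots> \<le> T * (P * L * (k * e)\<^sup>2) + P * (2 * L * (k * e)) * e"
    proof -
      have "measure lebesgue (E \<inter> {0..t}) \<le> measure lebesgue (E \<inter> {0..T})"
        using t E(1) by (intro measure_mono_fmeasurable)
          (auto intro: lmeasurable_Int_Icc fmeasurableD)
      then have "measure lebesgue (E \<inter> {0..t}) \<le> e" using E(3) by simp
      then show ?thesis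
        using t P(2) L k e unfolding real_scaleR_def by (intro add_mono mult_right_mono mult_left_mono) auto
    qed
    also have "\<dots> = C * e\<^sup>2" by (simp add: C_def power2_eq_square algebra_simps)
    finally show ?thesis using gint by (simp add: g_def[abs_def] z_def)
  qed
  have "C \<ge> 0" using P(2) L k T by (simp add: C_def)
  then show thesis by (rule that) (intro allI impI main)
qed

end

lemma lmeasurable_Ico: "{a..<b::real} \<in> lmeasurable"
  by (rule bounded_set_imp_lmeasurable) (auto intro: bounded_subset[OF bounded_closed_interval[of a b]])

context reference_trajectory
begin

section \<open>First variation under one or two needles\<close>

lemma adjoint_arc_continuous: "adjoint_arc f' T ub xb p \<Longrightarrow> continuous_on {0..T} p"
  by (auto simp: adjoint_arc_def intro: lipschitz_on_continuous_on)

text \<open>This increment of the Hamiltonian is the integrand of the first variation for a needle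
  with value \<open>v\<close>.\<close>

definition needle :: "(real \<Rightarrow> 'x) \<Rightarrow> 'u \<Rightarrow> real \<Rightarrow> real" where
  "needle p v r = p r \<bullet> (f (xb r, v) - f (xb r, ub r))"

text \<open>On a short interval the arc \<open>p\<close> and the state in the needle term may be
  frozen at \<open>c\<close> with an error quadratic in the length. The true displacement
  \<open>xb b - xb a\<close> is kept, because \<open>ub\<close> is merely measurable and its values
  cannot be frozen.\<close>

lemma needle_integral:
  assumes p: "adjoint_arc f' T ub xb p"
  obtains C where "C \<ge> 0" "\<forall>v a b c. norm v \<le> M \<longrightarrow> 0 \<le> a \<longrightarrow> a \<le> c \<longrightarrow> c \<le> b \<longrightarrow> b \<le> T \<longrightarrow>
    needle p v integrable_on {a..b} \<and>
    \<bar>integral {a..b} (needle p v) - p c \<bullet> ((b - a) *\<^sub>R f (xb c, v) - (xb b - xb a))\<bar> \<le> C * (b - a)\<^sup>2"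
proof -
  obtain Cp where Cp: "Cp-lipschitz_on {0..T} p" using p by (auto simp: adjoint_arc_def)
  have Cp0: "Cp \<ge> 0" using Cp by (rule lipschitz_on_nonneg)
  have cp: "continuous_on {0..T} p" using p by (rule adjoint_arc_continuous)
  obtain P where P: "\<forall>t\<in>{0..T}. norm (p t) \<le> P" "P \<ge> 0" using continuous_on_Icc_bounded[OF cp] .
  \<comment> \<open>Moving \<open>p\<close> to the time \<open>c\<close> costs \<open>Cp * L\<close>
    in each of the two velocity terms; moving the state in \<open>f (xb r, v)\<close> costs
    \<open>P * L * L\<close>.\<close>
  define C where "C = 2 * Cp * L + P * L * L"
  have C: "C \<ge> 0" using Cp0 P(2) L by (simp add: C_def)
  have main: "needle p v integrable_on {a..b} \<and>
    \<bar>integral {a..b} (needle p v) - p c \<bullet> ((b - a) *\<^sub>R f (xb c, v) - (xb b - xb a))\<bar> \<le> C * (b - a)\<^sup>2"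
    if v: "norm v \<le> M" and abc: "0 \<le> a" "a \<le> c" "c \<le> b" "b \<le> T" for v a b c
  proof -
    have fb: "norm (f (xb r, v)) \<le> L" "norm (f (xb r, ub r)) \<le> L" if "r \<in> {0..T}" for r
      using xb_R[OF that] v ub_M[OF that] by (auto intro: f_bound)
    have int: "needle p v integrable_on {a..b}"
    proof (rule integrable_on_subinterval)
      show "needle p v integrable_on {0..T}"
      proof (rule integrable_on_bounded_measurable)
        have [measurable]: "p \<in> borel_measurable (lebesgue_on {0..T})"
          "(\<lambda>r. f (xb r, v)) \<in> borel_measurable (lebesgue_on {0..T})"
          "(\<lambda>r. f (xb r, ub r)) \<in> borel_measurable (lebesgue_on {0..T})"
          by (intro continuous_on_borel_measurable_lebesgue_on_Icc cp
              measurable_dynamics[OF f_cont xb_continuous] ub_meas borel_measurable_const)+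
        show "needle p v \<in> borel_measurable (lebesgue_on {0..T})" unfolding needle_def[abs_def] by measurable
        fix r assume r: "r \<in> {0..T}"
        have "norm (f (xb r, v) - f (xb r, ub r)) \<le> 2 * L"
          using fb[OF r] norm_triangle_ineq4[of "f (xb r, v)" "f (xb r, ub r)"] by linarith
        then show "norm (needle p v r) \<le> P * (2 * L)"
          unfolding needle_def real_norm_def using P r
          by (intro order.trans[OF Cauchy_Schwarz_ineq2] mult_mono) auto
      qed
    qed (use abc in auto)
    have 1: "((\<lambda>r. p c \<bullet> (f (xb c, v) - f (xb r, ub r))) has_integral
        p c \<bullet> ((b - a) *\<^sub>R f (xb c, v) - (xb b - xb a))) {a..b}"
    proof -
      have "((\<lambda>r. f (xb c, v) - f (xb r, ub r)) has_integral ((b - a) *\<^sub>R f (xb c, v) - (xb b - xb a))) {a..b}"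
        using has_integral_const_real[of "f (xb c, v)" a b] abc
        by (intro has_integral_diff xb_has_integral) auto
      from has_integral_linear[OF this bounded_linear_inner_right[of "p c"]] show ?thesis
        by (simp add: o_def)
    qed
    have "norm (needle p v r - p c \<bullet> (f (xb c, v) - f (xb r, ub r))) \<le> C * (b - a)" if r: "r \<in> {a..b}" for r
    proof -
      have rT: "r \<in> {0..T}" "c \<in> {0..T}" using r abc by auto
      have rc: "dist r c \<le> b - a" using r abc by (auto simp: dist_real_def)
      have "dist (p r) (p c) \<le> Cp * dist r c" by (rule lipschitz_onD[OF Cp rT])
      also have "\<dots> \<le> Cp * (b - a)" using rc Cp0 by (intro mult_left_mono)
      finally have dp: "norm (p r - p c) \<le> Cp * (b - a)" "0 \<le> Cp * (b - a)"
        using Cp0 abc by (simp_all add: dist_norm)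
      have "norm (f (xb r, v) - f (xb c, v)) \<le> L * norm (xb r - xb c)"
        using xb_R[OF rT(1)] xb_R[OF rT(2)] v by (intro f_lip) auto
      also have "\<dots> \<le> L * (L * dist r c)"
        using lipschitz_onD[OF xb_lipschitz rT] L by (intro mult_left_mono) (auto simp: dist_norm)
      also have "\<dots> \<le> L * (L * (b - a))" using rc L by (intro mult_left_mono) auto
      finally have df: "norm (f (xb r, v) - f (xb c, v)) \<le> L * (L * (b - a))" .
      have "needle p v r - p c \<bullet> (f (xb c, v) - f (xb r, ub r))
          = (p r - p c) \<bullet> f (xb r, v) + p c \<bullet> (f (xb r, v) - f (xb c, v)) - (p r - p c) \<bullet> f (xb r, ub r)"
        by (simp add: needle_def algebra_simps inner_simps)
      moreover have "\<bar>(p r - p c) \<bullet> f (xb r, v)\<bar> \<le> Cp * (b - a) * L"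
        by (intro order.trans[OF Cauchy_Schwarz_ineq2] mult_mono dp fb[OF rT(1)] norm_ge_zero)
      moreover have "\<bar>(p r - p c) \<bullet> f (xb r, ub r)\<bar> \<le> Cp * (b - a) * L"
        by (intro order.trans[OF Cauchy_Schwarz_ineq2] mult_mono dp fb[OF rT(1)] norm_ge_zero)
      moreover have "\<bar>p c \<bullet> (f (xb r, v) - f (xb c, v))\<bar> \<le> P * (L * (L * (b - a)))"
        using df P rT by (intro order.trans[OF Cauchy_Schwarz_ineq2] mult_mono) auto
      moreover have "C * (b - a) = Cp * (b - a) * L + Cp * (b - a) * L + P * (L * (L * (b - a)))"
        by (simp add: C_def algebra_simps)
      ultimately show ?thesis unfolding real_norm_def by linarith
    qed
    moreover have "((\<lambda>r. needle p v r - p c \<bullet> (f (xb c, v) - f (xb r, ub r))) has_integral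
        (integral {a..b} (needle p v) - p c \<bullet> ((b - a) *\<^sub>R f (xb c, v) - (xb b - xb a)))) (cbox a b)"
      using has_integral_diff[OF integrable_integral[OF int] 1] by simp
    ultimately have "norm (integral {a..b} (needle p v) - p c \<bullet> ((b - a) *\<^sub>R f (xb c, v) - (xb b - xb a)))
        \<le> C * (b - a) * measure lborel (cbox a b)"
      using C abc by (intro has_integral_bound[where f = "\<lambda>r. needle p v r - p c \<bullet> (f (xb c, v) - f (xb r, ub r))"]) auto
    then show ?thesis using int abc by (simp add: power2_eq_square mult.assoc)
  qed
  from C show thesis by (rule that) (intro allI impI main)
qed

text \<open>The needle before \<open>s\<close> probes the Hamiltonian; the second one, on
  \<open>{l..<r}\<close>, allows the jump of the control to be moved and is switched off by
  \<open>l = r\<close>. Half-open intervals keep needles disjoint when \<open>s = l\<close>.\<close>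

definition needle_control :: "real \<Rightarrow> 'u \<Rightarrow> 'u \<Rightarrow> real \<Rightarrow> real \<Rightarrow> real \<Rightarrow> real \<Rightarrow> 'u" where
  "needle_control s v v2 e l r t = (if t \<in> {s - e..<s} then v else if t \<in> {l..<r} then v2 else ub t)"

abbreviation needle_set :: "real \<Rightarrow> real \<Rightarrow> real \<Rightarrow> real \<Rightarrow> real set" where
  "needle_set s e l r \<equiv> {s - e..<s} \<union> {l..<r}"

lemma needle_variation_exists:
  assumes "v \<in> U" "norm v \<le> M" "v2 \<in> U" "norm v2 \<le> M" "0 \<le> e" "l \<le> r" "variation_const * (e + (r - l)) \<le> 1"
  shows "\<exists>x. variation (needle_control s v v2 e l r) (needle_set s e l r) (e + (r - l)) x"
proof -
  have "measure lebesgue (needle_set s e l r \<inter> {0..T}) \<le> measure lebesgue (needle_set s e l r)"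
    by (intro measure_mono_fmeasurable fmeasurableD) (auto intro!: fmeasurable.Un lmeasurable_Ico)
  also have "\<dots> \<le> measure lebesgue {s - e..<s} + measure lebesgue {l..<r}"
    by (intro measure_Un_le) auto
  also have "\<dots> = e + (r - l)" using assms by simp
  finally have "measure lebesgue (needle_set s e l r \<inter> {0..T}) \<le> e + (r - l)" .
  moreover have "needle_control s v v2 e l r \<in> borel_measurable (lebesgue_on {0..T})"
    unfolding needle_control_def using ub_meas
    by (intro measurable_If_set borel_measurable_const) (auto simp: sets_restrict_space)
  ultimately obtain x where "variation (needle_control s v v2 e l r) (needle_set s e l r) (e + (r - l)) x"
    using assms ub_U ub_M
    by (rule_tac variation_exists[of "needle_control s v v2 e l r" "needle_set s e l r" "e + (r - l)"])
      (auto simp: needle_control_def)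
  then show ?thesis by blast
qed

text \<open>The two clauses concern a time between the needles and a time after both. The freezing
  point \<open>c\<close> is left free in \<open>{l..r}\<close>, because the original crossing time
  will be the right or the left end of the second needle, depending on the direction of the
  shift.\<close>

lemma needle_first_variation:
  assumes p: "adjoint_arc f' T ub xb p"
  obtains C where "C \<ge> 0" "\<forall>s v v2 e l r x t. norm v \<le> M \<longrightarrow> norm v2 \<le> M \<longrightarrow> 0 \<le> e \<longrightarrow> 0 \<le> s - e \<longrightarrow> s \<le> l \<longrightarrow>
      l \<le> r \<longrightarrow> r \<le> T \<longrightarrow> variation (needle_control s v v2 e l r) (needle_set s e l r) (e + (r - l)) x \<longrightarrow>
      (s \<le> t \<and> t \<le> l \<longrightarrow>
        \<bar>p t \<bullet> (x t - xb t) - p s \<bullet> (e *\<^sub>R f (xb s, v) - (xb s - xb (s - e)))\<bar> \<le> C * (e + (r - l))\<^sup>2) \<and>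
      (r \<le> t \<and> t \<le> T \<longrightarrow> (\<forall>c\<in>{l..r}.
        \<bar>p t \<bullet> (x t - xb t) - p s \<bullet> (e *\<^sub>R f (xb s, v) - (xb s - xb (s - e)))
          - p c \<bullet> ((r - l) *\<^sub>R f (xb c, v2) - (xb r - xb l))\<bar> \<le> C * (e + (r - l))\<^sup>2))"
proof -
  obtain C1 where C1: "C1 \<ge> 0" "\<forall>w E e x t. variation w E e x \<longrightarrow> t \<in> {0..T} \<longrightarrow>
    \<bar>p t \<bullet> (x t - xb t) - integral {0..t} (\<lambda>r. p r \<bullet> (f (xb r, w r) - f (xb r, ub r)))\<bar> \<le> C1 * e\<^sup>2 \<and>
    (\<lambda>r. p r \<bullet> (f (xb r, w r) - f (xb r, ub r))) integrable_on {0..t}"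
    using first_variation[OF p] .
  obtain C2 where C2: "C2 \<ge> 0" "\<forall>v a b c. norm v \<le> M \<longrightarrow> 0 \<le> a \<longrightarrow> a \<le> c \<longrightarrow> c \<le> b \<longrightarrow> b \<le> T \<longrightarrow>
    needle p v integrable_on {a..b} \<and>
    \<bar>integral {a..b} (needle p v) - p c \<bullet> ((b - a) *\<^sub>R f (xb c, v) - (xb b - xb a))\<bar> \<le> C2 * (b - a)\<^sup>2"
    using needle_integral[OF p] .
  define C where "C = C1 + 2 * C2"
  have main: "(s \<le> t \<and> t \<le> l \<longrightarrow>
        \<bar>p t \<bullet> (x t - xb t) - p s \<bullet> (e *\<^sub>R f (xb s, v) - (xb s - xb (s - e)))\<bar> \<le> C * (e + (r - l))\<^sup>2) \<and>
      (r \<le> t \<and> t \<le> T \<longrightarrow> (\<forall>c\<in>{l..r}.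
        \<bar>p t \<bullet> (x t - xb t) - p s \<bullet> (e *\<^sub>R f (xb s, v) - (xb s - xb (s - e)))
          - p c \<bullet> ((r - l) *\<^sub>R f (xb c, v2) - (xb r - xb l))\<bar> \<le> C * (e + (r - l))\<^sup>2))"
    if v: "norm v \<le> M" "norm v2 \<le> M" and o: "0 \<le> e" "0 \<le> s - e" "s \<le> l" "l \<le> r" "r \<le> T"
      and var: "variation (needle_control s v v2 e l r) (needle_set s e l r) (e + (r - l)) x"
    for s v v2 e l r x t
  proof -
    define G where "G q = p q \<bullet> (f (xb q, needle_control s v v2 e l r q) - f (xb q, ub q))" for q
    define I1 where "I1 = integral {s - e..s} (needle p v)"
    define I2 where "I2 = integral {l..r} (needle p v2)"
    have i1: "(G has_integral I1) {s - e..s}"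
      unfolding I1_def
      by (rule has_integral_spike_finite[of "{s}" _ _ "needle p v"])
        (use C2(2)[rule_format, OF v(1), of "s - e" "s - e" s] o in
          \<open>auto simp: G_def needle_control_def needle_def integrable_integral\<close>)
    have i2: "(G has_integral I2) {l..r}"
      unfolding I2_def
      by (rule has_integral_spike_finite[of "{r}" _ _ "needle p v2"])
        (use C2(2)[rule_format, OF v(2), of l l r] o in
          \<open>auto simp: G_def needle_control_def needle_def integrable_integral\<close>)
    \<comment> \<open>Away from the needles the integrand vanishes, except possibly at
      \<open>b\<close>, where the next needle may start.\<close>
    have z: "(G has_integral 0) {a..b}"
      if "b \<le> s - e \<or> s \<le> a \<and> b \<le> l \<or> r \<le> a" for a b
      by (rule has_integral_spike_finite[of "{b}" _ _ "\<lambda>_. 0"])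
        (use that o in \<open>auto simp: G_def needle_control_def\<close>)
    have J1: "(G has_integral I1) {0..t}" if "s \<le> t" "t \<le> l" for t
    proof -
      have "(G has_integral (0 + I1)) {0..s}"
        by (rule has_integral_combine[OF _ _ z i1]) (use o in auto)
      then have "(G has_integral (0 + I1 + 0)) {0..t}"
        by (rule has_integral_combine[OF _ _ _ z, rotated 2]) (use o that in auto)
      then show ?thesis by simp
    qed
    have J2: "(G has_integral (I1 + I2)) {0..t}" if "r \<le> t" for t
    proof -
      have "(G has_integral (I1 + I2)) {0..r}"
        by (rule has_integral_combine[OF _ _ J1 i2]) (use o in auto)
      then have "(G has_integral (I1 + I2 + 0)) {0..t}"
        by (rule has_integral_combine[OF _ _ _ z, rotated 2]) (use o that in auto)
      then show ?thesis by simp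
    qed
    have b1: "\<bar>I1 - p s \<bullet> (e *\<^sub>R f (xb s, v) - (xb s - xb (s - e)))\<bar> \<le> C2 * (e + (r - l))\<^sup>2"
    proof -
      have "\<bar>I1 - p s \<bullet> (e *\<^sub>R f (xb s, v) - (xb s - xb (s - e)))\<bar> \<le> C2 * e\<^sup>2"
        using C2(2)[rule_format, OF v(1), of "s - e" s s] o by (simp add: I1_def)
      also have "\<dots> \<le> C2 * (e + (r - l))\<^sup>2" using C2(1) o by (intro mult_left_mono power_mono) auto
      finally show ?thesis .
    qed
    have b2: "\<bar>I2 - p c \<bullet> ((r - l) *\<^sub>R f (xb c, v2) - (xb r - xb l))\<bar> \<le> C2 * (e + (r - l))\<^sup>2"
      if "c \<in> {l..r}" for c
    proof -
      have "\<bar>I2 - p c \<bullet> ((r - l) *\<^sub>R f (xb c, v2) - (xb r - xb l))\<bar> \<le> C2 * (r - l)\<^sup>2"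
        using C2(2)[rule_format, OF v(2), of l c r] o that by (simp add: I2_def)
      also have "\<dots> \<le> C2 * (e + (r - l))\<^sup>2" using C2(1) o by (intro mult_left_mono power_mono) auto
      finally show ?thesis .
    qed
    have b0: "\<bar>p t \<bullet> (x t - xb t) - integral {0..t} G\<bar> \<le> C1 * (e + (r - l))\<^sup>2" if "t \<in> {0..T}"
      using C1(2)[rule_format, OF var that] by (simp add: G_def[abs_def])
    have CC: "C * (e + (r - l))\<^sup>2 = C1 * (e + (r - l))\<^sup>2 + C2 * (e + (r - l))\<^sup>2 + C2 * (e + (r - l))\<^sup>2"
      by (simp add: C_def algebra_simps)
    have nn: "0 \<le> C2 * (e + (r - l))\<^sup>2" using C2(1) by simp
    show ?thesis
    proof (intro conjI impI ballI)
      assume t: "s \<le> t \<and> t \<le> l"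
      then have "\<bar>p t \<bullet> (x t - xb t) - I1\<bar> \<le> C1 * (e + (r - l))\<^sup>2"
        using b0 integral_unique[OF J1[of t]] o by auto
      then show "\<bar>p t \<bullet> (x t - xb t) - p s \<bullet> (e *\<^sub>R f (xb s, v) - (xb s - xb (s - e)))\<bar> \<le> C * (e + (r - l))\<^sup>2"
        using b1 nn unfolding CC by linarith
    next
      fix c assume t: "r \<le> t \<and> t \<le> T" and c: "c \<in> {l..r}"
      then have "\<bar>p t \<bullet> (x t - xb t) - (I1 + I2)\<bar> \<le> C1 * (e + (r - l))\<^sup>2"
        using b0 integral_unique[OF J2[of t]] o by auto
      then show "\<bar>p t \<bullet> (x t - xb t) - p s \<bullet> (e *\<^sub>R f (xb s, v) - (xb s - xb (s - e)))
          - p c \<bullet> ((r - l) *\<^sub>R f (xb c, v2) - (xb r - xb l))\<bar> \<le> C * (e + (r - l))\<^sup>2"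
        using b1 b2[OF c] unfolding CC by linarith
    qed
  qed
  have "C \<ge> 0" using C1(1) C2(1) by (simp add: C_def)
  then show thesis by (rule that) (intro allI impI main)
qed

end

section \<open>Needle variations around the crossing time\<close>

lemma eventually_at_right_mult_less: "d > 0 \<Longrightarrow> \<forall>\<^sub>F e in at_right 0. c * e < (d::real)"
proof -
  assume "d > 0"
  have "((\<lambda>e. c * e) \<longlongrightarrow> c * 0) (at_right 0)" by (intro tendsto_intros)
  then show ?thesis using \<open>d > 0\<close> by (intro order_tendstoD(2)[of _ "c * 0"]) auto
qed

lemma eventually_at_right_pos: "\<forall>\<^sub>F e in at_right 0. (0::real) < e"
  by (simp add: eventually_at_filter)

lemma tendsto_at_right_quotientI:
  fixes X :: "real \<Rightarrow> 'a::real_normed_vector"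
  assumes "\<And>\<sigma>. \<sigma> > 0 \<Longrightarrow> \<forall>\<^sub>F h in at_right 0. norm (X h - h *\<^sub>R c) \<le> \<sigma> * h"
  shows "((\<lambda>h. (1 / h) *\<^sub>R X h) \<longlongrightarrow> c) (at_right 0)"
proof (rule tendstoI)
  fix e :: real assume "e > 0"
  then have "\<forall>\<^sub>F h in at_right 0. norm (X h - h *\<^sub>R c) \<le> e / 2 * h" by (intro assms) simp
  then show "\<forall>\<^sub>F h in at_right 0. dist ((1 / h) *\<^sub>R X h) c < e"
    using eventually_at_right_pos
  proof eventually_elim
    case (elim h)
    have "(1 / h) *\<^sub>R X h - c = (1 / h) *\<^sub>R (X h - h *\<^sub>R c)"
      using elim(2) by (simp add: scaleR_diff_right)
    then have "dist ((1 / h) *\<^sub>R X h) c = norm (X h - h *\<^sub>R c) / h"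
      using elim(2) by (simp add: dist_norm)
    also have "\<dots> \<le> e / 2" using elim by (simp add: pos_divide_le_eq)
    also have "\<dots> < e" using \<open>e > 0\<close> by simp
    finally show ?case .
  qed
qed

lemma tendsto_at_right_quadratic:
  fixes D :: "real \<Rightarrow> real"
  assumes "\<forall>\<^sub>F e in at_right 0. \<bar>D e\<bar> \<le> C * e\<^sup>2"
  shows "((\<lambda>e. D e / e) \<longlongrightarrow> 0) (at_right 0)"
proof (rule Lim_null_comparison)
  show "\<forall>\<^sub>F e in at_right 0. norm (D e / e) \<le> C * e"
    using assms eventually_at_right_pos
    by eventually_elim (simp add: power2_eq_square field_simps)
  have "((\<lambda>e. C * e) \<longlongrightarrow> C * 0) (at_right 0)" by (intro tendsto_intros)
  then show "((\<lambda>e. C * e) \<longlongrightarrow> 0) (at_right 0)" by simp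
qed

lemma tendsto_at_right_scaled_quotient:
  fixes X :: "real \<Rightarrow> 'a::real_normed_vector"
  assumes "((\<lambda>h. (1 / h) *\<^sub>R X h) \<longlongrightarrow> c) (at_right 0)" "k > 0"
  shows "((\<lambda>e. (1 / e) *\<^sub>R X (k * e)) \<longlongrightarrow> k *\<^sub>R c) (at_right 0)"
proof -
  have "filterlim (\<lambda>e. k * e) (at_right 0) (at_right 0)"
  proof (rule filterlim_at_withinI)
    have "((\<lambda>e. k * e) \<longlongrightarrow> k * 0) (at_right 0)" by (intro tendsto_intros)
    then show "((\<lambda>e. k * e) \<longlongrightarrow> 0) (at_right 0)" by simp
    show "\<forall>\<^sub>F e in at_right 0. k * e \<in> {0<..} - {0}"
      using eventually_at_right_pos by eventually_elim (use \<open>k > 0\<close> in simp)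
  qed
  from filterlim_compose[OF assms(1) this]
  have "((\<lambda>e. k *\<^sub>R ((1 / (k * e)) *\<^sub>R X (k * e))) \<longlongrightarrow> k *\<^sub>R c) (at_right 0)"
    by (intro tendsto_intros)
  then show ?thesis using \<open>k > 0\<close> by simp
qed

text \<open>A mean value inequality in integral form. The bound is asked on the open interval, since
  a one-sided limit says nothing about the value at the endpoint.\<close>

lemma has_integral_mean_deviation:
  fixes h :: "real \<Rightarrow> 'a::euclidean_space"
  assumes "(h has_integral y) {s..t}" "s \<le> t" "0 \<le> \<sigma>" "\<And>r. r \<in> {s<..<t} \<Longrightarrow> norm (h r - c) \<le> \<sigma>"
  shows "norm (y - (t - s) *\<^sub>R c) \<le> \<sigma> * (t - s)"
proof -
  have "((\<lambda>r. h r - c) has_integral (y - (t - s) *\<^sub>R c)) (cbox s t)"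
    using has_integral_diff[OF assms(1) has_integral_const_real[of c s t]] assms(2) by simp
  then have "norm (y - (t - s) *\<^sub>R c) \<le> \<sigma> * measure lborel (cbox s t)"
    by (rule has_integral_bound_spike_finite[OF assms(3), of "{s, t}", rotated]) (use assms(4) in auto)
  then show ?thesis using assms(2) by simp
qed

text \<open>\<open>g_strict\<close> is strict differentiability at the crossing point:
  \<open>g\<close> will be compared at two points of a perturbed trajectory, neither of which has to
  be \<open>xb \<tau>\<close>. The sign of the transversality product is derived below from the
  signs of \<open>g\<close>.\<close>

locale crossing_trajectory = reference_trajectory f f' U T M R L x0 ub xb
  for f :: "'x::euclidean_space \<times> 'u::euclidean_space \<Rightarrow> 'x" and f' U T M R L x0 ub xb +
  fixes \<phi> g :: "'x \<Rightarrow> real" and d\<phi> dg :: 'x and \<tau> :: real and um up :: 'u and K :: "'x set"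
  assumes \<phi>_deriv: "(\<phi> has_derivative (\<lambda>h. d\<phi> \<bullet> h)) (at (xb T))"
    and g_strict: "\<And>\<sigma>. \<sigma> > 0 \<Longrightarrow> \<exists>\<delta>>0. \<forall>x y. norm (x - xb \<tau>) < \<delta> \<longrightarrow> norm (y - xb \<tau>) < \<delta> \<longrightarrow>
      \<bar>g x - g y - dg \<bullet> (x - y)\<bar> \<le> \<sigma> * norm (x - y)"
    and g_cont: "continuous_on UNIV g"
    and K_eq: "K = {x. g x \<le> 0}"
    and \<tau>: "0 < \<tau>" "\<tau> < T"
    and g_neg: "\<And>t. 0 \<le> t \<Longrightarrow> t < \<tau> \<Longrightarrow> g (xb t) < 0"
    and g_pos: "\<And>t. \<tau> < t \<Longrightarrow> t \<le> T \<Longrightarrow> g (xb t) > 0"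
    and um_lim: "(ub \<longlongrightarrow> um) (at_left \<tau>)" and up_lim: "(ub \<longlongrightarrow> up) (at_right \<tau>)"
    and um: "um \<in> U" "norm um \<le> M" and up: "up \<in> U" "norm up \<le> M"
    and transversal_nonzero: "dg \<bullet> f (xb \<tau>, um) \<noteq> 0"
    and optimal: "\<And>w x. w \<in> admissible_controls U T \<Longrightarrow> is_state f T x0 w x \<Longrightarrow>
      crisis_cost \<phi> K T xb \<le> crisis_cost \<phi> K T x"
begin

section \<open>The cost, and one-sided derivatives at the crossing time\<close>

lemma crisis_cost_eq:
  assumes "continuous_on {0..T} x"
  shows "{t \<in> {0..T}. x t \<notin> K} \<in> lmeasurable"
    and "crisis_cost \<phi> K T x = \<phi> (x T) + measure lebesgue {t \<in> {0..T}. x t \<notin> K}"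
proof -
  have "closed K" unfolding K_eq
    using continuous_closed_preimage[OF g_cont closed_UNIV closed_atMost, of 0] by (simp add: vimage_def)
  then have "closed ({0..T} \<inter> x -` K)"
    by (intro continuous_closed_preimage assms) auto
  then have "{0..T} - ({0..T} \<inter> x -` K) \<in> lmeasurable"
    by (intro fmeasurable_Diff) auto
  moreover have eq: "{0..T} - ({0..T} \<inter> x -` K) = {t \<in> {0..T}. x t \<notin> K}" by auto
  ultimately show S: "{t \<in> {0..T}. x t \<notin> K} \<in> lmeasurable" by simp
  have "(LINT t:{0..T}|lebesgue. indicator (- K) (x t)) = (LINT t|lebesgue. (indicator {t \<in> {0..T}. x t \<notin> K} t :: real))"
    unfolding set_lebesgue_integral_def
    by (intro Bochner_Integration.integral_cong) (auto simp: indicator_def)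
  also have "\<dots> = measure lebesgue {t \<in> {0..T}. x t \<notin> K}" by simp
  finally show "crisis_cost \<phi> K T x = \<phi> (x T) + measure lebesgue {t \<in> {0..T}. x t \<notin> K}"
    by (simp add: crisis_cost_def)
qed

text \<open>After \<open>t1\<close> the indicator is at most one, so a bound from above follows from
  staying in \<open>K\<close> up to \<open>t1\<close>, whatever happens later. This is why the exit
  time of a perturbed trajectory never has to be found.\<close>

lemma crisis_cost_le:
  assumes "continuous_on {0..T} x" "0 \<le> t1" "t1 \<le> T" "\<forall>t\<in>{0..t1}. x t \<in> K"
  shows "crisis_cost \<phi> K T x \<le> \<phi> (x T) + (T - t1)"
proof -
  have "{t \<in> {0..T}. x t \<notin> K} \<subseteq> {t1..T}" using assms(4) by force
  then have "measure lebesgue {t \<in> {0..T}. x t \<notin> K} \<le> measure lebesgue {t1..T}"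
    by (intro measure_mono_fmeasurable fmeasurableD crisis_cost_eq assms(1)) auto
  then show ?thesis using crisis_cost_eq(2)[OF assms(1)] assms(3) by simp
qed

lemma g_xb_\<tau>: "g (xb \<tau>) = 0"
proof (rule antisym)
  have c: "continuous_on {0..T} (\<lambda>t. g (xb t))"
    by (rule continuous_on_compose2[OF g_cont xb_continuous]) auto
  show "g (xb \<tau>) \<le> 0"
  proof (rule continuous_le_on_closure[of "{0..<\<tau>}" "\<lambda>t. g (xb t)"])
    show "continuous_on (closure {0..<\<tau>}) (\<lambda>t. g (xb t))"
      using \<tau> by (intro continuous_on_subset[OF c]) auto
  qed (use \<tau> g_neg in \<open>auto intro: less_imp_le\<close>)
  show "0 \<le> g (xb \<tau>)"
  proof (rule continuous_ge_on_closure[of "{\<tau><..T}" "\<lambda>t. g (xb t)"])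
    show "continuous_on (closure {\<tau><..T}) (\<lambda>t. g (xb t))"
      using \<tau> by (intro continuous_on_subset[OF c]) auto
  qed (use \<tau> g_pos in \<open>auto intro: less_imp_le\<close>)
qed

lemma crisis_cost_xb: "crisis_cost \<phi> K T xb = \<phi> (xb T) + (T - \<tau>)"
proof -
  have "{t \<in> {0..T}. xb t \<notin> K} = {\<tau><..T}"
  proof (intro equalityI subsetI)
    fix t assume "t \<in> {t \<in> {0..T}. xb t \<notin> K}"
    then show "t \<in> {\<tau><..T}" using g_neg[of t] g_xb_\<tau> by (cases t \<tau> rule: linorder_cases) (auto simp: K_eq)
  next
    fix t assume "t \<in> {\<tau><..T}"
    then show "t \<in> {t \<in> {0..T}. xb t \<notin> K}" using g_pos[of t] \<tau> by (auto simp: K_eq)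
  qed
  then show ?thesis using crisis_cost_eq(2)[OF xb_continuous] \<tau> by simp
qed

lemma continuous_on_tendsto_crossing:
  fixes h :: "real \<Rightarrow> 'x"
  assumes "continuous_on {0..T} h"
  shows "(h \<longlongrightarrow> h \<tau>) (at \<tau>)"
proof -
  have "continuous (at \<tau> within {0..T}) h"
    using assms \<tau> by (auto simp: continuous_on_eq_continuous_within)
  moreover have "at \<tau> within {0..T} = at \<tau>"
    using \<tau> by (intro at_within_interior) simp
  ultimately show ?thesis by (simp add: continuous_within)
qed

lemma xb_tendsto: "(xb \<longlongrightarrow> xb \<tau>) (at \<tau>)"
  by (rule continuous_on_tendsto_crossing[OF xb_continuous])

lemma f_tendsto: "((\<lambda>z. f z) \<longlongrightarrow> f z0) (at z0)"
  using f_cont continuous_on_eq_continuous_at[OF open_UNIV] unfolding isCont_def by blast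

text \<open>The trajectory is differentiable almost everywhere, and \<tau> may be exceptional; the
  left limit of the control supplies a left derivative there.\<close>

lemma xb_left_quotient: "((\<lambda>h. (1 / h) *\<^sub>R (xb \<tau> - xb (\<tau> - h))) \<longlongrightarrow> f (xb \<tau>, um)) (at_right 0)"
proof (rule tendsto_at_right_quotientI)
  fix \<sigma> :: real assume \<sigma>: "\<sigma> > 0"
  have "((\<lambda>r. (xb r, ub r)) \<longlongrightarrow> (xb \<tau>, um)) (at_left \<tau>)"
    using um_lim xb_tendsto by (intro tendsto_Pair) (auto simp: filterlim_at_split)
  then have "((\<lambda>r. f (xb r, ub r)) \<longlongrightarrow> f (xb \<tau>, um)) (at_left \<tau>)"
    by (rule isCont_tendsto_compose[rotated]) (simp add: isCont_def f_tendsto)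
  then have "\<forall>\<^sub>F r in at_left \<tau>. dist (f (xb r, ub r)) (f (xb \<tau>, um)) < \<sigma>" using \<sigma> by (rule tendstoD)
  then obtain b where b: "b < \<tau>" "\<forall>r>b. r < \<tau> \<longrightarrow> dist (f (xb r, ub r)) (f (xb \<tau>, um)) < \<sigma>"
    by (auto simp: eventually_at_left_field)
  have "\<forall>\<^sub>F h in at_right 0. 1 * h < min (\<tau> - b) \<tau>" using b \<tau> by (intro eventually_at_right_mult_less) auto
  then show "\<forall>\<^sub>F h in at_right 0. norm (xb \<tau> - xb (\<tau> - h) - h *\<^sub>R f (xb \<tau>, um)) \<le> \<sigma> * h"
    using eventually_at_right_pos
  proof eventually_elim
    case (elim h)
    have "norm (xb \<tau> - xb (\<tau> - h) - (\<tau> - (\<tau> - h)) *\<^sub>R f (xb \<tau>, um)) \<le> \<sigma> * (\<tau> - (\<tau> - h))"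
      using elim \<tau> \<sigma> b(2)
      by (intro has_integral_mean_deviation[OF xb_has_integral]) (auto simp: dist_norm intro!: less_imp_le)
    then show ?case by simp
  qed
qed

text \<open>Since \<open>g\<close> is negative before \<tau> and zero at \<tau>, its left difference
  quotients are positive and their limit is nonnegative; that the limit is nonzero decides the
  sign.\<close>

lemma transversal: "dg \<bullet> f (xb \<tau>, um) > 0"
proof -
  define l where "l = dg \<bullet> f (xb \<tau>, um)"
  have lim: "((\<lambda>h. dg \<bullet> ((1 / h) *\<^sub>R (xb \<tau> - xb (\<tau> - h)))) \<longlongrightarrow> l) (at_right 0)"
    unfolding l_def by (intro tendsto_intros xb_left_quotient)
  have "0 \<le> l + \<epsilon>" if "\<epsilon> > 0" for \<epsilon> :: real
  proof -
    \<comment> \<open>The tolerance is divided by \<open>L\<close> because the displacement over a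
      time \<open>h\<close> is at most \<open>L * h\<close>.\<close>
    have "\<epsilon> / L > 0" using that L by simp
    from g_strict[OF this] obtain \<delta> where \<delta>: "\<delta> > 0"
      "\<forall>x y. norm (x - xb \<tau>) < \<delta> \<longrightarrow> norm (y - xb \<tau>) < \<delta> \<longrightarrow> \<bar>g x - g y - dg \<bullet> (x - y)\<bar> \<le> \<epsilon> / L * norm (x - y)"
      by blast
    have "\<forall>\<^sub>F h in at_right 0. 1 * h < \<tau>" "\<forall>\<^sub>F h in at_right 0. L * h < \<delta>"
      by (rule eventually_at_right_mult_less, use \<tau> \<delta>(1) in simp)+
    then have "\<forall>\<^sub>F h in at_right 0. - \<epsilon> \<le> dg \<bullet> ((1 / h) *\<^sub>R (xb \<tau> - xb (\<tau> - h)))"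
      using eventually_at_right_pos
    proof eventually_elim
      case (elim h)
      define \<Delta> where "\<Delta> = xb \<tau> - xb (\<tau> - h)"
      have n: "norm \<Delta> \<le> L * h"
        using lipschitz_onD[OF xb_lipschitz, of \<tau> "\<tau> - h"] elim \<tau> by (simp add: dist_norm dist_real_def \<Delta>_def)
      then have "norm (xb (\<tau> - h) - xb \<tau>) < \<delta>" using elim by (simp add: norm_minus_commute \<Delta>_def)
      then have "\<bar>g (xb \<tau>) - g (xb (\<tau> - h)) - dg \<bullet> \<Delta>\<bar> \<le> \<epsilon> / L * norm \<Delta>"
        unfolding \<Delta>_def using \<delta> by (intro \<delta>(2)[rule_format]) auto
      also have "\<dots> \<le> \<epsilon> / L * (L * h)" using n that L by (intro mult_left_mono) auto
      also have "\<dots> = \<epsilon> * h" using L by simp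
      finally have "- (\<epsilon> * h) \<le> dg \<bullet> \<Delta>"
        using g_neg[of "\<tau> - h"] g_xb_\<tau> elim by linarith
      then have "- \<epsilon> \<le> (dg \<bullet> \<Delta>) / h" using elim(3) by (simp add: pos_le_divide_eq)
      then show ?case by (simp add: \<Delta>_def)
    qed
    then have "- \<epsilon> \<le> l" by (rule tendsto_lowerbound[OF lim]) simp
    then show ?thesis by simp
  qed
  then have "0 \<le> l" by (rule field_le_epsilon)
  then show ?thesis using transversal_nonzero by (simp add: l_def)
qed

lemma xb_right_quotient: "((\<lambda>h. (1 / h) *\<^sub>R (xb (\<tau> + h) - xb \<tau>)) \<longlongrightarrow> f (xb \<tau>, up)) (at_right 0)"
proof (rule tendsto_at_right_quotientI)
  fix \<sigma> :: real assume \<sigma>: "\<sigma> > 0"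
  have "((\<lambda>r. (xb r, ub r)) \<longlongrightarrow> (xb \<tau>, up)) (at_right \<tau>)"
    using up_lim xb_tendsto by (intro tendsto_Pair) (auto simp: filterlim_at_split)
  then have "((\<lambda>r. f (xb r, ub r)) \<longlongrightarrow> f (xb \<tau>, up)) (at_right \<tau>)"
    by (rule isCont_tendsto_compose[rotated]) (simp add: isCont_def f_tendsto)
  then have "\<forall>\<^sub>F r in at_right \<tau>. dist (f (xb r, ub r)) (f (xb \<tau>, up)) < \<sigma>" using \<sigma> by (rule tendstoD)
  then obtain b where b: "b > \<tau>" "\<forall>r>\<tau>. r < b \<longrightarrow> dist (f (xb r, ub r)) (f (xb \<tau>, up)) < \<sigma>"
    by (auto simp: eventually_at_right_field)
  have "\<forall>\<^sub>F h in at_right 0. 1 * h < min (b - \<tau>) (T - \<tau>)" using b \<tau> by (intro eventually_at_right_mult_less) auto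
  then show "\<forall>\<^sub>F h in at_right 0. norm (xb (\<tau> + h) - xb \<tau> - h *\<^sub>R f (xb \<tau>, up)) \<le> \<sigma> * h"
    using eventually_at_right_pos
  proof eventually_elim
    case (elim h)
    have "norm (xb (\<tau> + h) - xb \<tau> - ((\<tau> + h) - \<tau>) *\<^sub>R f (xb \<tau>, up)) \<le> \<sigma> * ((\<tau> + h) - \<tau>)"
      using elim \<tau> \<sigma> b(2)
      by (intro has_integral_mean_deviation[OF xb_has_integral]) (auto simp: dist_norm intro!: less_imp_le)
    then show ?case by simp
  qed
qed

lemma xb_needle_quotient:
  assumes "(xb has_vector_derivative y) (at s)"
  shows "((\<lambda>e. (1 / e) *\<^sub>R (e *\<^sub>R c - (xb s - xb (s - e)))) \<longlongrightarrow> c - y) (at_right 0)"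
proof (rule tendsto_at_right_quotientI)
  fix \<sigma> :: real assume "\<sigma> > 0"
  then obtain d where d: "d > 0" "\<forall>r. norm (r - s) < d \<longrightarrow> norm (xb r - xb s - (r - s) *\<^sub>R y) \<le> \<sigma> * norm (r - s)"
    using assms unfolding has_vector_derivative_def has_derivative_at_alt by blast
  have "\<forall>\<^sub>F e in at_right 0. 1 * e < d" using d(1) by (rule eventually_at_right_mult_less)
  then show "\<forall>\<^sub>F e in at_right 0. norm (e *\<^sub>R c - (xb s - xb (s - e)) - e *\<^sub>R (c - y)) \<le> \<sigma> * e"
    using eventually_at_right_pos
  proof eventually_elim
    case (elim e)
    then have "norm (xb (s - e) - xb s - (s - e - s) *\<^sub>R y) \<le> \<sigma> * norm (s - e - s)"
      by (intro d(2)[rule_format]) auto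
    moreover have eq: "xb (s - e) - xb s - (s - e - s) *\<^sub>R y = e *\<^sub>R c - (xb s - xb (s - e)) - e *\<^sub>R (c - y)"
      by (simp add: algebra_simps)
    ultimately show ?case using elim(2) unfolding eq by simp
  qed
qed

text \<open>The reference cost is exactly \<open>\<phi> (xb T) + (T - \<tau>)\<close>, while the
  perturbed one is eventually at most \<open>\<phi> (x e T) + (T - \<tau>) + \<theta> * e\<close>.
  Optimality divided by \<open>e\<close> gives the inequality in the limit.\<close>

lemma cost_limit:
  assumes e0: "e0 > 0" and k: "k > 0"
    and var: "\<forall>e\<in>{0<..<e0}. variation (w e) (E e) (k * e) (x e)"
    and inK: "\<forall>\<^sub>F e in at_right 0. 0 \<le> \<tau> - \<theta> * e \<and> \<tau> - \<theta> * e \<le> T \<and> (\<forall>t\<in>{0..\<tau> - \<theta> * e}. x e t \<in> K)"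
    and lim: "((\<lambda>e. (d\<phi> \<bullet> (x e T - xb T)) / e) \<longlongrightarrow> c) (at_right 0)"
  shows "0 \<le> c + \<theta>"
proof -
  define \<kappa> where "\<kappa> = variation_const * k"
  have \<kappa>: "\<kappa> > 0" using variation_const_pos k by (simp add: \<kappa>_def)
  have ev: "\<forall>\<^sub>F e in at_right 0. 1 * e < e0" using e0 by (rule eventually_at_right_mult_less)
  \<comment> \<open>The remainder of \<phi> is of smaller order than \<open>e\<close>, because the
    final states differ by at most \<open>\<kappa> * e\<close>.\<close>
  have "((\<lambda>e. (\<phi> (x e T) - \<phi> (xb T) - d\<phi> \<bullet> (x e T - xb T)) / e) \<longlongrightarrow> 0) (at_right 0)"
  proof (rule tendstoI)
    fix \<sigma> :: real assume "\<sigma> > 0"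
    then have "\<sigma> / (2 * \<kappa>) > 0" using \<kappa> by simp
    then obtain d where d: "d > 0" "\<forall>y. norm (y - xb T) < d \<longrightarrow>
        norm (\<phi> y - \<phi> (xb T) - d\<phi> \<bullet> (y - xb T)) \<le> \<sigma> / (2 * \<kappa>) * norm (y - xb T)"
      using \<phi>_deriv unfolding has_derivative_at_alt by blast
    have "\<forall>\<^sub>F e in at_right 0. \<kappa> * e < d" using d(1) by (rule eventually_at_right_mult_less)
    then show "\<forall>\<^sub>F e in at_right 0. dist ((\<phi> (x e T) - \<phi> (xb T) - d\<phi> \<bullet> (x e T - xb T)) / e) 0 < \<sigma>"
      using ev eventually_at_right_pos
    proof eventually_elim
      case (elim e)
      then have v: "variation (w e) (E e) (k * e) (x e)" using var by auto
      then have n: "norm (x e T - xb T) \<le> \<kappa> * e" using T by (auto simp: variation_def \<kappa>_def mult.assoc)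
      then have "norm (x e T - xb T) < d" using elim by linarith
      then have "norm (\<phi> (x e T) - \<phi> (xb T) - d\<phi> \<bullet> (x e T - xb T)) \<le> \<sigma> / (2 * \<kappa>) * norm (x e T - xb T)"
        using d(2) by blast
      also have "\<dots> \<le> \<sigma> / (2 * \<kappa>) * (\<kappa> * e)" using n \<open>\<sigma> > 0\<close> \<kappa> by (intro mult_left_mono) auto
      also have "\<dots> = \<sigma> / 2 * e" using \<kappa> by simp
      also have "\<dots> < \<sigma> * e" using \<open>\<sigma> > 0\<close> elim by simp
      finally show ?case using elim by (simp add: dist_real_def pos_divide_less_eq)
    qed
  qed
  from tendsto_add[OF tendsto_add[OF this lim] tendsto_const[of \<theta>]]
  have "((\<lambda>e. (\<phi> (x e T) - \<phi> (xb T)) / e + \<theta>) \<longlongrightarrow> c + \<theta>) (at_right 0)"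
    by (simp add: add_divide_distrib[symmetric])
  moreover have "\<forall>\<^sub>F e in at_right 0. 0 \<le> (\<phi> (x e T) - \<phi> (xb T)) / e + \<theta>"
    using inK ev eventually_at_right_pos
  proof eventually_elim
    case (elim e)
    then have v: "variation (w e) (E e) (k * e) (x e)" using var by auto
    then obtain C where "C-lipschitz_on {0..T} (x e)" by (auto simp: variation_def)
    then have "crisis_cost \<phi> K T (x e) \<le> \<phi> (x e T) + (T - (\<tau> - \<theta> * e))"
      using elim(1) by (intro crisis_cost_le lipschitz_on_continuous_on) auto
    moreover have "crisis_cost \<phi> K T xb \<le> crisis_cost \<phi> K T (x e)"
      using v by (intro optimal[of "w e"]) (auto simp: variation_def admissible_controls_def)
    ultimately have "0 \<le> (\<phi> (x e T) - \<phi> (xb T)) + \<theta> * e" using crisis_cost_xb by simp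
    also have "\<dots> = ((\<phi> (x e T) - \<phi> (xb T)) / e + \<theta>) * e" using elim(3) by (simp add: distrib_right)
    finally show ?case using elim(3) by (simp add: zero_le_mult_iff)
  qed
  ultimately show ?thesis
    by (rule tendsto_lowerbound) simp
qed

text \<open>Close to the crossing time \<open>g\<close> increases along the perturbed trajectory as long as the control
  is close to \<open>um\<close>, so it suffices to look at the sign of \<open>g\<close> at the last such time.\<close>

lemma eventually_in_K:
  assumes e0: "e0 > 0" and k: "k > 0"
    and var: "\<forall>e\<in>{0<..<e0}. variation (w e) (E e) (k * e) (x e)"
    and lim: "((\<lambda>e. (dg \<bullet> (x e (\<tau> - \<theta> * e) - xb \<tau>)) / e) \<longlongrightarrow> - m) (at_right 0)" and m: "m > 0"
    and \<eta>1: "\<eta>1 > 0"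
    and ctrl: "\<forall>e\<in>{0<..<e0}. \<forall>r\<in>{\<tau> - \<eta>1<..<\<tau> - \<theta> * e}. r < \<tau> \<and> w e r = ub r \<or> w e r = um"
  shows "\<forall>\<^sub>F e in at_right 0. 0 \<le> \<tau> - \<theta> * e \<and> \<tau> - \<theta> * e \<le> T \<and> (\<forall>t\<in>{0..\<tau> - \<theta> * e}. x e t \<in> K)"
proof -
  define fm where "fm = f (xb \<tau>, um)"
  define a where "a = dg \<bullet> fm"
  have a: "a > 0" using transversal by (simp add: a_def fm_def)
  define \<kappa> where "\<kappa> = variation_const * k"
  have \<kappa>: "\<kappa> > 0" using variation_const_pos k by (simp add: \<kappa>_def)
  \<comment> \<open>The tolerances \<open>\<sigma>1\<close>, for the deviation of the velocity from
    \<open>fm\<close>, and \<open>\<sigma>2\<close>, for the linearization of \<open>g\<close>, each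
    cost at most \<open>a / 4\<close> of the growth rate \<open>a\<close>, so \<open>a / 2\<close>
    remains. \<open>B * e\<close> bounds the distance from \<open>xb \<tau>\<close> at the last
    time, and \<open>\<sigma>3\<close> keeps the error of \<open>g\<close> there within
    \<open>m / 4 * e\<close>.\<close>
  define \<sigma>1 where "\<sigma>1 = a / (4 * (norm dg + 1))"
  define \<sigma>2 where "\<sigma>2 = a / (4 * (norm fm + \<sigma>1 + 1))"
  define B where "B = \<kappa> + L * \<bar>\<theta>\<bar>"
  define \<sigma>3 where "\<sigma>3 = m / (4 * B)"
  have B: "B > 0" using \<kappa> L by (simp add: B_def add_pos_nonneg)
  have dg1: "norm dg + 1 > 0" by (simp add: add_nonneg_pos)
  have \<sigma>1: "\<sigma>1 > 0" using a dg1 by (simp add: \<sigma>1_def)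
  have fm1: "norm fm + \<sigma>1 + 1 > 0" using \<sigma>1 norm_ge_zero[of fm] by linarith
  have \<sigma>: "\<sigma>2 > 0" "\<sigma>3 > 0" using a fm1 B m by (auto simp: \<sigma>2_def \<sigma>3_def)
  have s1: "norm dg * \<sigma>1 \<le> a / 4"
  proof -
    have "norm dg * \<sigma>1 \<le> (norm dg + 1) * \<sigma>1" using \<sigma>1 by (intro mult_right_mono) auto
    also have "\<dots> = a / 4" using dg1 by (simp add: \<sigma>1_def field_simps)
    finally show ?thesis .
  qed
  have s2: "\<sigma>2 * (norm fm + \<sigma>1) \<le> a / 4"
  proof -
    have "\<sigma>2 * (norm fm + \<sigma>1) \<le> \<sigma>2 * (norm fm + \<sigma>1 + 1)" using \<sigma> by (intro mult_left_mono) auto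
    also have "\<dots> = a / 4" using fm1 by (simp add: \<sigma>2_def field_simps)
    finally show ?thesis .
  qed
  obtain \<rho> where \<rho>: "\<rho> > 0" "\<And>y u. norm (y - xb \<tau>) < \<rho> \<Longrightarrow> norm (u - um) < \<rho> \<Longrightarrow> norm (f (y, u) - fm) \<le> \<sigma>1"
  proof -
    have "\<exists>d>0. \<forall>z. dist z (xb \<tau>, um) < d \<longrightarrow> dist (f z) (f (xb \<tau>, um)) < \<sigma>1"
      using f_cont \<sigma>1 by (auto simp: continuous_on_iff)
    then obtain d where d: "d > 0" "\<forall>z. dist z (xb \<tau>, um) < d \<longrightarrow> dist (f z) (f (xb \<tau>, um)) < \<sigma>1" by blast
    show thesis
    proof (rule that[of "d / 2"])
      fix y u assume yu: "norm (y - xb \<tau>) < d / 2" "norm (u - um) < d / 2"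
      have "dist (y, u) (xb \<tau>, um) \<le> norm (y - xb \<tau>) + norm (u - um)"
        using sqrt_sum_squares_le_sum_abs[of "dist y (xb \<tau>)" "dist u um"] by (simp add: dist_norm norm_Pair)
      then have "dist (y, u) (xb \<tau>, um) < d" using yu by linarith
      then show "norm (f (y, u) - fm) \<le> \<sigma>1" using d(2) by (auto simp: fm_def dist_norm intro: less_imp_le)
    qed (use d in simp)
  qed
  obtain \<delta>2 where \<delta>2: "\<delta>2 > 0" "\<forall>y z. norm (y - xb \<tau>) < \<delta>2 \<longrightarrow> norm (z - xb \<tau>) < \<delta>2 \<longrightarrow>
      \<bar>g y - g z - dg \<bullet> (y - z)\<bar> \<le> \<sigma>2 * norm (y - z)" using g_strict[OF \<sigma>(1)] by blast
  obtain \<delta>3 where \<delta>3: "\<delta>3 > 0" "\<forall>y z. norm (y - xb \<tau>) < \<delta>3 \<longrightarrow> norm (z - xb \<tau>) < \<delta>3 \<longrightarrow>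
      \<bar>g y - g z - dg \<bullet> (y - z)\<bar> \<le> \<sigma>3 * norm (y - z)" using g_strict[OF \<sigma>(2)] by blast
  obtain b where b: "b < \<tau>" "\<forall>r>b. r < \<tau> \<longrightarrow> norm (ub r - um) < \<rho>"
    using tendstoD[OF um_lim \<rho>(1)] by (auto simp: eventually_at_left_field dist_norm)
  define q where "q = min \<rho> \<delta>2"
  have q: "q > 0" using \<rho>(1) \<delta>2(1) by (simp add: q_def)
  \<comment> \<open>In the window of length \<open>\<eta>\<close> before \<tau> the control
    \<open>ub\<close> is within \<open>\<rho>\<close> of \<open>um\<close>, and the states have to
    stay within \<open>q\<close> of the crossing point: a quarter of \<open>q\<close> is spent on
    the window and half of it on the perturbation.\<close>
  define \<eta> where "\<eta> = min (min (\<eta>1 / 2) ((\<tau> - b) / 2)) (min (\<tau> / 2) (q / (4 * L)))"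
  have "q / (4 * L) > 0" using q L by simp
  then have "\<eta> > 0" using \<eta>1 b(1) \<tau> by (simp add: \<eta>_def)
  moreover have "\<eta> \<le> \<eta>1 / 2" "\<eta> \<le> (\<tau> - b) / 2" "\<eta> \<le> \<tau> / 2" "\<eta> \<le> q / (4 * L)"
    unfolding \<eta>_def by linarith+
  ultimately have \<eta>: "\<eta> > 0" "\<eta> < \<eta>1" "\<tau> - \<eta> > b" "\<eta> < \<tau>" "\<eta> \<le> q / (4 * L)"
    using \<eta>1 b(1) \<tau> by (simp_all add: field_simps)
  have L\<eta>: "L * \<eta> \<le> q / 4"
  proof -
    have "L * \<eta> \<le> L * (q / (4 * L))" using \<eta>(5) L by (intro mult_left_mono) auto
    then show ?thesis using L by simp
  qed
  \<comment> \<open>Before the window the reference trajectory fills a compact subset of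
    \<open>{y. g y < 0}\<close>, so a uniform distance \<open>\<delta>4\<close> protects the
    perturbed states.\<close>
  obtain \<delta>4 where \<delta>4: "\<delta>4 > 0" "(\<Union>y\<in>xb ` {0..\<tau> - \<eta>}. ball y \<delta>4) \<subseteq> {y. g y < 0}"
  proof (rule compact_subset_open_imp_ball_epsilon_subset[of "xb ` {0..\<tau> - \<eta>}" "{y. g y < 0}"])
    show "compact (xb ` {0..\<tau> - \<eta>})"
      by (intro compact_continuous_image continuous_on_subset[OF xb_continuous] compact_Icc) (use \<eta> \<tau> in auto)
    show "open {y. g y < 0}"
      using open_Collect_less[OF g_cont continuous_on_const] .
    show "xb ` {0..\<tau> - \<eta>} \<subseteq> {y. g y < 0}" using g_neg \<eta> by auto
  qed blast
  have "\<forall>\<^sub>F e in at_right 0. 1 * e < e0" "\<forall>\<^sub>F e in at_right 0. B * e < q / 2" "\<forall>\<^sub>F e in at_right 0. B * e < \<delta>3"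
    "\<forall>\<^sub>F e in at_right 0. \<kappa> * e < \<delta>4" "\<forall>\<^sub>F e in at_right 0. \<bar>\<theta>\<bar> * e < min \<eta> (T - \<tau>)"
    by (rule eventually_at_right_mult_less, use e0 q \<delta>3(1) \<delta>4(1) \<eta>(1) \<tau> in simp)+
  moreover have "\<forall>\<^sub>F e in at_right 0. (dg \<bullet> (x e (\<tau> - \<theta> * e) - xb \<tau>)) / e < - m / 2"
    using m by (intro order_tendstoD(2)[OF lim]) auto
  ultimately show ?thesis using eventually_at_right_pos
  proof eventually_elim
    case (elim e)
    define t1 where "t1 = \<tau> - \<theta> * e"
    have v: "variation (w e) (E e) (k * e) (x e)" using var elim(1,7) by auto
    have abs\<theta>: "\<bar>\<theta> * e\<bar> = \<bar>\<theta>\<bar> * e" using elim(7) by (simp add: abs_mult)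
    have t1: "\<bar>t1 - \<tau>\<bar> = \<bar>\<theta>\<bar> * e" "\<tau> - \<eta> < t1" "t1 \<le> T" "0 \<le> t1"
      using elim(5) abs\<theta> \<eta>(4) by (auto simp: t1_def abs_if split: if_splits)
    have near: "norm (x e t - xb t) \<le> \<kappa> * e" if "t \<in> {0..T}" for t
      using v that by (auto simp: variation_def \<kappa>_def mult.assoc)
    have near\<tau>: "norm (x e t - xb \<tau>) \<le> \<kappa> * e + L * \<bar>t - \<tau>\<bar>" if "t \<in> {0..T}" for t
    proof -
      have "norm (xb t - xb \<tau>) \<le> L * \<bar>t - \<tau>\<bar>"
        using lipschitz_onD[OF xb_lipschitz that, of \<tau>] \<tau> by (simp add: dist_norm dist_real_def)
      then show ?thesis using near[OF that] norm_triangle_ineq[of "x e t - xb t" "xb t - xb \<tau>"] by simp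
    qed
    have Be: "\<kappa> * e + L * \<bar>t1 - \<tau>\<bar> = B * e" unfolding t1(1) B_def by (simp add: algebra_simps)
    have nq: "norm (x e t - xb \<tau>) < q" if t: "\<tau> - \<eta> \<le> t" "t \<le> t1" for t
    proof -
      have "\<bar>t - \<tau>\<bar> \<le> \<eta> + \<bar>t1 - \<tau>\<bar>" using t \<eta>(1) by linarith
      then have "L * \<bar>t - \<tau>\<bar> \<le> L * (\<eta> + \<bar>t1 - \<tau>\<bar>)" using L by (intro mult_left_mono) auto
      then have "norm (x e t - xb \<tau>) \<le> \<kappa> * e + L * (\<eta> + \<bar>t1 - \<tau>\<bar>)"
        using near\<tau>[of t] t t1 \<eta>(4) by auto
      also have "\<dots> = B * e + L * \<eta>" unfolding Be[symmetric] by (simp add: algebra_simps)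
      also have "\<dots> < q" using elim(2) L\<eta> q by linarith
      finally show ?thesis .
    qed
    have mono: "g (x e t) \<le> g (x e t1)" if t: "\<tau> - \<eta> \<le> t" "t \<le> t1" for t
    proof -
      define \<Delta> where "\<Delta> = x e t1 - x e t"
      have "norm (\<Delta> - (t1 - t) *\<^sub>R fm) \<le> \<sigma>1 * (t1 - t)" unfolding \<Delta>_def
      proof (rule has_integral_mean_deviation[OF _ t(2)])
        show "((\<lambda>r. f (x e r, w e r)) has_integral (x e t1 - x e t)) {t..t1}"
          using v t t1 \<eta>(4) by (auto simp: variation_def)
        fix r assume r: "r \<in> {t<..<t1}"
        show "norm (f (x e r, w e r) - fm) \<le> \<sigma>1"
        proof (rule \<rho>(2))
          show "norm (x e r - xb \<tau>) < \<rho>" using nq[of r] r t by (simp add: q_def)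
          have "r \<in> {\<tau> - \<eta>1<..<\<tau> - \<theta> * e}" using r t \<eta>(2) by (auto simp: t1_def)
          then have "r < \<tau> \<and> w e r = ub r \<or> w e r = um" using ctrl elim(1,7) by auto
          then show "norm (w e r - um) < \<rho>"
            using b(2) r t \<eta>(3) \<rho>(1) by auto
        qed
      qed (use \<sigma>1 in simp)
      then have d1: "norm (\<Delta> - (t1 - t) *\<^sub>R fm) \<le> \<sigma>1 * (t1 - t)" .
      have "\<bar>dg \<bullet> (\<Delta> - (t1 - t) *\<^sub>R fm)\<bar> \<le> norm dg * (\<sigma>1 * (t1 - t))"
        using d1 by (intro order.trans[OF Cauchy_Schwarz_ineq2] mult_left_mono) auto
      also have "\<dots> \<le> a / 4 * (t1 - t)"
        using mult_right_mono[OF s1, of "t1 - t"] t by (simp add: mult.assoc)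
      finally have "\<bar>dg \<bullet> \<Delta> - (t1 - t) * a\<bar> \<le> a / 4 * (t1 - t)" by (simp add: inner_diff_right a_def)
      then have 1: "dg \<bullet> \<Delta> \<ge> (t1 - t) * a - a / 4 * (t1 - t)" by linarith
      have "norm \<Delta> \<le> norm ((t1 - t) *\<^sub>R fm) + \<sigma>1 * (t1 - t)"
        using d1 norm_triangle_sub[of \<Delta> "(t1 - t) *\<^sub>R fm"] by linarith
      also have "norm ((t1 - t) *\<^sub>R fm) = norm fm * (t1 - t)" using t by simp
      also have "norm fm * (t1 - t) + \<sigma>1 * (t1 - t) = (norm fm + \<sigma>1) * (t1 - t)" by (rule distrib_right[symmetric])
      finally have "\<sigma>2 * norm \<Delta> \<le> \<sigma>2 * ((norm fm + \<sigma>1) * (t1 - t))" using \<sigma> by (intro mult_left_mono) auto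
      also have "\<dots> \<le> a / 4 * (t1 - t)"
        using mult_right_mono[OF s2, of "t1 - t"] t by (simp add: mult.assoc)
      finally have 2: "\<sigma>2 * norm \<Delta> \<le> a / 4 * (t1 - t)" .
      have "\<bar>g (x e t1) - g (x e t) - dg \<bullet> \<Delta>\<bar> \<le> \<sigma>2 * norm \<Delta>"
        unfolding \<Delta>_def using nq[of t] nq[of t1] t t1(2) by (intro \<delta>2(2)[rule_format]) (auto simp: q_def)
      then have "g (x e t1) - g (x e t) \<ge> (t1 - t) * a - a / 4 * (t1 - t) - a / 4 * (t1 - t)"
        using 1 2 by linarith
      moreover have "(t1 - t) * a - a / 4 * (t1 - t) - a / 4 * (t1 - t) = a / 2 * (t1 - t)"
        by (simp add: field_simps)
      moreover have "0 \<le> a / 2 * (t1 - t)" using a t by simp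
      ultimately show ?thesis by linarith
    qed
    have neg: "g (x e t1) < 0"
    proof -
      have n: "norm (x e t1 - xb \<tau>) \<le> B * e" using near\<tau>[of t1] t1 Be by simp
      then have "\<bar>g (x e t1) - g (xb \<tau>) - dg \<bullet> (x e t1 - xb \<tau>)\<bar> \<le> \<sigma>3 * norm (x e t1 - xb \<tau>)"
        using elim(3) \<delta>3(1) by (intro \<delta>3(2)[rule_format]) auto
      also have "\<dots> \<le> \<sigma>3 * (B * e)" using n \<sigma> by (intro mult_left_mono) auto
      also have "\<dots> = m / 4 * e" using B by (simp add: \<sigma>3_def)
      finally have "g (x e t1) \<le> dg \<bullet> (x e t1 - xb \<tau>) + m / 4 * e" using g_xb_\<tau> by linarith
      moreover have "dg \<bullet> (x e t1 - xb \<tau>) < - m / 2 * e"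
        using elim(6,7) by (simp add: t1_def pos_divide_less_eq)
      moreover have "- m / 2 * e + m / 4 * e < 0" using m elim(7) by (simp add: field_simps)
      ultimately show ?thesis by linarith
    qed
    have "x e t \<in> K" if t: "t \<in> {0..t1}" for t
    proof (cases "\<tau> - \<eta> \<le> t")
      case True
      then show ?thesis using mono[of t] neg t by (auto simp: K_eq)
    next
      case False
      then have "t \<in> {0..\<tau> - \<eta>}" using t by auto
      moreover have "x e t \<in> ball (xb t) \<delta>4"
        using near[of t] t t1 elim(4) by (auto simp: dist_norm norm_minus_commute)
      ultimately have "g (x e t) < 0" using \<delta>4(2) by blast
      then show ?thesis by (simp add: K_eq)
    qed
    then show ?case using t1 by (auto simp: t1_def)
  qed
qed

end

context crossing_trajectory
begin

text \<open>A needle after \<tau> leaves the trajectory up to \<tau> unchanged, so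
  \<open>cost_limit\<close> applies with \<theta> equal to zero. The second needle is empty, with
  both ends at \<open>T\<close>.\<close>

lemma after_crossing_minimum:
  assumes P: "adjoint_arc f' T ub xb P" "P T = d\<phi>"
    and s: "\<tau> < s" "s < T" "(xb has_vector_derivative f (xb s, ub s)) (at s)"
    and v: "v \<in> U" "norm v \<le> M"
  shows "P s \<bullet> f (xb s, ub s) \<le> P s \<bullet> f (xb s, v)"
proof -
  define w where "w e = needle_control s v v e T T" for e
  define E where "E e = needle_set s e T T" for e
  define e0 where "e0 = min (s - \<tau>) (1 / variation_const)"
  have e0: "e0 > 0" using s variation_const_pos by (simp add: e0_def)
  have small: "e < s - \<tau>" "variation_const * e \<le> 1" if "e \<in> {0<..<e0}" for e
    using that variation_const_pos by (auto simp: e0_def field_simps)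
  have "\<forall>e\<in>{0<..<e0}. \<exists>x. variation (w e) (E e) (1 * e) x"
    using needle_variation_exists[OF v v, of _ T T s] small by (simp add: w_def E_def)
  from bchoice[OF this] obtain x where x: "\<forall>e\<in>{0<..<e0}. variation (w e) (E e) (1 * e) (x e)" by blast
  have ev: "\<forall>\<^sub>F e in at_right 0. e \<in> {0<..<e0}" using e0 by (rule eventually_at_right_real)
  define Z where "Z e = e *\<^sub>R f (xb s, v) - (xb s - xb (s - e))" for e
  have Z: "((\<lambda>e. (1 / e) *\<^sub>R Z e) \<longlongrightarrow> f (xb s, v) - f (xb s, ub s)) (at_right 0)"
    unfolding Z_def by (rule xb_needle_quotient[OF s(3)])
  obtain C where C: "C \<ge> 0" "\<forall>s v v2 e l r x t. norm v \<le> M \<longrightarrow> norm v2 \<le> M \<longrightarrow> 0 \<le> e \<longrightarrow> 0 \<le> s - e \<longrightarrow> s \<le> l \<longrightarrow>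
      l \<le> r \<longrightarrow> r \<le> T \<longrightarrow> variation (needle_control s v v2 e l r) (needle_set s e l r) (e + (r - l)) x \<longrightarrow>
      (s \<le> t \<and> t \<le> l \<longrightarrow>
        \<bar>P t \<bullet> (x t - xb t) - P s \<bullet> (e *\<^sub>R f (xb s, v) - (xb s - xb (s - e)))\<bar> \<le> C * (e + (r - l))\<^sup>2) \<and>
      (r \<le> t \<and> t \<le> T \<longrightarrow> (\<forall>c\<in>{l..r}.
        \<bar>P t \<bullet> (x t - xb t) - P s \<bullet> (e *\<^sub>R f (xb s, v) - (xb s - xb (s - e)))
          - P c \<bullet> ((r - l) *\<^sub>R f (xb c, v2) - (xb r - xb l))\<bar> \<le> C * (e + (r - l))\<^sup>2))"
    using needle_first_variation[OF P(1)] .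
  define D where "D e = d\<phi> \<bullet> (x e T - xb T) - P s \<bullet> Z e" for e
  have "((\<lambda>e. D e / e) \<longlongrightarrow> 0) (at_right 0)"
  proof (rule tendsto_at_right_quadratic[of _ C], use ev in eventually_elim)
    case (elim e)
    then have "variation (w e) (E e) (1 * e) (x e)" using x by blast
    then have "variation (needle_control s v v e T T) (needle_set s e T T) (e + (T - T)) (x e)"
      by (simp add: w_def E_def)
    then show ?case
      using C(2)[rule_format, of v v e s T T "x e" T] v s elim small[OF elim] \<tau> P(2) by (simp add: D_def Z_def)
  qed
  from tendsto_add[OF this tendsto_inner[OF tendsto_const[of "P s"] Z]]
  have "((\<lambda>e. (d\<phi> \<bullet> (x e T - xb T)) / e) \<longlongrightarrow> P s \<bullet> (f (xb s, v) - f (xb s, ub s))) (at_right 0)"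
    by (simp add: D_def add_divide_distrib[symmetric])
  moreover have "\<forall>\<^sub>F e in at_right 0. 0 \<le> \<tau> - 0 * e \<and> \<tau> - 0 * e \<le> T \<and> (\<forall>t\<in>{0..\<tau> - 0 * e}. x e t \<in> K)"
    using ev
  proof eventually_elim
    case (elim e)
    have "x e t \<in> K" if t: "t \<in> {0..\<tau>}" for t
    proof -
      have "E e \<inter> {0..t} = {}" using t small[OF elim] by (auto simp: E_def)
      then have "x e t = xb t" using x elim t \<tau> by (auto simp: variation_def)
      then show ?thesis using g_neg[of t] g_xb_\<tau> t by (cases "t = \<tau>") (auto simp: K_eq)
    qed
    then show ?case using \<tau> by auto
  qed
  ultimately have "0 \<le> P s \<bullet> (f (xb s, v) - f (xb s, ub s)) + 0"
    using cost_limit[OF e0 zero_less_one x] by blast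
  then show ?thesis by (simp add: inner_diff_right)
qed

text \<open>When the needle shifts the crossing time by about \<open>- \<theta> * e\<close>, the control is moreover replaced by
  the one-sided limit \<open>up\<close> (or \<open>um\<close>) between the perturbed and the original crossing time, so that it
  still jumps at the crossing.\<close>

lemma before_crossing_direction:
  assumes P: "adjoint_arc f' T ub xb P" "P T = d\<phi>"
    and Q: "adjoint_arc f' T ub xb Q" "Q \<tau> = dg"
    and s: "0 < s" "s < \<tau>" "(xb has_vector_derivative f (xb s, ub s)) (at s)"
    and v: "v \<in> U" "norm v \<le> M"
    and \<theta>: "\<theta> \<noteq> 0" "Q s \<bullet> (f (xb s, v) - f (xb s, ub s)) < \<theta> * (dg \<bullet> f (xb \<tau>, um))"
  shows "0 \<le> P s \<bullet> (f (xb s, v) - f (xb s, ub s)) + \<theta> * (1 + P \<tau> \<bullet> (f (xb \<tau>, up) - f (xb \<tau>, um)))"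
proof -
  define y0 where "y0 = f (xb s, v) - f (xb s, ub s)"
  define fm where "fm = f (xb \<tau>, um)"
  define fp where "fp = f (xb \<tau>, up)"
  \<comment> \<open>\<open>k * e\<close> is the total length of the two needles.\<close>
  define k where "k = 1 + \<bar>\<theta>\<bar>"
  \<comment> \<open>For positive \<theta> the crossing is expected earlier, and \<open>up\<close> is
    used from the new crossing time on. For negative \<theta> it is expected later, and
    \<open>um\<close> is prolonged beyond \<tau>. In both cases the second needle fills the gap of
    length \<open>\<bar>\<theta>\<bar> * e\<close>.\<close>
  define lf where "lf e = (if \<theta> > 0 then \<tau> - \<theta> * e else \<tau>)" for e
  define rf where "rf e = (if \<theta> > 0 then \<tau> else \<tau> - \<theta> * e)" for e
  define v2 where "v2 = (if \<theta> > 0 then up else um)"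
  define w where "w e = needle_control s v v2 e (lf e) (rf e)" for e
  define E where "E e = needle_set s e (lf e) (rf e)" for e
  define e0 where "e0 = min (min s ((\<tau> - s) / k)) (min ((T - \<tau>) / k) (1 / (variation_const * k)))"
  have k: "k > 0" by (simp add: k_def add_pos_nonneg)
  have v2: "v2 \<in> U" "norm v2 \<le> M" using um up by (auto simp: v2_def)
  have e0: "e0 > 0" using s \<tau> variation_const_pos k by (simp add: e0_def)
  have ok: "0 < e" "0 \<le> s - e" "s \<le> lf e" "lf e \<le> rf e" "rf e \<le> T" "e + (rf e - lf e) = k * e"
      "variation_const * (k * e) \<le> 1" "lf e \<le> \<tau>" "\<tau> \<le> rf e" "\<tau> - \<theta> * e \<in> {s..T}" "\<bar>\<theta> * e\<bar> = \<bar>\<theta>\<bar> * e"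
    if e: "e \<in> {0<..<e0}" for e
  proof -
    have e1: "0 < e" "e < s" "e < (\<tau> - s) / k" "e < (T - \<tau>) / k" "e < 1 / (variation_const * k)"
      using e by (auto simp: e0_def)
    have e2: "k * e < \<tau> - s" "k * e < T - \<tau>"
      using e1(3,4) k by (simp_all add: pos_less_divide_eq mult.commute)
    have e3: "variation_const * (k * e) < 1"
      using e1(5) k variation_const_pos by (simp add: pos_less_divide_eq mult_ac)
    have e4: "\<bar>\<theta>\<bar> * e \<le> k * e" using e1(1) by (simp add: k_def algebra_simps)
    show e5: "\<bar>\<theta> * e\<bar> = \<bar>\<theta>\<bar> * e" using e1(1) by (simp add: abs_mult)
    show "0 < e" "0 \<le> s - e" "variation_const * (k * e) \<le> 1" using e1 e3 by auto
    have e6: "\<theta> > 0 \<Longrightarrow> \<theta> * e \<ge> 0" "\<not> \<theta> > 0 \<Longrightarrow> \<theta> * e \<le> 0"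
      using e1(1) by (auto simp: mult_nonpos_nonneg)
    have e7: "\<bar>\<theta> * e\<bar> < \<tau> - s" "\<bar>\<theta> * e\<bar> < T - \<tau>" using e4 e2 unfolding e5 by linarith+
    have "s \<le> lf e \<and> lf e \<le> rf e \<and> rf e \<le> T \<and> lf e \<le> \<tau> \<and> \<tau> \<le> rf e \<and> s \<le> \<tau> - \<theta> * e \<and> \<tau> - \<theta> * e \<le> T"
    proof (cases "\<theta> > 0")
      case True
      then have "lf e = \<tau> - \<theta> * e" "rf e = \<tau>" by (simp_all add: lf_def rf_def)
      then show ?thesis using e6(1)[OF True] e7 s \<tau> by linarith
    next
      case False
      then have "lf e = \<tau>" "rf e = \<tau> - \<theta> * e" by (simp_all add: lf_def rf_def)
      then show ?thesis using e6(2)[OF False] e7 s \<tau> by linarith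
    qed
    then show "s \<le> lf e" "lf e \<le> rf e" "rf e \<le> T" "lf e \<le> \<tau>" "\<tau> \<le> rf e" "\<tau> - \<theta> * e \<in> {s..T}"
      by simp_all
    show "e + (rf e - lf e) = k * e"
      using \<theta>(1) by (auto simp: lf_def rf_def k_def algebra_simps)
  qed
  have "\<forall>e\<in>{0<..<e0}. \<exists>x. variation (w e) (E e) (k * e) x"
  proof
    fix e assume e: "e \<in> {0<..<e0}"
    show "\<exists>x. variation (w e) (E e) (k * e) x"
      using needle_variation_exists[OF v v2, of e "lf e" "rf e" s] ok[OF e] by (simp add: w_def E_def)
  qed
  from bchoice[OF this] obtain x where x: "\<forall>e\<in>{0<..<e0}. variation (w e) (E e) (k * e) (x e)" by blast
  have ev: "\<forall>\<^sub>F e in at_right 0. e \<in> {0<..<e0}" using e0 by (rule eventually_at_right_real)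
  define Z1 where "Z1 e = e *\<^sub>R f (xb s, v) - (xb s - xb (s - e))" for e
  define Z2 where "Z2 e = (rf e - lf e) *\<^sub>R f (xb \<tau>, v2) - (xb (rf e) - xb (lf e))" for e
  define Y where "Y e = xb (\<tau> - \<theta> * e) - xb \<tau>" for e
  have Z1: "((\<lambda>e. (1 / e) *\<^sub>R Z1 e) \<longlongrightarrow> y0) (at_right 0)"
    unfolding Z1_def y0_def by (rule xb_needle_quotient[OF s(3)])
  \<comment> \<open>Both signs of \<theta> give the same first-order effect
    \<open>\<theta> *\<^sub>R (fp - fm)\<close> of moving the jump. Only the displacement
    \<open>Y\<close> of the reference trajectory distinguishes them: it has velocity
    \<open>fm\<close> before \<tau> and \<open>fp\<close> after it.\<close>
  have Z2Y: "((\<lambda>e. (1 / e) *\<^sub>R Z2 e) \<longlongrightarrow> \<theta> *\<^sub>R (fp - fm)) (at_right 0) \<and>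
      ((\<lambda>e. (1 / e) *\<^sub>R Y e) \<longlongrightarrow> - \<theta> *\<^sub>R (if \<theta> > 0 then fm else fp)) (at_right 0)"
  proof (cases "\<theta> > 0")
    case True
    have 1: "((\<lambda>e. (1 / e) *\<^sub>R (xb \<tau> - xb (\<tau> - \<theta> * e))) \<longlongrightarrow> \<theta> *\<^sub>R fm) (at_right 0)"
      using tendsto_at_right_scaled_quotient[OF xb_left_quotient True] by (simp add: fm_def)
    have "((\<lambda>e. \<theta> *\<^sub>R fp - (1 / e) *\<^sub>R (xb \<tau> - xb (\<tau> - \<theta> * e))) \<longlongrightarrow> \<theta> *\<^sub>R fp - \<theta> *\<^sub>R fm) (at_right 0)"
      by (intro tendsto_intros 1)
    then have "((\<lambda>e. (1 / e) *\<^sub>R Z2 e) \<longlongrightarrow> \<theta> *\<^sub>R fp - \<theta> *\<^sub>R fm) (at_right 0)"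
      by (rule Lim_transform_eventually, rule_tac eventually_mono[OF eventually_at_right_pos])
        (use True in \<open>simp add: Z2_def lf_def rf_def v2_def fp_def scaleR_diff_right\<close>)
    moreover have "((\<lambda>e. (1 / e) *\<^sub>R Y e) \<longlongrightarrow> - (\<theta> *\<^sub>R fm)) (at_right 0)"
      using tendsto_minus[OF 1] by (simp add: Y_def scaleR_diff_right)
    ultimately show ?thesis using True by (simp add: scaleR_diff_right)
  next
    case False
    then have \<theta>': "- \<theta> > 0" using \<theta>(1) by simp
    have 1: "((\<lambda>e. (1 / e) *\<^sub>R (xb (\<tau> - \<theta> * e) - xb \<tau>)) \<longlongrightarrow> - \<theta> *\<^sub>R fp) (at_right 0)"
      using tendsto_at_right_scaled_quotient[OF xb_right_quotient \<theta>'] by (simp add: fp_def)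
    have "((\<lambda>e. - \<theta> *\<^sub>R fm - (1 / e) *\<^sub>R (xb (\<tau> - \<theta> * e) - xb \<tau>)) \<longlongrightarrow> - \<theta> *\<^sub>R fm - - \<theta> *\<^sub>R fp) (at_right 0)"
      by (intro tendsto_intros 1)
    then have "((\<lambda>e. (1 / e) *\<^sub>R Z2 e) \<longlongrightarrow> - \<theta> *\<^sub>R fm - - \<theta> *\<^sub>R fp) (at_right 0)"
      by (rule Lim_transform_eventually, rule_tac eventually_mono[OF eventually_at_right_pos])
        (use False in \<open>simp add: Z2_def lf_def rf_def v2_def fm_def scaleR_diff_right\<close>)
    moreover have "- \<theta> *\<^sub>R fm - - \<theta> *\<^sub>R fp = \<theta> *\<^sub>R (fp - fm)" by (simp add: algebra_simps)
    ultimately show ?thesis using False 1 by (simp add: Y_def)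
  qed
  have var: "variation (needle_control s v v2 e (lf e) (rf e)) (needle_set s e (lf e) (rf e)) (e + (rf e - lf e)) (x e)"
    if "e \<in> {0<..<e0}" for e
    using x that unfolding ok(6)[OF that] by (simp add: w_def E_def)
  have limP: "((\<lambda>e. (d\<phi> \<bullet> (x e T - xb T)) / e) \<longlongrightarrow> P s \<bullet> y0 + P \<tau> \<bullet> (\<theta> *\<^sub>R (fp - fm))) (at_right 0)"
  proof -
    obtain C where C: "C \<ge> 0" "\<forall>s v v2 e l r x t. norm v \<le> M \<longrightarrow> norm v2 \<le> M \<longrightarrow> 0 \<le> e \<longrightarrow> 0 \<le> s - e \<longrightarrow> s \<le> l \<longrightarrow>
      l \<le> r \<longrightarrow> r \<le> T \<longrightarrow> variation (needle_control s v v2 e l r) (needle_set s e l r) (e + (r - l)) x \<longrightarrow>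
      (s \<le> t \<and> t \<le> l \<longrightarrow>
        \<bar>P t \<bullet> (x t - xb t) - P s \<bullet> (e *\<^sub>R f (xb s, v) - (xb s - xb (s - e)))\<bar> \<le> C * (e + (r - l))\<^sup>2) \<and>
      (r \<le> t \<and> t \<le> T \<longrightarrow> (\<forall>c\<in>{l..r}.
        \<bar>P t \<bullet> (x t - xb t) - P s \<bullet> (e *\<^sub>R f (xb s, v) - (xb s - xb (s - e)))
          - P c \<bullet> ((r - l) *\<^sub>R f (xb c, v2) - (xb r - xb l))\<bar> \<le> C * (e + (r - l))\<^sup>2))"
      using needle_first_variation[OF P(1)] .
    define D where "D e = d\<phi> \<bullet> (x e T - xb T) - P s \<bullet> Z1 e - P \<tau> \<bullet> Z2 e" for e
    have "((\<lambda>e. D e / e) \<longlongrightarrow> 0) (at_right 0)"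
    proof (rule tendsto_at_right_quadratic[of _ "C * k\<^sup>2"], use ev in eventually_elim)
      case (elim e)
      note o = ok[OF elim]
      have "\<bar>P T \<bullet> (x e T - xb T) - P s \<bullet> (e *\<^sub>R f (xb s, v) - (xb s - xb (s - e)))
          - P \<tau> \<bullet> ((rf e - lf e) *\<^sub>R f (xb \<tau>, v2) - (xb (rf e) - xb (lf e)))\<bar> \<le> C * (e + (rf e - lf e))\<^sup>2"
        using C(2)[rule_format, of v v2 e s "lf e" "rf e" "x e" T, OF v(2) v2(2) less_imp_le[OF o(1)] o(2-5) var[OF elim]]
          o(5,8,9) by simp
      then show ?case unfolding o(6) by (simp add: D_def Z1_def Z2_def P(2) power_mult_distrib)
    qed
    from tendsto_add[OF tendsto_add[OF this tendsto_inner[OF tendsto_const[of "P s"] Z1]]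
        tendsto_inner[OF tendsto_const[of "P \<tau>"] conjunct1[OF Z2Y]]]
    show ?thesis by (simp add: D_def add_divide_distrib[symmetric])
  qed
  have limQ: "((\<lambda>e. (dg \<bullet> (x e (\<tau> - \<theta> * e) - xb \<tau>)) / e) \<longlongrightarrow> - (\<theta> * (dg \<bullet> fm) - Q s \<bullet> y0)) (at_right 0)"
  proof -
    obtain C where C: "C \<ge> 0" "\<forall>s v v2 e l r x t. norm v \<le> M \<longrightarrow> norm v2 \<le> M \<longrightarrow> 0 \<le> e \<longrightarrow> 0 \<le> s - e \<longrightarrow> s \<le> l \<longrightarrow>
      l \<le> r \<longrightarrow> r \<le> T \<longrightarrow> variation (needle_control s v v2 e l r) (needle_set s e l r) (e + (r - l)) x \<longrightarrow>
      (s \<le> t \<and> t \<le> l \<longrightarrow>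
        \<bar>Q t \<bullet> (x t - xb t) - Q s \<bullet> (e *\<^sub>R f (xb s, v) - (xb s - xb (s - e)))\<bar> \<le> C * (e + (r - l))\<^sup>2) \<and>
      (r \<le> t \<and> t \<le> T \<longrightarrow> (\<forall>c\<in>{l..r}.
        \<bar>Q t \<bullet> (x t - xb t) - Q s \<bullet> (e *\<^sub>R f (xb s, v) - (xb s - xb (s - e)))
          - Q c \<bullet> ((r - l) *\<^sub>R f (xb c, v2) - (xb r - xb l))\<bar> \<le> C * (e + (r - l))\<^sup>2))"
      using needle_first_variation[OF Q(1)] .
    obtain CQ where CQ: "CQ-lipschitz_on {0..T} Q" using Q(1) by (auto simp: adjoint_arc_def)
    define t1 where "t1 e = \<tau> - \<theta> * e" for e
    \<comment> \<open>At the time \<open>t1 e\<close> the second needle has not yet acted if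
      \<theta> is positive and is completed otherwise.\<close>
    define k2 where "k2 = (if \<theta> > 0 then 0 else 1 :: real)"
    define D where "D e = Q (t1 e) \<bullet> (x e (t1 e) - xb (t1 e)) - Q s \<bullet> Z1 e - k2 * (dg \<bullet> Z2 e)" for e
    \<comment> \<open>Replacing \<open>Q (t1 e)\<close> by its value \<open>dg\<close> at \<tau>
      costs a product of two quantities of order \<open>e\<close>.\<close>
    define G where "G e = (dg - Q (t1 e)) \<bullet> (x e (t1 e) - xb (t1 e))" for e
    have limD: "((\<lambda>e. D e / e) \<longlongrightarrow> 0) (at_right 0)"
    proof (rule tendsto_at_right_quadratic[of _ "C * k\<^sup>2"], use ev in eventually_elim)
      case (elim e)
      note o = ok[OF elim]
      note CC = C(2)[rule_format, of v v2 e s "lf e" "rf e" "x e" "t1 e",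
          OF v(2) v2(2) less_imp_le[OF o(1)] o(2-5) var[OF elim]]
      have "\<bar>D e\<bar> \<le> C * (e + (rf e - lf e))\<^sup>2"
      proof (cases "\<theta> > 0")
        case True
        then have "s \<le> t1 e \<and> t1 e \<le> lf e" using o by (auto simp: t1_def lf_def)
        then show ?thesis using conjunct1[OF CC] True by (simp add: D_def Z1_def k2_def)
      next
        case False
        then have "rf e \<le> t1 e \<and> t1 e \<le> T" using o by (auto simp: t1_def rf_def)
        moreover have "\<tau> \<in> {lf e..rf e}" using o by auto
        ultimately show ?thesis using conjunct2[OF CC] False Q(2) by (auto simp: D_def Z1_def Z2_def k2_def)
      qed
      then show ?case unfolding o(6) by (simp add: power_mult_distrib)
    qed
    have limG: "((\<lambda>e. G e / e) \<longlongrightarrow> 0) (at_right 0)"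
    proof (rule tendsto_at_right_quadratic[of _ "CQ * \<bar>\<theta>\<bar> * (variation_const * k)"], use ev in eventually_elim)
      case (elim e)
      note o = ok[OF elim]
      have t1T: "t1 e \<in> {0..T}" "\<tau> \<in> {0..T}" using o(10) s \<tau> by (auto simp: t1_def)
      have "norm (dg - Q (t1 e)) \<le> CQ * (\<bar>\<theta>\<bar> * e)"
        using lipschitz_onD[OF CQ t1T(2,1)] o(11) Q(2) by (simp add: dist_norm t1_def)
      moreover have "norm (x e (t1 e) - xb (t1 e)) \<le> variation_const * (k * e)"
        using x elim t1T by (auto simp: variation_def)
      ultimately have "\<bar>G e\<bar> \<le> CQ * (\<bar>\<theta>\<bar> * e) * (variation_const * (k * e))"
        unfolding G_def using lipschitz_on_nonneg[OF CQ] o(1)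
        by (intro order.trans[OF Cauchy_Schwarz_ineq2] mult_mono) auto
      then show ?case by (simp add: power2_eq_square mult_ac)
    qed
    have split: "dg \<bullet> (x e (t1 e) - xb \<tau>) = D e + Q s \<bullet> Z1 e + k2 * (dg \<bullet> Z2 e) + G e + dg \<bullet> Y e" for e
      by (simp add: D_def G_def Y_def t1_def inner_diff_left inner_diff_right)
    have lims: "((\<lambda>e. D e / e + Q s \<bullet> ((1 / e) *\<^sub>R Z1 e) + k2 * (dg \<bullet> ((1 / e) *\<^sub>R Z2 e)) + G e / e + dg \<bullet> ((1 / e) *\<^sub>R Y e))
      \<longlongrightarrow> 0 + Q s \<bullet> y0 + k2 * (dg \<bullet> (\<theta> *\<^sub>R (fp - fm))) + 0 + dg \<bullet> (- \<theta> *\<^sub>R (if \<theta> > 0 then fm else fp))) (at_right 0)"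
      by (intro tendsto_intros limD limG Z1 conjunct1[OF Z2Y] conjunct2[OF Z2Y])
    have eq1: "D e / e + Q s \<bullet> ((1 / e) *\<^sub>R Z1 e) + k2 * (dg \<bullet> ((1 / e) *\<^sub>R Z2 e)) + G e / e + dg \<bullet> ((1 / e) *\<^sub>R Y e)
        = (dg \<bullet> (x e (\<tau> - \<theta> * e) - xb \<tau>)) / e" for e
      using split[of e] by (simp add: t1_def add_divide_distrib)
    \<comment> \<open>The two cases agree: for negative \<theta> the contributions of
      \<open>fp\<close> from the second needle and from the displacement cancel.\<close>
    have eq2: "0 + Q s \<bullet> y0 + k2 * (dg \<bullet> (\<theta> *\<^sub>R (fp - fm))) + 0 + dg \<bullet> (- \<theta> *\<^sub>R (if \<theta> > 0 then fm else fp))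
        = - (\<theta> * (dg \<bullet> fm) - Q s \<bullet> y0)"
      by (simp add: k2_def inner_diff_right algebra_simps)
    show ?thesis using lims unfolding eq1 eq2 .
  qed
  have m: "\<theta> * (dg \<bullet> fm) - Q s \<bullet> y0 > 0" using \<theta>(2) by (simp add: fm_def y0_def)
  have \<eta>1: "\<tau> - s > 0" using s by simp
  have ctrl: "\<forall>e\<in>{0<..<e0}. \<forall>r\<in>{\<tau> - (\<tau> - s)<..<\<tau> - \<theta> * e}. r < \<tau> \<and> w e r = ub r \<or> w e r = um"
  proof (intro ballI)
    fix e r assume e: "e \<in> {0<..<e0}" and r: "r \<in> {\<tau> - (\<tau> - s)<..<\<tau> - \<theta> * e}"
    show "r < \<tau> \<and> w e r = ub r \<or> w e r = um"
    proof (cases "\<theta> > 0")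
      case True
      then have "\<theta> * e > 0" using ok(1)[OF e] by simp
      then show ?thesis using True r by (auto simp: w_def needle_control_def lf_def rf_def)
    next
      case False
      then show ?thesis using r by (auto simp: w_def needle_control_def lf_def rf_def v2_def)
    qed
  qed
  have "0 \<le> (P s \<bullet> y0 + P \<tau> \<bullet> (\<theta> *\<^sub>R (fp - fm))) + \<theta>"
    by (rule cost_limit[OF e0 k x eventually_in_K[OF e0 k x limQ m \<eta>1 ctrl] limP])
  then show ?thesis by (simp add: y0_def fp_def fm_def algebra_simps)
qed

text \<open>The previous inequality holds for every nonzero \<theta> above the rate
  \<open>b / a\<close> at which the needle shifts the crossing. Letting \<theta> decrease to
  \<open>b / a\<close> makes it sharp, and the equation for \<gamma> absorbs the factor of \<theta>
  into a multiple of \<open>Q s\<close>.\<close>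

lemma before_crossing_minimum:
  assumes P: "adjoint_arc f' T ub xb P" "P T = d\<phi>"
    and Q: "adjoint_arc f' T ub xb Q" "Q \<tau> = dg"
    and s: "0 < s" "s < \<tau>" "(xb has_vector_derivative f (xb s, ub s)) (at s)"
    and v: "v \<in> U" "norm v \<le> M"
    and \<gamma>: "\<gamma> * (dg \<bullet> f (xb \<tau>, um)) = - (1 + P \<tau> \<bullet> (f (xb \<tau>, up) - f (xb \<tau>, um)))"
  shows "(P s - \<gamma> *\<^sub>R Q s) \<bullet> f (xb s, ub s) \<le> (P s - \<gamma> *\<^sub>R Q s) \<bullet> f (xb s, v)"
proof -
  define y0 where "y0 = f (xb s, v) - f (xb s, ub s)"
  define a where "a = dg \<bullet> f (xb \<tau>, um)"
  define A where "A = P s \<bullet> y0"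
  define B where "B = 1 + P \<tau> \<bullet> (f (xb \<tau>, up) - f (xb \<tau>, um))"
  define b where "b = Q s \<bullet> y0"
  have a: "a > 0" using transversal by (simp add: a_def)
  have "((\<lambda>\<theta>. A + \<theta> * B) \<longlongrightarrow> A + (b / a) * B) (at_right (b / a))"
    by (intro tendsto_intros)
  moreover have "\<forall>\<^sub>F \<theta> in at_right (b / a). 0 \<le> A + \<theta> * B"
    using eventually_neq_at_within[of 0 "b / a" "{b / a<..}"] eventually_at_right_less[of "b / a"]
  proof eventually_elim
    case (elim \<theta>)
    then have "b < \<theta> * a" using a by (simp add: pos_divide_less_eq)
    then show ?case using before_crossing_direction[OF P Q s v elim(1)]
      by (simp add: A_def B_def b_def a_def y0_def)
  qed
  ultimately have "0 \<le> A + (b / a) * B" by (rule tendsto_lowerbound) simp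
  also have "B = - (\<gamma> * a)" using \<gamma> by (simp add: B_def a_def)
  finally have "0 \<le> A - \<gamma> * b" using a by (simp add: mult.commute)
  then show ?thesis by (simp add: A_def b_def y0_def inner_diff_left inner_diff_right right_diff_distrib)
qed

end

section \<open>Costates and the Hamiltonian\<close>

text \<open>\<open>gradient\<close> is a definite description, so existence and uniqueness have to
  be secured once: the values of the derivative on an orthonormal basis give a representing vector,
  and testing against all directions shows that it is the only one.\<close>

lemma has_derivative_gradient:
  fixes h :: "'a::euclidean_space \<Rightarrow> real"
  assumes "(h has_derivative h') (at x)"
  shows "(h has_derivative (\<lambda>d. gradient h x \<bullet> d)) (at x)" "gradient h x \<bullet> d = h' d"
proof -
  define D where "D = (\<Sum>b\<in>Basis. h' b *\<^sub>R b)"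
  have lin: "linear h'" using assms by (rule has_derivative_linear)
  have D: "D \<bullet> d = h' d" for d
  proof -
    have "h' d = h' (\<Sum>b\<in>Basis. (d \<bullet> b) *\<^sub>R b)" by (simp add: euclidean_representation)
    also have "\<dots> = (\<Sum>b\<in>Basis. (d \<bullet> b) *\<^sub>R h' b)"
      by (simp add: linear_sum[OF lin] linear_scale[OF lin])
    also have "\<dots> = D \<bullet> d" by (simp add: D_def inner_sum_left mult.commute inner_commute[of d])
    finally show ?thesis by simp
  qed
  have hD: "GDERIV h x :> D"
    unfolding gderiv_def using assms by (simp add: D inner_commute[of _ D])
  have "gradient h x = D" unfolding gradient_def
  proof (rule the_equality)
    show "GDERIV h x :> D" by (rule hD)
    fix D' assume "GDERIV h x :> D'"
    then have "(h has_derivative (\<lambda>d. d \<bullet> D')) (at x)" by (simp add: gderiv_def)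
    then have "h' = (\<lambda>d. d \<bullet> D')" using assms by (intro has_derivative_unique)
    then have "D' \<bullet> d = D \<bullet> d" for d using D[of d] by (simp add: inner_commute)
    then show "D' = D" using vector_eq_rdot[of D' D] by blast
  qed
  then show "gradient h x \<bullet> d = h' d" for d using D by simp
  then have "h' = (\<lambda>d. gradient h x \<bullet> d)" by auto
  then show "(h has_derivative (\<lambda>d. gradient h x \<bullet> d)) (at x)" using assms by simp
qed

lemma Ham_gradient_inner:
  fixes f :: "'x::euclidean_space \<times> 'u::euclidean_space \<Rightarrow> 'x"
  assumes "(f has_derivative blinfun_apply (f' (x, u))) (at (x, u))"
  shows "gradient (\<lambda>y. Ham f y p u) x \<bullet> h = p \<bullet> f' (x, u) (h, 0)"
    and "((\<lambda>v. p \<bullet> f (x, v)) has_derivative (\<lambda>h. p \<bullet> f' (x, u) (0, h))) (at u)"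
proof -
  have "((\<lambda>y. f (y, u)) has_derivative (\<lambda>h. f' (x, u) (h, 0))) (at x)"
    by (rule has_derivative_compose[of "\<lambda>y. (y, u)" "\<lambda>h. (h, 0)", OF _ assms]) (auto intro!: derivative_eq_intros)
  then have "((\<lambda>y. Ham f y p u) has_derivative (\<lambda>h. p \<bullet> f' (x, u) (h, 0))) (at x)"
    unfolding Ham_def by (rule has_derivative_inner_right)
  then show "gradient (\<lambda>y. Ham f y p u) x \<bullet> h = p \<bullet> f' (x, u) (h, 0)"
    by (rule has_derivative_gradient)
  have "((\<lambda>v. f (x, v)) has_derivative (\<lambda>h. f' (x, u) (0, h))) (at u)"
    by (rule has_derivative_compose[of "\<lambda>v. (x, v)" "\<lambda>h. (0, h)", OF _ assms]) (auto intro!: derivative_eq_intros)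
  then show "((\<lambda>v. p \<bullet> f (x, v)) has_derivative (\<lambda>h. p \<bullet> f' (x, u) (0, h))) (at u)"
    by (rule has_derivative_inner_right)
qed

text \<open>A null set contains no interval, so the constant value is taken arbitrarily close to the
  endpoint and equals the limit there. This evaluates the constant Hamiltonian at the crossing time,
  where the control has only one-sided limits.\<close>

lemma AE_eq_const_imp_limit_eq:
  fixes F :: "real \<Rightarrow> 'a::t1_space"
  assumes "AE t in lebesgue_on {a<..<b}. F t = h" "a < b"
  shows "(F \<longlongrightarrow> l) (at_left b) \<Longrightarrow> h = l" and "(F \<longlongrightarrow> l) (at_right a) \<Longrightarrow> h = l"
proof -
  have neg: "negligible {t \<in> {a<..<b}. F t \<noteq> h}" using assms(1) by (simp add: AE_lebesgue_on_iff_negligible)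
  have no: "\<not> {c<..<d} \<subseteq> {t \<in> {a<..<b}. F t \<noteq> h}" if "c < d" for c d
    using negligible_subset[OF neg, of "{c<..<d}"] open_not_negligible[of "{c<..<d}"] that by auto
  show "h = l" if lim: "(F \<longlongrightarrow> l) (at_left b)"
  proof (rule ccontr)
    assume "h \<noteq> l"
    then have "\<forall>\<^sub>F t in at_left b. F t \<noteq> h" using lim by (intro tendsto_imp_eventually_ne) auto
    then obtain c where "c < b" "\<forall>t>c. t < b \<longrightarrow> F t \<noteq> h" by (auto simp: eventually_at_left_field)
    then show False using no[of "max a c" b] \<open>a < b\<close> by auto
  qed
  show "h = l" if lim: "(F \<longlongrightarrow> l) (at_right a)"
  proof (rule ccontr)
    assume "h \<noteq> l"
    then have "\<forall>\<^sub>F t in at_right a. F t \<noteq> h" using lim by (intro tendsto_imp_eventually_ne) auto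
    then obtain c where "a < c" "\<forall>t>a. t < c \<longrightarrow> F t \<noteq> h" by (auto simp: eventually_at_right_field)
    then show False using no[of a "min b c"] \<open>a < b\<close> by auto
  qed
qed

section \<open>Existence and comparison of adjoint arcs\<close>

lemma abs_continuous_on_diff:
  fixes x y :: "real \<Rightarrow> 'a::real_normed_vector"
  assumes "abs_continuous_on S x" "abs_continuous_on S y"
  shows "abs_continuous_on S (\<lambda>t. x t - y t)"
  unfolding abs_continuous_on_def
proof (intro allI impI)
  fix e :: real assume "e > 0"
  then have "e / 2 > 0" by simp
  obtain d1 where d1: "d1 > 0" "\<forall>D. finite D \<longrightarrow> (\<forall>(a, b)\<in>D. a \<le> b \<and> {a..b} \<subseteq> S) \<longrightarrow>
        pairwise (\<lambda>(a, b) (c, d). {a<..<b} \<inter> {c<..<d} = {}) D \<longrightarrow>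
        (\<Sum>(a, b)\<in>D. b - a) < d1 \<longrightarrow> (\<Sum>(a, b)\<in>D. norm (x b - x a)) < e / 2"
    using abs_continuous_onE[OF assms(1) \<open>e / 2 > 0\<close>] .
  obtain d2 where d2: "d2 > 0" "\<forall>D. finite D \<longrightarrow> (\<forall>(a, b)\<in>D. a \<le> b \<and> {a..b} \<subseteq> S) \<longrightarrow>
        pairwise (\<lambda>(a, b) (c, d). {a<..<b} \<inter> {c<..<d} = {}) D \<longrightarrow>
        (\<Sum>(a, b)\<in>D. b - a) < d2 \<longrightarrow> (\<Sum>(a, b)\<in>D. norm (y b - y a)) < e / 2"
    using abs_continuous_onE[OF assms(2) \<open>e / 2 > 0\<close>] .
  show "\<exists>d>0. \<forall>D. finite D \<longrightarrow> (\<forall>(a, b)\<in>D. a \<le> b \<and> {a..b} \<subseteq> S) \<longrightarrow>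
        pairwise (\<lambda>(a, b) (c, d). {a<..<b} \<inter> {c<..<d} = {}) D \<longrightarrow>
        (\<Sum>(a, b)\<in>D. b - a) < d \<longrightarrow> (\<Sum>(a, b)\<in>D. norm (x b - y b - (x a - y a))) < e"
  proof (intro exI[of _ "min d1 d2"] conjI allI impI)
    fix D assume D: "finite D" "\<forall>(a, b)\<in>D. a \<le> b \<and> {a..b} \<subseteq> S"
      "pairwise (\<lambda>(a, b) (c, d). {a<..<b} \<inter> {c<..<d} = {}) D" "(\<Sum>(a, b)\<in>D. b - a) < min d1 d2"
    have "(\<Sum>(a, b)\<in>D. norm (x b - y b - (x a - y a))) \<le> (\<Sum>(a, b)\<in>D. norm (x b - x a) + norm (y b - y a))"
    proof (rule sum_mono, clarify)
      fix a b
      have "x b - y b - (x a - y a) = (x b - x a) - (y b - y a)" by simp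
      then show "norm (x b - y b - (x a - y a)) \<le> norm (x b - x a) + norm (y b - y a)"
        by (metis norm_triangle_ineq4)
    qed
    also have "\<dots> = (\<Sum>(a, b)\<in>D. norm (x b - x a)) + (\<Sum>(a, b)\<in>D. norm (y b - y a))"
      by (simp add: sum.distrib case_prod_beta)
    also have "\<dots> < e / 2 + e / 2"
      using d1(2) d2(2) D by (intro add_strict_mono) auto
    finally show "(\<Sum>(a, b)\<in>D. norm (x b - y b - (x a - y a))) < e" by simp
  qed (use d1(1) d2(1) in auto)
qed

text \<open>The comparison time \<open>s\<close> is kept free: it will be the final time on one side
  of the crossing and will tend to the crossing time on the other.\<close>

lemma abs_continuous_adjoint_difference_zero:
  fixes p P :: "real \<Rightarrow> 'a::euclidean_space"
  assumes ac: "abs_continuous_on {a..b} (\<lambda>t. p t - P t)"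
    and der: "AE t in lebesgue_on {a<..<b}. (p has_vector_derivative G t) (at t) \<and>
      (P has_vector_derivative H t) (at t) \<and> norm (G t - H t) \<le> L * norm (p t - P t)"
    and L: "L > 0" and st: "s \<in> {a..b}" "t \<in> {a..b}"
  shows "norm (p t - P t) \<le> 2 * norm (p s - P s) * exp (2 * L * (b - a))"
proof -
  have "AE t in lebesgue_on {a<..<b}. ((\<lambda>t. p t - P t) has_vector_derivative (G t - H t)) (at t)"
    using der by eventually_elim (auto intro: has_vector_derivative_diff)
  moreover have "AE t in lebesgue_on {a<..<b}. norm (G t - H t) \<le> L * norm (p t - P t)"
    using der by eventually_elim auto
  ultimately have "norm (p t - P t) \<le> 2 * norm (p s - P s) * exp (2 * L * \<bar>t - s\<bar>)"
    using ac L st by (intro abs_continuous_solution_bound)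
  also have "\<dots> \<le> 2 * norm (p s - P s) * exp (2 * L * (b - a))"
    using L st by (intro mult_left_mono) auto
  finally show ?thesis .
qed

context reference_trajectory
begin

text \<open>Testing with \<open>h = q\<close> bounds the transposed operator by the norm of the
  operator itself.\<close>

lemma norm_le_adjoint:
  assumes "\<And>h. q \<bullet> h = - (p \<bullet> f' (xb t, ub t) (h, 0))" "t \<in> {0..T}"
  shows "norm q \<le> L * norm p"
proof (cases "q = 0")
  case False
  have "(norm q)\<^sup>2 = - (p \<bullet> f' (xb t, ub t) (q, 0))" using assms(1)[of q] by (simp add: power2_norm_eq_inner)
  also have "\<dots> \<le> norm p * norm (f' (xb t, ub t) (q, 0))"
    using Cauchy_Schwarz_ineq2[of p "f' (xb t, ub t) (q, 0)"] by linarith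
  also have "\<dots> \<le> norm p * (L * norm q)"
  proof (intro mult_left_mono)
    have "norm (f' (xb t, ub t) (q, 0)) \<le> norm (f' (xb t, ub t)) * norm (q, 0::'u)" by (rule norm_blinfun)
    also have "\<dots> \<le> L * norm (q, 0::'u)"
      using f'_bound[of "xb t" "ub t"] xb_R[OF assms(2)] ub_M[OF assms(2)] by (intro mult_right_mono) auto
    finally show "norm (f' (xb t, ub t) (q, 0)) \<le> L * norm q" by (simp add: norm_Pair)
  qed simp
  finally have "norm q * norm q \<le> (L * norm p) * norm q" by (simp add: power2_eq_square mult_ac)
  then show ?thesis using False by simp
qed (use L in simp)

lemma adjoint_exists:
  assumes f'_cont: "continuous_on UNIV f'" and t0: "t0 \<in> {0..T}"
  obtains p where "adjoint_arc f' T ub xb p" "p t0 = y"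
proof -
  \<comment> \<open>This is minus the transpose of the state derivative, written in an orthonormal
    basis so that measurability in time is visible.\<close>
  define F where "F t q = - (\<Sum>b\<in>Basis. (q \<bullet> f' (xb t, ub t) (b, 0)) *\<^sub>R b)" for t q
  have F: "F t q \<bullet> h = - (q \<bullet> f' (xb t, ub t) (h, 0))" for t q h
  proof -
    have "linear (\<lambda>h. q \<bullet> f' (xb t, ub t) (h, 0))"
      by (intro bounded_linear.linear bounded_linear_compose[OF bounded_linear_inner_right]
          bounded_linear_compose[OF blinfun.bounded_linear_right] bounded_linear_Pair bounded_linear_ident bounded_linear_zero)
    from linear_sum[OF this, of "\<lambda>b. (h \<bullet> b) *\<^sub>R b" Basis] linear_scale[OF this]
    have "q \<bullet> f' (xb t, ub t) (\<Sum>b\<in>Basis. (h \<bullet> b) *\<^sub>R b, 0) = (\<Sum>b\<in>Basis. (h \<bullet> b) * (q \<bullet> f' (xb t, ub t) (b, 0)))"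
      by simp
    then have rep: "q \<bullet> f' (xb t, ub t) (h, 0) = (\<Sum>b\<in>Basis. (h \<bullet> b) * (q \<bullet> f' (xb t, ub t) (b, 0)))"
      unfolding euclidean_representation .
    have "F t q \<bullet> h = - (\<Sum>b\<in>Basis. (q \<bullet> f' (xb t, ub t) (b, 0)) * (b \<bullet> h))"
      by (simp add: F_def inner_sum_left)
    also have "(\<Sum>b\<in>Basis. (q \<bullet> f' (xb t, ub t) (b, 0)) * (b \<bullet> h)) = (\<Sum>b\<in>Basis. (h \<bullet> b) * (q \<bullet> f' (xb t, ub t) (b, 0)))"
      by (intro sum.cong refl) (simp only: inner_commute[of h] mult.commute)
    finally show ?thesis using rep by simp
  qed
  obtain p C where p: "C-lipschitz_on {0..T} p" "p t0 = y"
    "AE t in lebesgue_on {0<..<T}. (p has_vector_derivative F t (p t)) (at t)"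
  proof (rule caratheodory_solution[OF t0, of F 0 L y])
    fix x :: "real \<Rightarrow> 'x" assume x: "continuous_on {0..T} x"
    have [measurable]: "x \<in> borel_measurable (lebesgue_on {0..T})"
      using x by (rule continuous_on_borel_measurable_lebesgue_on_Icc)
    have [measurable]: "(\<lambda>t. f' (xb t, ub t) (b, 0)) \<in> borel_measurable (lebesgue_on {0..T})" for b
      by (rule measurable_dynamics[OF _ xb_continuous ub_meas]) (intro continuous_intros f'_cont)
    show "(\<lambda>t. F t (x t)) \<in> borel_measurable (lebesgue_on {0..T})"
      unfolding F_def by measurable
  next
    fix t and q r :: 'x assume t: "t \<in> {0..T}"
    show "norm (F t 0) \<le> 0" by (simp add: F_def)
    have "(F t q - F t r) \<bullet> h = - ((q - r) \<bullet> f' (xb t, ub t) (h, 0))" for h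
      by (simp add: inner_diff_left F)
    then show "norm (F t q - F t r) \<le> L * norm (q - r)" using t by (rule norm_le_adjoint)
  qed blast
  have "adjoint_arc f' T ub xb p"
    unfolding adjoint_arc_def
  proof (intro conjI)
    show "AE t in lebesgue_on {0<..<T}.
      \<exists>q. (p has_vector_derivative q) (at t) \<and> (\<forall>h. q \<bullet> h = - (p t \<bullet> f' (xb t, ub t) (h, 0)))"
      using p(3) by eventually_elim (use F in blast)
  qed (use p(1) in blast)
  then show thesis using p(2) by (rule that)
qed

lemma adjoint_arc_scaleR_diff:
  assumes "adjoint_arc f' T ub xb P" "adjoint_arc f' T ub xb Q"
  shows "adjoint_arc f' T ub xb (\<lambda>t. \<alpha> *\<^sub>R P t - \<gamma> *\<^sub>R Q t)"
proof -
  obtain C D where "C-lipschitz_on {0..T} P" "D-lipschitz_on {0..T} Q"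
    using assms by (auto simp: adjoint_arc_def)
  then have "(\<bar>\<alpha>\<bar> * C + \<bar>\<gamma>\<bar> * D)-lipschitz_on {0..T} (\<lambda>t. \<alpha> *\<^sub>R P t - \<gamma> *\<^sub>R Q t)"
    by (intro lipschitz_on_diff lipschitz_on_cmult)
  moreover have "AE t in lebesgue_on {0<..<T}.
      \<exists>q. (P has_vector_derivative q) (at t) \<and> (\<forall>h. q \<bullet> h = - (P t \<bullet> f' (xb t, ub t) (h, 0)))"
    "AE t in lebesgue_on {0<..<T}.
      \<exists>q. (Q has_vector_derivative q) (at t) \<and> (\<forall>h. q \<bullet> h = - (Q t \<bullet> f' (xb t, ub t) (h, 0)))"
    using assms by (auto simp: adjoint_arc_def)
  then have "AE t in lebesgue_on {0<..<T}. \<exists>q. ((\<lambda>t. \<alpha> *\<^sub>R P t - \<gamma> *\<^sub>R Q t) has_vector_derivative q) (at t) \<and>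
      (\<forall>h. q \<bullet> h = - ((\<alpha> *\<^sub>R P t - \<gamma> *\<^sub>R Q t) \<bullet> f' (xb t, ub t) (h, 0)))"
  proof eventually_elim
    case (elim t)
    then obtain q r where q: "(P has_vector_derivative q) (at t)" "\<forall>h. q \<bullet> h = - (P t \<bullet> f' (xb t, ub t) (h, 0))"
      and r: "(Q has_vector_derivative r) (at t)" "\<forall>h. r \<bullet> h = - (Q t \<bullet> f' (xb t, ub t) (h, 0))" by blast
    have "((\<lambda>t. \<alpha> *\<^sub>R P t - \<gamma> *\<^sub>R Q t) has_vector_derivative (\<alpha> *\<^sub>R q - \<gamma> *\<^sub>R r)) (at t)"
      by (intro has_vector_derivative_diff bounded_linear.has_vector_derivative[OF bounded_linear_scaleR_right] q(1) r(1))
    moreover have "(\<alpha> *\<^sub>R q - \<gamma> *\<^sub>R r) \<bullet> h = - ((\<alpha> *\<^sub>R P t - \<gamma> *\<^sub>R Q t) \<bullet> f' (xb t, ub t) (h, 0))" for h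
      using q(2) r(2) by (simp add: inner_diff_left)
    ultimately show ?case by blast
  qed
  ultimately show ?thesis by (auto simp: adjoint_arc_def)
qed

text \<open>The minimum \<open>m\<close> of the Hamiltonian over the compact set of bounded controls is Lipschitz in
  time.  At almost every \<open>t\<close> it is dominated by the Hamiltonian with the frozen control \<open>ub t\<close>, which
  touches \<open>m\<close> at \<open>t\<close> and has derivative zero there.\<close>

lemma hamiltonian_constant:
  assumes U: "closed U" and f': "\<And>z. (f has_derivative blinfun_apply (f' z)) (at z)"
    and p: "adjoint_arc f' T ub xb p" and ab: "0 \<le> a" "a < b" "b \<le> T"
    and min: "AE t in lebesgue_on {a<..<b}. \<forall>u\<in>U. p t \<bullet> f (xb t, ub t) \<le> p t \<bullet> f (xb t, u)"
  obtains h where "AE t in lebesgue_on {a<..<b}. p t \<bullet> f (xb t, ub t) = h"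
proof -
  \<comment> \<open>The ball provides compactness. As \<open>ub\<close> takes values in
    \<open>V\<close>, the minimum over \<open>V\<close> equals the one over \<open>U\<close> at good
    times.\<close>
  define V where "V = U \<inter> cball 0 M"
  have ubV: "ub t \<in> V" if "t \<in> {0..T}" for t using ub_U[OF that] ub_M[OF that] by (simp add: V_def)
  have V: "compact V" "V \<noteq> {}" using U ubV[of 0] T by (auto simp: V_def intro: closed_Int_compact)
  define H where "H t u = p t \<bullet> f (xb t, u)" for t u
  have cH: "continuous_on V (H t)" for t
    unfolding H_def by (intro continuous_intros continuous_on_compose2[OF f_cont]) auto
  have "\<forall>t. \<exists>u. u \<in> V \<and> (\<forall>v\<in>V. H t u \<le> H t v)"
    using continuous_attains_inf[OF V cH] by blast
  then obtain u where u: "\<And>t. u t \<in> V" "\<And>t v. v \<in> V \<Longrightarrow> H t (u t) \<le> H t v" by metis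
  define m where "m t = H t (u t)" for t
  obtain Cp where Cp: "Cp-lipschitz_on {0..T} p" using p by (auto simp: adjoint_arc_def)
  have Cp0: "Cp \<ge> 0" using Cp by (rule lipschitz_on_nonneg)
  obtain P where P: "\<forall>t\<in>{0..T}. norm (p t) \<le> P" "P \<ge> 0"
    using continuous_on_Icc_bounded[OF adjoint_arc_continuous[OF p]] .
  define C where "C = Cp * L + P * L * L"
  have C: "C \<ge> 0" using Cp0 P(2) L by (simp add: C_def)
  have H_lip: "H t v - H s v \<le> C * \<bar>t - s\<bar>" if st: "s \<in> {0..T}" "t \<in> {0..T}" and v: "v \<in> V" for s t v
  proof -
    have nv: "norm v \<le> M" using v by (simp add: V_def)
    have R: "norm (xb s) \<le> R + 1" "norm (xb t) \<le> R + 1" using xb_R[OF st(1)] xb_R[OF st(2)] by auto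
    have "H t v - H s v = (p t - p s) \<bullet> f (xb t, v) + p s \<bullet> (f (xb t, v) - f (xb s, v))"
      by (simp add: H_def inner_diff_left inner_diff_right)
    moreover have "\<bar>(p t - p s) \<bullet> f (xb t, v)\<bar> \<le> (Cp * \<bar>t - s\<bar>) * L"
      using lipschitz_onD[OF Cp st(2,1)] Cp0
      by (intro order.trans[OF Cauchy_Schwarz_ineq2] mult_mono f_bound[OF R(2) nv]) (auto simp: dist_norm)
    moreover have "norm (f (xb t, v) - f (xb s, v)) \<le> L * (L * \<bar>t - s\<bar>)"
    proof (rule order.trans[OF f_lip[OF R nv]])
      show "L * norm (xb t - xb s) \<le> L * (L * \<bar>t - s\<bar>)"
        using lipschitz_onD[OF xb_lipschitz st(2,1)] L by (intro mult_left_mono) (auto simp: dist_norm)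
    qed
    then have "\<bar>p s \<bullet> (f (xb t, v) - f (xb s, v))\<bar> \<le> P * (L * (L * \<bar>t - s\<bar>))"
      using P st by (intro order.trans[OF Cauchy_Schwarz_ineq2] mult_mono) auto
    moreover have "C * \<bar>t - s\<bar> = (Cp * \<bar>t - s\<bar>) * L + P * (L * (L * \<bar>t - s\<bar>))"
      by (simp add: C_def algebra_simps)
    ultimately show ?thesis by linarith
  qed
  \<comment> \<open>The minimizer at time \<open>s\<close> competes at time \<open>t\<close>, so the
    growth bound for a frozen control passes to the minimum.\<close>
  have m_le: "m t - m s \<le> C * \<bar>t - s\<bar>" if "s \<in> {0..T}" "t \<in> {0..T}" for s t
    using H_lip[OF that u(1)[of s]] u(2)[OF u(1)[of s], of t] by (simp add: m_def)
  have m_lip: "C-lipschitz_on {a..b} m"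
  proof (rule lipschitz_onI)
    fix s t assume "s \<in> {a..b}" "t \<in> {a..b}"
    then show "dist (m s) (m t) \<le> C * dist s t"
      using m_le[of s t] m_le[of t s] ab by (auto simp: dist_real_def abs_le_iff abs_minus_commute)
  qed (rule C)
  define good where "good t \<longleftrightarrow> (\<forall>u\<in>U. H t (ub t) \<le> H t u) \<and> (xb has_vector_derivative f (xb t, ub t)) (at t) \<and>
    (\<exists>q. (p has_vector_derivative q) (at t) \<and> (\<forall>h. q \<bullet> h = - (p t \<bullet> f' (xb t, ub t) (h, 0))))" for t
  have sub: "{a<..<b} \<subseteq> {0<..<T}" using ab by auto
  have "AE t in lebesgue_on {a<..<b}. (xb has_vector_derivative f (xb t, ub t)) (at t)"
    using xb_state by (intro AE_lebesgue_on_subset[OF _ sub]) (auto simp: is_state_def)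
  moreover have "AE t in lebesgue_on {a<..<b}. \<exists>q. (p has_vector_derivative q) (at t) \<and>
      (\<forall>h. q \<bullet> h = - (p t \<bullet> f' (xb t, ub t) (h, 0)))"
    using p by (intro AE_lebesgue_on_subset[OF _ sub]) (auto simp: adjoint_arc_def)
  ultimately have good: "AE t in lebesgue_on {a<..<b}. good t"
    using min by eventually_elim (auto simp: good_def H_def)
  have m_good: "m t = H t (ub t)" if "good t" "t \<in> {0..T}" for t
  proof (rule antisym)
    show "m t \<le> H t (ub t)" unfolding m_def by (rule u(2)[OF ubV[OF that(2)]])
    show "H t (ub t) \<le> m t" using that(1) u(1)[of t] by (auto simp: good_def m_def V_def)
  qed
  have "m t = m a" if t: "t \<in> {a..b}" for t
  proof (rule lipschitz_on_dini_nonpos_imp_const[OF m_lip])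
    show "negligible {t \<in> {a<..<b}. \<not> good t}" using good by (simp add: AE_lebesgue_on_iff_negligible)
    fix t e :: real assume t: "t \<in> {a<..<b} - {t \<in> {a<..<b}. \<not> good t}" and e: "e > 0"
    then have g: "good t" and tT: "t \<in> {0..T}" using ab by auto
    then obtain q where q: "(p has_vector_derivative q) (at t)" "\<forall>h. q \<bullet> h = - (p t \<bullet> f' (xb t, ub t) (h, 0))"
      and x: "(xb has_vector_derivative f (xb t, ub t)) (at t)" by (auto simp: good_def)
    have "((\<lambda>s. (xb s, ub t)) has_derivative (\<lambda>h. (h *\<^sub>R f (xb t, ub t), 0))) (at t)"
      using x unfolding has_vector_derivative_def by (intro has_derivative_Pair) auto
    from has_derivative_compose[OF this f']
    have "((\<lambda>s. f (xb s, ub t)) has_derivative (\<lambda>h. f' (xb t, ub t) (h *\<^sub>R f (xb t, ub t), 0))) (at t)" .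
    moreover have "f' (xb t, ub t) (h *\<^sub>R f (xb t, ub t), 0) = h *\<^sub>R f' (xb t, ub t) (f (xb t, ub t), 0)" for h
      using blinfun.scaleR_right[of "f' (xb t, ub t)" h "(f (xb t, ub t), 0)"] by simp
    ultimately have "((\<lambda>s. f (xb s, ub t)) has_vector_derivative f' (xb t, ub t) (f (xb t, ub t), 0)) (at t)"
      by (simp add: has_vector_derivative_def)
    \<comment> \<open>The contribution of the moving state and that of the adjoint equation
      cancel.\<close>
    from bounded_bilinear.has_vector_derivative[OF bounded_bilinear_inner q(1) this]
    have "((\<lambda>s. H s (ub t)) has_vector_derivative 0) (at t)"
      using q(2) by (simp add: H_def)
    then obtain d where d: "d > 0" "\<forall>s. norm (s - t) < d \<longrightarrow> norm (H s (ub t) - H t (ub t)) \<le> e * norm (s - t)"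
      using e unfolding has_vector_derivative_def has_derivative_at_alt by auto
    have "m s - m t \<le> e * \<bar>s - t\<bar>" if s: "\<bar>s - t\<bar> < d" "s \<in> {a..b}" for s
    proof -
      have "m s \<le> H s (ub t)" unfolding m_def by (rule u(2)[OF ubV[OF tT]])
      moreover have "\<bar>H s (ub t) - H t (ub t)\<bar> \<le> e * \<bar>s - t\<bar>" using d(2) s by auto
      ultimately show ?thesis using m_good[OF g tT] by linarith
    qed
    then show "\<exists>d>0. \<forall>s. \<bar>s - t\<bar> < d \<longrightarrow> s \<in> {a..b} \<longrightarrow> m s - m t \<le> e * \<bar>s - t\<bar>"
      using d(1) by (intro exI[of _ d]) simp
  qed (use t ab in auto)
  then have m_const: "m t = m a" if "t \<in> {a..b}" for t using that by blast
  have "AE t in lebesgue_on {a<..<b}. p t \<bullet> f (xb t, ub t) = m a"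
    using good AE_lebesgue_on_Ioo[of a b]
  proof eventually_elim
    case (elim t)
    then have "H t (ub t) = m t" using m_good[of t] ab by simp
    also have "\<dots> = m a" using elim by (intro m_const) auto
    finally show ?case by (simp add: H_def)
  qed
  then show thesis by (rule that)
qed

end

context crossing_trajectory
begin

lemma hamiltonian_before:
  assumes U: "closed U" and f': "\<And>z. (f has_derivative blinfun_apply (f' z)) (at z)"
    and p: "adjoint_arc f' T ub xb p"
    and min: "AE t in lebesgue_on {0<..<\<tau>}. \<forall>u\<in>U. p t \<bullet> f (xb t, ub t) \<le> p t \<bullet> f (xb t, u)"
  shows "AE t in lebesgue_on {0<..<\<tau>}. p t \<bullet> f (xb t, ub t) = p \<tau> \<bullet> f (xb \<tau>, um)"
proof -
  obtain h where h: "AE t in lebesgue_on {0<..<\<tau>}. p t \<bullet> f (xb t, ub t) = h"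
    by (rule hamiltonian_constant[OF U f' p _ _ _ min]) (use \<tau> in auto)
  have "(p \<longlongrightarrow> p \<tau>) (at \<tau>)"
    by (rule continuous_on_tendsto_crossing[OF adjoint_arc_continuous[OF p]])
  then have "(p \<longlongrightarrow> p \<tau>) (at_left \<tau>)" by (simp add: filterlim_at_split)
  moreover have "((\<lambda>r. f (xb r, ub r)) \<longlongrightarrow> f (xb \<tau>, um)) (at_left \<tau>)"
  proof (rule isCont_tendsto_compose[of "(xb \<tau>, um)" f])
    show "((\<lambda>r. (xb r, ub r)) \<longlongrightarrow> (xb \<tau>, um)) (at_left \<tau>)"
      using um_lim xb_tendsto by (intro tendsto_Pair) (auto simp: filterlim_at_split)
  qed (simp add: isCont_def f_tendsto)
  ultimately have "((\<lambda>t. p t \<bullet> f (xb t, ub t)) \<longlongrightarrow> p \<tau> \<bullet> f (xb \<tau>, um)) (at_left \<tau>)"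
    by (rule tendsto_inner)
  then show ?thesis using AE_eq_const_imp_limit_eq(1)[OF h \<tau>(1)] h by simp
qed

lemma hamiltonian_after:
  assumes U: "closed U" and f': "\<And>z. (f has_derivative blinfun_apply (f' z)) (at z)"
    and p: "adjoint_arc f' T ub xb p"
    and min: "AE t in lebesgue_on {\<tau><..<T}. \<forall>u\<in>U. p t \<bullet> f (xb t, ub t) \<le> p t \<bullet> f (xb t, u)"
  shows "AE t in lebesgue_on {\<tau><..<T}. p t \<bullet> f (xb t, ub t) = p \<tau> \<bullet> f (xb \<tau>, up)"
proof -
  obtain h where h: "AE t in lebesgue_on {\<tau><..<T}. p t \<bullet> f (xb t, ub t) = h"
    by (rule hamiltonian_constant[OF U f' p _ _ _ min]) (use \<tau> in auto)
  have "(p \<longlongrightarrow> p \<tau>) (at \<tau>)"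
    by (rule continuous_on_tendsto_crossing[OF adjoint_arc_continuous[OF p]])
  then have "(p \<longlongrightarrow> p \<tau>) (at_right \<tau>)" by (simp add: filterlim_at_split)
  moreover have "((\<lambda>r. f (xb r, ub r)) \<longlongrightarrow> f (xb \<tau>, up)) (at_right \<tau>)"
  proof (rule isCont_tendsto_compose[of "(xb \<tau>, up)" f])
    show "((\<lambda>r. (xb r, ub r)) \<longlongrightarrow> (xb \<tau>, up)) (at_right \<tau>)"
      using up_lim xb_tendsto by (intro tendsto_Pair) (auto simp: filterlim_at_split)
  qed (simp add: isCont_def f_tendsto)
  ultimately have "((\<lambda>t. p t \<bullet> f (xb t, ub t)) \<longlongrightarrow> p \<tau> \<bullet> f (xb \<tau>, up)) (at_right \<tau>)"
    by (rule tendsto_inner)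
  then show ?thesis using AE_eq_const_imp_limit_eq(2)[OF h \<tau>(2)] h by simp
qed

end

section \<open>Karush-Kuhn-Tucker multipliers\<close>

lemma in_span_image_finite:
  fixes G :: "'i \<Rightarrow> 'a::real_vector"
  assumes "finite B" "x \<in> span (G ` B)"
  obtains a where "x = (\<Sum>i\<in>B. a i *\<^sub>R G i)"
proof -
  define V where "V = {x. \<exists>a. x = (\<Sum>i\<in>B. a i *\<^sub>R G i)}"
  have "subspace V"
    unfolding subspace_def
  proof (intro conjI ballI allI)
    show "0 \<in> V" unfolding V_def by (auto intro!: exI[of _ "\<lambda>_. 0"])
    fix x assume "x \<in> V"
    then obtain a where a: "x = (\<Sum>i\<in>B. a i *\<^sub>R G i)" by (auto simp: V_def)
    show "k *\<^sub>R x \<in> V" for k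
      unfolding V_def a by (auto intro!: exI[of _ "\<lambda>i. k * a i"] simp: scaleR_sum_right)
    fix y assume "y \<in> V"
    then obtain b where b: "y = (\<Sum>i\<in>B. b i *\<^sub>R G i)" by (auto simp: V_def)
    show "x + y \<in> V"
      unfolding V_def a b by (auto intro!: exI[of _ "\<lambda>i. a i + b i"] simp: scaleR_add_left sum.distrib)
  qed
  moreover have "G ` B \<subseteq> V"
  proof
    fix y assume "y \<in> G ` B"
    then obtain j where j: "j \<in> B" "y = G j" by blast
    have "(\<Sum>i\<in>B. (if i = j then 1 else 0) *\<^sub>R G i) = (\<Sum>i\<in>B. if i = j then G i else 0)"
      by (intro sum.cong) auto
    also have "\<dots> = G j" using assms(1) j by (simp add: sum.delta)
    finally show "y \<in> V" unfolding V_def j(2) by (auto intro!: exI[of _ "\<lambda>i. if i = j then 1 else 0"])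
  qed
  ultimately have "span (G ` B) \<subseteq> V" by (intro span_minimal)
  then show thesis using assms(2) that by (auto simp: V_def)
qed

text \<open>The component of \<open>G j\<close> orthogonal to the span of the other vectors is
  nonzero by independence; normalizing it gives the dual vector.\<close>

lemma dual_vector_exists:
  fixes G :: "'i \<Rightarrow> 'a::euclidean_space"
  assumes "finite B" and indep: "\<And>\<xi>. (\<Sum>i\<in>B. \<xi> i *\<^sub>R G i) = 0 \<Longrightarrow> \<forall>i\<in>B. \<xi> i = 0" and j: "j \<in> B"
  shows "\<exists>d. G j \<bullet> d = 1 \<and> (\<forall>i\<in>B - {j}. G i \<bullet> d = 0)"
proof -
  obtain y z where yz: "y \<in> span (G ` (B - {j}))" "\<And>w. w \<in> span (G ` (B - {j})) \<Longrightarrow> orthogonal z w" "G j = y + z"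
    using orthogonal_subspace_decomp_exists[of "G ` (B - {j})" "G j"] by metis
  have "z \<noteq> 0"
  proof
    assume "z = 0"
    then have "G j \<in> span (G ` (B - {j}))" using yz by simp
    then obtain a where a: "G j = (\<Sum>i\<in>B - {j}. a i *\<^sub>R G i)"
      using in_span_image_finite[of "B - {j}"] assms(1) by (metis finite_Diff)
    define \<xi> where "\<xi> i = (if i = j then - 1 else a i)" for i
    have "(\<Sum>i\<in>B. \<xi> i *\<^sub>R G i) = \<xi> j *\<^sub>R G j + (\<Sum>i\<in>B - {j}. \<xi> i *\<^sub>R G i)"
      using assms(1) j by (simp add: sum.remove)
    also have "(\<Sum>i\<in>B - {j}. \<xi> i *\<^sub>R G i) = (\<Sum>i\<in>B - {j}. a i *\<^sub>R G i)"
      by (intro sum.cong) (auto simp: \<xi>_def)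
    finally have "(\<Sum>i\<in>B. \<xi> i *\<^sub>R G i) = 0" using a by (simp add: \<xi>_def)
    then have "\<xi> j = 0" using indep j by blast
    then show False by (simp add: \<xi>_def)
  qed
  define d where "d = (1 / (z \<bullet> z)) *\<^sub>R z"
  have "y \<bullet> z = 0" using yz(1,2) by (simp add: orthogonal_def inner_commute)
  then have "G j \<bullet> d = 1" using \<open>z \<noteq> 0\<close> by (simp add: d_def yz(3) inner_add_left)
  moreover have "G i \<bullet> d = 0" if "i \<in> B - {j}" for i
    using yz(2)[of "G i"] that by (simp add: d_def orthogonal_def inner_commute span_base)
  ultimately show ?thesis by blast
qed

text \<open>Directions that strictly decrease all active constraints stay feasible for small steps,
  so \<open>dh\<close> is nonnegative on them and, by a limit, on all directions \<open>v\<close>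
  with \<open>G i \<bullet> v \<le> 0\<close> for active \<open>i\<close>. The component of
  \<open>dh\<close> orthogonal to the active gradients then vanishes, and dual vectors read off the
  sign of each coefficient.\<close>

lemma kkt_multiplier_exists:
  fixes h :: "'u::euclidean_space \<Rightarrow> real" and c :: "'u \<Rightarrow> real ^ 'l" and G :: "'l \<Rightarrow> 'u"
  assumes h: "(h has_derivative (\<lambda>d. dh \<bullet> d)) (at u0)"
    and c: "\<And>i. ((\<lambda>u. c u $ i) has_derivative (\<lambda>d. G i \<bullet> d)) (at u0)"
    and feas: "\<And>i. c u0 $ i \<le> 0"
    and min: "\<And>u. (\<forall>i. c u $ i \<le> 0) \<Longrightarrow> h u0 \<le> h u"
    and indep: "\<And>\<xi>. (\<Sum>i\<in>{i. c u0 $ i = 0}. \<xi> i *\<^sub>R G i) = 0 \<Longrightarrow> \<forall>i\<in>{i. c u0 $ i = 0}. \<xi> i = 0"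
  shows "\<exists>\<mu> :: real ^ 'l. (\<forall>i. 0 \<le> \<mu> $ i) \<and> (\<forall>i. c u0 $ i \<noteq> 0 \<longrightarrow> \<mu> $ i = 0) \<and> dh + (\<Sum>i\<in>UNIV. \<mu> $ i *\<^sub>R G i) = 0"
proof -
  define B where "B = {i. c u0 $ i = 0}"
  have B: "finite B" by simp
  have deriv: "DERIV (\<lambda>s. F (u0 + s *\<^sub>R d)) 0 :> D \<bullet> d" if "(F has_derivative (\<lambda>d. D \<bullet> d)) (at u0)" for F :: "'u \<Rightarrow> real" and D d
  proof -
    have "((\<lambda>s. u0 + s *\<^sub>R d) has_derivative (\<lambda>s. s *\<^sub>R d)) (at 0)"
      by (auto intro!: derivative_eq_intros)
    from has_derivative_compose[OF this, of F "\<lambda>d. D \<bullet> d"] that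
    have "((\<lambda>s. F (u0 + s *\<^sub>R d)) has_derivative (\<lambda>s. s * (D \<bullet> d))) (at 0)" by simp
    then show ?thesis by (simp add: has_field_derivative_def mult_commute_abs)
  qed
  have strict: "0 \<le> dh \<bullet> d" if d: "\<forall>i\<in>B. G i \<bullet> d < 0" for d
  proof (rule ccontr)
    assume "\<not> 0 \<le> dh \<bullet> d"
    then obtain e where e: "e > 0" "\<forall>s>0. s < e \<longrightarrow> h (u0 + (0 + s) *\<^sub>R d) < h (u0 + 0 *\<^sub>R d)"
      using DERIV_neg_dec_right[OF deriv[OF h, of d]] by auto
    have "\<forall>\<^sub>F s in at_right 0. c (u0 + s *\<^sub>R d) $ i \<le> 0" for i
    proof (cases "i \<in> B")
      case True
      then obtain e where e: "e > 0" "\<forall>s>0. s < e \<longrightarrow> c (u0 + (0 + s) *\<^sub>R d) $ i < c (u0 + 0 *\<^sub>R d) $ i"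
        using DERIV_neg_dec_right[OF deriv[OF c[of i], of d]] d by blast
      have "\<forall>\<^sub>F s in at_right 0. s \<in> {0<..<e}" using e(1) by (rule eventually_at_right_real)
      then show ?thesis
        by eventually_elim (use e(2) True in \<open>auto simp: B_def intro: less_imp_le\<close>)
    next
      case False
      then have "c u0 $ i < 0" using feas[of i] by (simp add: B_def)
      moreover have "isCont (\<lambda>s. c (u0 + s *\<^sub>R d) $ i) 0" using DERIV_isCont[OF deriv[OF c[of i]]] .
      then have "((\<lambda>s. c (u0 + s *\<^sub>R d) $ i) \<longlongrightarrow> c u0 $ i) (at_right 0)"
        by (simp add: isCont_def filterlim_at_split)
      ultimately have "\<forall>\<^sub>F s in at_right 0. c (u0 + s *\<^sub>R d) $ i < 0" by (intro order_tendstoD(2))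
      then show ?thesis by eventually_elim simp
    qed
    then have "\<forall>\<^sub>F s in at_right 0. \<forall>i. c (u0 + s *\<^sub>R d) $ i \<le> 0" by (rule eventually_all_finite)
    moreover have "\<forall>\<^sub>F s in at_right 0. s \<in> {0<..<e}" using e(1) by (rule eventually_at_right_real)
    ultimately have "\<forall>\<^sub>F s in at_right (0::real). False"
    proof eventually_elim
      case (elim s)
      then have "h u0 \<le> h (u0 + s *\<^sub>R d)" by (intro min)
      moreover have "h (u0 + s *\<^sub>R d) < h u0" using e(2) elim(2) by auto
      ultimately show False by simp
    qed
    then show False by simp
  qed
  have "\<forall>j\<in>B. \<exists>d. G j \<bullet> d = 1 \<and> (\<forall>i\<in>B - {j}. G i \<bullet> d = 0)"
    using dual_vector_exists[OF B indep[folded B_def]] by blast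
  from bchoice[OF this] obtain d where d: "\<forall>j\<in>B. G j \<bullet> d j = 1 \<and> (\<forall>i\<in>B - {j}. G i \<bullet> d j = 0)" by blast
  have Gd: "G i \<bullet> d j = (if i = j then 1 else 0)" if "i \<in> B" "j \<in> B" for i j using d that by auto
  \<comment> \<open>The negative sum of the dual vectors decreases every active constraint at unit
    rate, so adding a small multiple of it makes a nonstrict direction strict.\<close>
  define e where "e = - (\<Sum>j\<in>B. d j)"
  have Ge: "G i \<bullet> e = - 1" if "i \<in> B" for i
  proof -
    have "G i \<bullet> e = - (\<Sum>j\<in>B. G i \<bullet> d j)" by (simp add: e_def inner_sum_right)
    also have "(\<Sum>j\<in>B. G i \<bullet> d j) = (\<Sum>j\<in>B. if j = i then 1 else 0)"
      using Gd[OF that] by (intro sum.cong) auto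
    also have "\<dots> = 1" using that B by simp
    finally show ?thesis .
  qed
  have nonstrict: "0 \<le> dh \<bullet> v" if v: "\<forall>i\<in>B. G i \<bullet> v \<le> 0" for v
  proof -
    have "((\<lambda>s. dh \<bullet> v + s * (dh \<bullet> e)) \<longlongrightarrow> dh \<bullet> v + 0 * (dh \<bullet> e)) (at_right 0)"
      by (intro tendsto_intros)
    moreover have "\<forall>\<^sub>F s in at_right 0. 0 \<le> dh \<bullet> v + s * (dh \<bullet> e)"
      using eventually_at_right_pos
    proof eventually_elim
      case (elim s)
      have "\<forall>i\<in>B. G i \<bullet> (v + s *\<^sub>R e) < 0"
        using v Ge elim by (auto simp: inner_add_right intro: add_nonpos_neg)
      then have "0 \<le> dh \<bullet> (v + s *\<^sub>R e)" by (rule strict)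
      then show ?case by (simp add: inner_add_right)
    qed
    ultimately have "0 \<le> dh \<bullet> v + 0 * (dh \<bullet> e)" by (rule tendsto_lowerbound) simp
    then show ?thesis by simp
  qed
  obtain y z where yz: "y \<in> span (G ` B)" "\<And>w. w \<in> span (G ` B) \<Longrightarrow> orthogonal z w" "dh = y + z"
    using orthogonal_subspace_decomp_exists[of "G ` B" dh] by metis
  have "G i \<bullet> - z = 0" if "i \<in> B" for i
    using yz(2)[of "G i"] that by (simp add: orthogonal_def inner_commute span_base)
  then have "0 \<le> dh \<bullet> - z" by (intro nonstrict) auto
  moreover have "dh \<bullet> z = z \<bullet> z"
    using yz(2)[OF yz(1)] unfolding yz(3) orthogonal_def inner_add_left by (simp add: inner_commute[of y z])
  ultimately have "z = 0" by (metis inner_eq_zero_iff inner_ge_zero inner_minus_right neg_0_le_iff_le order.antisym)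
  then obtain a where a: "dh = (\<Sum>i\<in>B. a i *\<^sub>R G i)"
    using in_span_image_finite[OF B, of dh G] yz by auto
  have a_le: "a j \<le> 0" if j: "j \<in> B" for j
  proof -
    have "0 \<le> dh \<bullet> - d j"
      using Gd j by (intro nonstrict) auto
    also have "dh \<bullet> - d j = - (\<Sum>i\<in>B. a i * (G i \<bullet> d j))" by (simp add: a inner_sum_left)
    also have "(\<Sum>i\<in>B. a i * (G i \<bullet> d j)) = (\<Sum>i\<in>B. if i = j then a i else 0)"
      using Gd j by (intro sum.cong) auto
    also have "\<dots> = a j" using j B by simp
    finally show ?thesis by simp
  qed
  define \<mu> :: "real ^ 'l" where "\<mu> = (\<chi> i. if i \<in> B then - a i else 0)"
  have "(\<Sum>i\<in>UNIV. \<mu> $ i *\<^sub>R G i) = (\<Sum>i\<in>B. (- a i) *\<^sub>R G i)"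
    by (rule sum.mono_neutral_cong_right) (auto simp: \<mu>_def)
  then have "dh + (\<Sum>i\<in>UNIV. \<mu> $ i *\<^sub>R G i) = 0" by (simp add: a sum_negf)
  moreover have "\<forall>i. 0 \<le> \<mu> $ i" using a_le by (simp add: \<mu>_def)
  moreover have "\<forall>i. c u0 $ i \<noteq> 0 \<longrightarrow> \<mu> $ i = 0" by (simp add: \<mu>_def B_def)
  ultimately show ?thesis by blast
qed

text \<open>The multiplier solves a linear system whose matrix is the Gram matrix of the gradients of the
  nearly active constraints, completed by the identity; Cramer's rule exhibits it as a measurable
  function of time.\<close>

lemma measurable_multiplier:
  fixes G :: "real \<Rightarrow> 'l::finite \<Rightarrow> 'u::euclidean_space" and dH :: "real \<Rightarrow> 'u" and I :: "real \<Rightarrow> 'l set"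
  assumes meas: "\<And>i. (\<lambda>t. G t i) \<in> borel_measurable N" "dH \<in> borel_measurable N"
    "\<And>i. {t \<in> space N. i \<in> I t} \<in> sets N"
  obtains \<nu> :: "real \<Rightarrow> real ^ 'l" where "\<nu> \<in> borel_measurable N"
    "\<And>t \<mu> \<epsilon>. \<epsilon> > 0 \<Longrightarrow> \<forall>\<xi> :: real ^ 'l. (\<forall>i. i \<notin> I t \<longrightarrow> \<xi> $ i = 0) \<longrightarrow> \<epsilon> * norm \<xi> \<le> norm (\<Sum>i\<in>UNIV. \<xi> $ i *\<^sub>R G t i) \<Longrightarrow>
      (\<forall>i. i \<notin> I t \<longrightarrow> \<mu> $ i = 0) \<Longrightarrow> dH t + (\<Sum>i\<in>UNIV. \<mu> $ i *\<^sub>R G t i) = 0 \<Longrightarrow> \<nu> t = \<mu>"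
proof -
  \<comment> \<open>Outside \<open>I t\<close> the rows and columns are those of the identity, so
    the matrix keeps a fixed size although the index set varies with time.\<close>
  define A :: "real \<Rightarrow> real ^ 'l ^ 'l" where
    "A t = (\<chi> i j. if i \<in> I t then if j \<in> I t then G t i \<bullet> G t j else 0 else if i = j then 1 else 0)" for t
  define b :: "real \<Rightarrow> real ^ 'l" where "b t = (\<chi> i. if i \<in> I t then - (G t i \<bullet> dH t) else 0)" for t
  \<comment> \<open>Where the determinant vanishes, division by zero makes the value zero, so the
    formula is total and measurable.\<close>
  define \<nu> :: "real \<Rightarrow> real ^ 'l" where
    "\<nu> t = (\<chi> k. det (\<chi> i j. if j = k then b t $ i else A t $ i $ j) / det (A t))" for t
  have [measurable]: "(\<lambda>t. G t i) \<in> borel_measurable N" "Measurable.pred N (\<lambda>t. i \<in> I t)" for i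
    using meas(1,3) by (auto simp: pred_def)
  have [measurable]: "dH \<in> borel_measurable N" by (rule meas(2))
  have [measurable]: "(\<lambda>t. A t $ i $ j) \<in> borel_measurable N" for i j
    unfolding A_def by (cases "i = j") simp_all
  have [measurable]: "(\<lambda>t. b t $ i) \<in> borel_measurable N" for i
    unfolding b_def by simp
  have det_meas: "(\<lambda>t. det (B t)) \<in> borel_measurable N" if [measurable]: "\<And>i j. (\<lambda>t. B t $ i $ j) \<in> borel_measurable N"
    for B :: "real \<Rightarrow> real ^ 'l ^ 'l"
    unfolding det_def by measurable
  have comp: "(\<lambda>t. \<nu> t $ k) \<in> borel_measurable N" for k
  proof -
    have "(\<lambda>t. det (\<chi> i j. if j = k then b t $ i else A t $ i $ j)) \<in> borel_measurable N"
    proof (rule det_meas)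
      fix i j
      show "(\<lambda>t. (\<chi> i j. if j = k then b t $ i else A t $ i $ j) $ i $ j) \<in> borel_measurable N"
        by (cases "j = k") simp_all
    qed
    moreover have "(\<lambda>t. det (A t)) \<in> borel_measurable N" by (rule det_meas) simp
    ultimately show ?thesis unfolding \<nu>_def by simp
  qed
  have \<nu>_meas: "\<nu> \<in> borel_measurable N"
  proof (rule borel_measurable_euclidean_space[THEN iffD2], rule ballI)
    fix i :: "real ^ 'l" assume "i \<in> Basis"
    then obtain k where "i = axis k 1" by (auto simp: Basis_vec_def)
    then show "(\<lambda>t. \<nu> t \<bullet> i) \<in> borel_measurable N" using comp[of k] by (simp add: inner_axis)
  qed
  have \<nu>_eq: "\<nu> t = \<mu>"
    if e: "\<epsilon> > 0" and cq: "\<forall>\<xi> :: real ^ 'l. (\<forall>i. i \<notin> I t \<longrightarrow> \<xi> $ i = 0) \<longrightarrow> \<epsilon> * norm \<xi> \<le> norm (\<Sum>i\<in>UNIV. \<xi> $ i *\<^sub>R G t i)"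
      and \<mu>: "\<forall>i. i \<notin> I t \<longrightarrow> \<mu> $ i = 0" "dH t + (\<Sum>i\<in>UNIV. \<mu> $ i *\<^sub>R G t i) = 0" for t \<mu> \<epsilon>
  proof -
    have row1: "(A t *v \<xi>) $ i = G t i \<bullet> (\<Sum>j\<in>UNIV. \<xi> $ j *\<^sub>R G t j)"
      if "i \<in> I t" "\<forall>i. i \<notin> I t \<longrightarrow> \<xi> $ i = 0" for \<xi> i
    proof -
      have "(A t *v \<xi>) $ i = (\<Sum>j\<in>UNIV. A t $ i $ j * \<xi> $ j)" by (simp add: matrix_vector_mult_def)
      also have "\<dots> = (\<Sum>j\<in>UNIV. \<xi> $ j * (G t i \<bullet> G t j))"
        using that by (intro sum.cong) (auto simp: A_def)
      also have "\<dots> = G t i \<bullet> (\<Sum>j\<in>UNIV. \<xi> $ j *\<^sub>R G t j)" by (simp add: inner_sum_right)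
      finally show ?thesis .
    qed
    have row2: "(A t *v \<xi>) $ i = \<xi> $ i" if "i \<notin> I t" for \<xi> i
    proof -
      have "(A t *v \<xi>) $ i = (\<Sum>j\<in>UNIV. A t $ i $ j * \<xi> $ j)" by (simp add: matrix_vector_mult_def)
      also have "\<dots> = (\<Sum>j\<in>UNIV. if j = i then \<xi> $ j else 0)"
        using that by (intro sum.cong) (auto simp: A_def)
      finally show ?thesis by simp
    qed
    \<comment> \<open>A kernel vector yields a combination \<open>w\<close> of gradients that is
      orthogonal to itself, and the qualification bound then forces the vector to be zero.\<close>
    have "\<xi> = 0" if "A t *v \<xi> = 0" for \<xi>
    proof -
      have off: "\<forall>i. i \<notin> I t \<longrightarrow> \<xi> $ i = 0" using row2[of _ \<xi>] that by simp
      define w where "w = (\<Sum>j\<in>UNIV. \<xi> $ j *\<^sub>R G t j)"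
      have z: "\<xi> $ i * (G t i \<bullet> w) = 0" for i
        using row1[of i \<xi>] off that by (cases "i \<in> I t") (auto simp: w_def)
      have "w \<bullet> w = (\<Sum>i\<in>UNIV. \<xi> $ i * (G t i \<bullet> w))"
        by (subst (1) w_def) (simp add: inner_sum_left)
      also have "\<dots> = 0" by (rule sum.neutral) (use z in blast)
      finally have "w = 0" by simp
      then have "\<epsilon> * norm \<xi> \<le> 0" using cq off unfolding w_def by force
      then show ?thesis using e by (simp add: mult_le_0_iff)
    qed
    then have "det (A t) \<noteq> 0"
      by (metis invertible_det_nz invertible_left_inverse matrix_left_invertible_ker)
    moreover have "A t *v \<mu> = b t"
    proof (rule vec_eq_iff[THEN iffD2], intro allI)
      fix i
      have s: "(\<Sum>j\<in>UNIV. \<mu> $ j *\<^sub>R G t j) = - dH t" using \<mu>(2) by (simp add: eq_neg_iff_add_eq_0 add.commute)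
      show "(A t *v \<mu>) $ i = b t $ i"
      proof (cases "i \<in> I t")
        case True
        then show ?thesis using row1[OF True \<mu>(1)] by (simp add: s b_def)
      next
        case False
        then show ?thesis using row2[OF False, of \<mu>] \<mu>(1) by (simp add: b_def)
      qed
    qed
    ultimately have "\<mu> = (\<chi> k. det (\<chi> i j. if j = k then b t $ i else A t $ i $ j) / det (A t))"
      using cramer by blast
    then show ?thesis by (simp add: \<nu>_def)
  qed
  show thesis by (rule that[OF \<nu>_meas \<nu>_eq])
qed

text \<open>The mean value inequality on a small ball is applied to \<open>g\<close> minus its
  linear part at \<open>z\<close>, whose derivative is small there by continuity of the derivative
  of \<open>g\<close>.\<close>

lemma C1_strictly_differentiable:
  fixes g :: "'x::euclidean_space \<Rightarrow> real"
  assumes "class_C1 g" "\<sigma> > 0"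
  shows "\<exists>\<delta>>0. \<forall>x y. norm (x - z) < \<delta> \<longrightarrow> norm (y - z) < \<delta> \<longrightarrow>
    \<bar>g x - g y - gradient g z \<bullet> (x - y)\<bar> \<le> \<sigma> * norm (x - y)"
proof -
  obtain g' where g': "\<And>x. (g has_derivative blinfun_apply (g' x)) (at x)" "continuous_on UNIV g'"
    using assms(1) unfolding class_C1_def by blast
  have grad: "gradient g z \<bullet> h = g' z h" for h by (rule has_derivative_gradient(2)[OF g'(1)])
  obtain \<delta> where \<delta>: "\<delta> > 0" "\<forall>x. dist x z < \<delta> \<longrightarrow> dist (g' x) (g' z) < \<sigma>"
    using g'(2) assms(2) unfolding continuous_on_iff by (metis UNIV_I)
  have "\<bar>g x - g y - gradient g z \<bullet> (x - y)\<bar> \<le> \<sigma> * norm (x - y)" if "norm (x - z) < \<delta>" "norm (y - z) < \<delta>" for x y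
  proof -
    define k where "k v = g v - g' z v" for v
    have "norm (k x - k y) \<le> \<sigma> * norm (x - y)"
    proof (rule differentiable_bound[of "ball z \<delta>" k "\<lambda>v. blinfun_apply (g' v - g' z)"])
      fix v assume "v \<in> ball z \<delta>"
      then have "dist (g' v) (g' z) < \<sigma>" using \<delta>(2) by (simp add: dist_commute)
      then show "onorm (blinfun_apply (g' v - g' z)) \<le> \<sigma>"
        by (simp add: dist_norm norm_blinfun.rep_eq[symmetric])
      have "(k has_derivative (\<lambda>h. g' v h - g' z h)) (at v)"
        unfolding k_def by (intro has_derivative_diff g'(1) bounded_linear_imp_has_derivative blinfun.bounded_linear_right)
      moreover have "blinfun_apply (g' v - g' z) = (\<lambda>h. g' v h - g' z h)"
        by (auto simp: blinfun.diff_left)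
      ultimately show "(k has_derivative blinfun_apply (g' v - g' z)) (at v within ball z \<delta>)"
        by (simp add: has_derivative_at_withinI)
    qed (use that in \<open>auto simp: dist_norm norm_minus_commute\<close>)
    moreover have "k x - k y = g x - g y - gradient g z \<bullet> (x - y)"
      by (simp add: k_def grad blinfun.diff_right)
    ultimately show ?thesis by simp
  qed
  then show ?thesis using \<delta>(1) by blast
qed

lemma gradient_component:
  fixes c :: "'u::euclidean_space \<Rightarrow> real ^ 'l"
  assumes "(c has_derivative blinfun_apply c') (at u)"
  shows "((\<lambda>u. c u $ i) has_derivative (\<lambda>d. gradient (\<lambda>u. c u $ i) u \<bullet> d)) (at u)"
    and "gradient (\<lambda>u. c u $ i) u \<bullet> d = c' d $ i"
proof -
  have "((\<lambda>u. c u $ i) has_derivative (\<lambda>d. c' d $ i)) (at u)"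
    using assms by (rule bounded_linear.has_derivative[OF bounded_linear_vec_nth])
  from has_derivative_gradient[OF this]
  show "((\<lambda>u. c u $ i) has_derivative (\<lambda>d. gradient (\<lambda>u. c u $ i) u \<bullet> d)) (at u)"
    "gradient (\<lambda>u. c u $ i) u \<bullet> d = c' d $ i" by auto
qed

lemma gradient_Ham_aug:
  fixes f :: "'x::euclidean_space \<times> 'u::euclidean_space \<Rightarrow> 'x" and c :: "'u \<Rightarrow> real ^ 'l"
  assumes f': "(f has_derivative blinfun_apply (f' (x, u))) (at (x, u))"
    and c': "(c has_derivative blinfun_apply c') (at u)"
  shows "gradient (\<lambda>u. Ham_aug f c x p u \<nu>) u
    = gradient (\<lambda>v. p \<bullet> f (x, v)) u + (\<Sum>i\<in>UNIV. \<nu> $ i *\<^sub>R gradient (\<lambda>u. c u $ i) u)"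
proof -
  note 1 = Ham_gradient_inner(2)[where f = f and f' = f' and x = x and u = u and p = p, OF f']
  have 2: "((\<lambda>u. \<nu> \<bullet> c u) has_derivative (\<lambda>h. \<nu> \<bullet> c' h)) (at u)"
    using c' by (rule has_derivative_inner_right)
  have "gradient (\<lambda>u. Ham_aug f c x p u \<nu>) u \<bullet> h
      = (gradient (\<lambda>v. p \<bullet> f (x, v)) u + (\<Sum>i\<in>UNIV. \<nu> $ i *\<^sub>R gradient (\<lambda>u. c u $ i) u)) \<bullet> h" for h
  proof -
    have "gradient (\<lambda>u. Ham_aug f c x p u \<nu>) u \<bullet> h = p \<bullet> f' (x, u) (0, h) + \<nu> \<bullet> c' h"
      unfolding Ham_aug_def by (rule has_derivative_gradient(2)[OF has_derivative_add[OF 1 2]])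
    then show ?thesis
      by (simp add: inner_add_left inner_sum_left has_derivative_gradient(2)[OF 1] gradient_component(2)[OF c']
          inner_vec_def)
  qed
  then show ?thesis using vector_eq_rdot by blast
qed

text \<open>The weight \<open>rho\<close> has total mass one on the first interval and minus one on
  the second, so constant values on the two sides leave their difference.\<close>

lemma set_lebesgue_integral_step:
  fixes F :: "real \<Rightarrow> real"
  assumes \<tau>: "0 < \<tau>" "\<tau> < T"
    and h1: "AE t in lebesgue_on {0<..<\<tau>}. F t = h1" and h2: "AE t in lebesgue_on {\<tau><..<T}. F t = h2"
  shows "(LINT t:{0..T}|lebesgue. rho T \<tau> t * F t) = h1 - h2"
proof -
  define N where "N = {t \<in> {0<..<\<tau>}. F t \<noteq> h1} \<union> {t \<in> {\<tau><..<T}. F t \<noteq> h2} \<union> {0, \<tau>, T}"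
  have N: "negligible N" using h1 h2 by (simp add: N_def AE_lebesgue_on_iff_negligible negligible_Un)
  define s where "s t = (if t \<in> {0..\<tau>} then h1 / \<tau> else - h2 / (T - \<tau>))" for t
  have 1: "(s has_integral (h1 / \<tau> * \<tau>)) {0..\<tau>}"
  proof (rule has_integral_eq)
    show "((\<lambda>_. h1 / \<tau>) has_integral (h1 / \<tau> * \<tau>)) {0..\<tau>}"
      using has_integral_const_real[of "h1 / \<tau>" 0 \<tau>] \<tau> by simp
  qed (simp add: s_def)
  have 2: "(s has_integral (- h2 / (T - \<tau>) * (T - \<tau>))) {\<tau>..T}"
  proof (rule has_integral_spike_finite[of "{\<tau>}"])
    show "((\<lambda>_. - h2 / (T - \<tau>)) has_integral (- h2 / (T - \<tau>) * (T - \<tau>))) {\<tau>..T}"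
      using has_integral_const_real[of "- h2 / (T - \<tau>)" \<tau> T] \<tau> by (simp add: mult.commute)
  qed (auto simp: s_def)
  have s: "(s has_integral (h1 - h2)) {0..T}"
    using has_integral_combine[OF _ _ 1 2] \<tau> by simp
  \<comment> \<open>Absolute integrability identifies the Lebesgue integral with the gauge integral;
    the bounded step function has it, and it survives changes on null sets.\<close>
  have s_abs: "s absolutely_integrable_on {0..T}"
  proof (rule absolutely_integrable_integrable_bound[where g = "\<lambda>_. \<bar>h1 / \<tau>\<bar> + \<bar>h2 / (T - \<tau>)\<bar>"])
    show "s integrable_on {0..T}" using s by blast
  qed (auto simp: s_def)
  have F_eq: "rho T \<tau> t * F t = s t" if "t \<in> {0..T} - N" for t
    using that by (cases "t < \<tau>") (auto simp: N_def rho_def s_def)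
  have "(\<lambda>t. rho T \<tau> t * F t) absolutely_integrable_on {0..T}"
    by (rule absolutely_integrable_spike[OF s_abs N F_eq])
  then have "(LINT t:{0..T}|lebesgue. rho T \<tau> t * F t) = integral {0..T} (\<lambda>t. rho T \<tau> t * F t)"
    by (rule set_lebesgue_integral_eq_integral(2))
  also have "\<dots> = h1 - h2"
    by (rule integral_unique[OF has_integral_spike[OF N F_eq s]])
  finally show ?thesis .
qed

section \<open>Costates with a jump at the crossing time\<close>

lemma AE_split_at:
  fixes \<tau> :: real
  assumes "AE t in lebesgue_on {a<..<\<tau>}. Q t" "AE t in lebesgue_on {\<tau><..<b}. Q t"
  shows "AE t in lebesgue_on {a<..<b}. Q t"
proof -
  have "negligible ({t \<in> {a<..<\<tau>}. \<not> Q t} \<union> {t \<in> {\<tau><..<b}. \<not> Q t} \<union> {\<tau>})"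
    using assms by (simp add: AE_lebesgue_on_iff_negligible negligible_Un)
  then have "negligible {t \<in> {a<..<b}. \<not> Q t}"
    by (rule negligible_subset) auto
  then show ?thesis by (simp add: AE_lebesgue_on_iff_negligible)
qed

context crossing_trajectory
begin

text \<open>This is uniqueness for the linear adjoint equation. After \<tau> the comparison starts
  at \<open>T\<close>, where the final condition makes the difference vanish. Before \<tau> it
  starts at times tending to \<tau>, where the jump condition and the known right limit determine
  the left limit. Here \<open>ub0\<close> is the given control and \<open>ub\<close> a bounded
  representative of it.\<close>

lemma costate_eq:
  assumes f': "\<And>z. (f has_derivative blinfun_apply (f' z)) (at z)"
    and eq: "AE t in lebesgue_on {0<..<T}. ub0 t = ub t"
    and P: "adjoint_arc f' T ub xb P" "P T = gradient \<phi> (xb T)"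
    and Q: "adjoint_arc f' T ub xb Q" "Q \<tau> = gradient g (xb \<tau>)"
    and p: "is_costate f \<phi> g T ub0 xb \<tau> \<alpha> \<gamma> p"
  shows "t \<in> {0..<\<tau>} \<Longrightarrow> p t = \<alpha> *\<^sub>R P t - \<gamma> *\<^sub>R Q t" and "t \<in> {\<tau><..T} \<Longrightarrow> p t = \<alpha> *\<^sub>R P t"
proof -
  have pder: "AE t in lebesgue_on {0<..<T}. (p has_vector_derivative - gradient (\<lambda>x. Ham f x (p t) (ub t)) (xb t)) (at t)"
    using p eq unfolding is_costate_def by (auto elim: eventually_elim2)
  obtain pm pp where pm: "(p \<longlongrightarrow> pm) (at_left \<tau>)" and pp: "(p \<longlongrightarrow> pp) (at_right \<tau>)"
    and jump: "pp - pm = \<gamma> *\<^sub>R gradient g (xb \<tau>)" using p unfolding is_costate_def by blast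
  have key: "norm (p t - S t) \<le> 2 * norm (p s - S s) * exp (2 * L * T)"
    if S: "adjoint_arc f' T ub xb S" and ac: "abs_continuous_on {a..b} p" and ab: "0 \<le> a" "b \<le> T"
      and st: "s \<in> {a..b}" "t \<in> {a..b}" for S a b s t
  proof -
    obtain C where "C-lipschitz_on {0..T} S" using S by (auto simp: adjoint_arc_def)
    then have "C-lipschitz_on {a..b} S" by (rule lipschitz_on_subset) (use ab in auto)
    then have acd: "abs_continuous_on {a..b} (\<lambda>t. p t - S t)"
      by (intro abs_continuous_on_diff ac lipschitz_on_imp_abs_continuous_on)
    define H where "H t = (SOME q. (S has_vector_derivative q) (at t) \<and> (\<forall>h. q \<bullet> h = - (S t \<bullet> f' (xb t, ub t) (h, 0))))" for t
    have "AE t in lebesgue_on {0<..<T}. \<exists>q. (S has_vector_derivative q) (at t) \<and> (\<forall>h. q \<bullet> h = - (S t \<bullet> f' (xb t, ub t) (h, 0)))"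
      using S by (simp add: adjoint_arc_def)
    then have "AE t in lebesgue_on {0<..<T}. (p has_vector_derivative - gradient (\<lambda>x. Ham f x (p t) (ub t)) (xb t)) (at t) \<and>
      (S has_vector_derivative H t) (at t) \<and>
      norm (- gradient (\<lambda>x. Ham f x (p t) (ub t)) (xb t) - H t) \<le> L * norm (p t - S t)"
      using pder AE_lebesgue_on_Ioo[of 0 T]
    proof eventually_elim
      case (elim t)
      have H: "(S has_vector_derivative H t) (at t) \<and> (\<forall>h. H t \<bullet> h = - (S t \<bullet> f' (xb t, ub t) (h, 0)))"
        unfolding H_def by (rule someI_ex[OF elim(1)])
      have "(- gradient (\<lambda>x. Ham f x (p t) (ub t)) (xb t) - H t) \<bullet> h = - ((p t - S t) \<bullet> f' (xb t, ub t) (h, 0))" for h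
        using H Ham_gradient_inner(1)[where f = f and f' = f' and x = "xb t" and u = "ub t" and p = "p t" and h = h, OF f'] by (simp add: inner_diff_left)
      then have "norm (- gradient (\<lambda>x. Ham f x (p t) (ub t)) (xb t) - H t) \<le> L * norm (p t - S t)"
        by (rule norm_le_adjoint) (use elim(3) in auto)
      then show ?case using elim(2) H by blast
    qed
    then have "AE t in lebesgue_on {a<..<b}. (p has_vector_derivative - gradient (\<lambda>x. Ham f x (p t) (ub t)) (xb t)) (at t) \<and>
      (S has_vector_derivative H t) (at t) \<and>
      norm (- gradient (\<lambda>x. Ham f x (p t) (ub t)) (xb t) - H t) \<le> L * norm (p t - S t)"
      by (rule AE_lebesgue_on_subset) (use ab in auto)
    from abs_continuous_adjoint_difference_zero[OF acd this L st]
    have "norm (p t - S t) \<le> 2 * norm (p s - S s) * exp (2 * L * (b - a))" .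
    also have "\<dots> \<le> 2 * norm (p s - S s) * exp (2 * L * T)"
      using ab L by (intro mult_left_mono) auto
    finally show ?thesis .
  qed
  define S1 where "S1 t = \<alpha> *\<^sub>R P t - \<gamma> *\<^sub>R Q t" for t
  \<comment> \<open>The vanishing second term lets the lemma on linear combinations cover this arc
    as well.\<close>
  define S2 where "S2 t = \<alpha> *\<^sub>R P t - 0 *\<^sub>R Q t" for t
  have S: "adjoint_arc f' T ub xb S1" "adjoint_arc f' T ub xb S2"
    unfolding S1_def S2_def by (intro adjoint_arc_scaleR_diff P(1) Q(1))+
  have lim: "(S \<longlongrightarrow> S \<tau>) (at \<tau>)" if "adjoint_arc f' T ub xb S" for S
    by (rule continuous_on_tendsto_crossing[OF adjoint_arc_continuous[OF that]])
  have after: "p t = \<alpha> *\<^sub>R P t" if t: "t \<in> {\<tau><..T}" for t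
  proof -
    have "norm (p t - S2 t) \<le> 2 * norm (p T - S2 T) * exp (2 * L * T)"
      using p t \<tau> by (intro key[OF S(2), of t T]) (auto simp: is_costate_def intro: abs_continuous_on_subset)
    also have "\<dots> = 0" using p P(2) by (simp add: is_costate_def S2_def)
    finally show ?thesis by (simp add: S2_def)
  qed
  then show "t \<in> {\<tau><..T} \<Longrightarrow> p t = \<alpha> *\<^sub>R P t" .
  have "(p \<longlongrightarrow> \<alpha> *\<^sub>R P \<tau>) (at_right \<tau>)"
  proof (rule Lim_transform_eventually)
    have "(P \<longlongrightarrow> P \<tau>) (at_right \<tau>)" using lim[OF P(1)] by (simp add: filterlim_at_split)
    then show "((\<lambda>t. \<alpha> *\<^sub>R P t) \<longlongrightarrow> \<alpha> *\<^sub>R P \<tau>) (at_right \<tau>)" by (intro tendsto_intros)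
    have "\<forall>\<^sub>F t in at_right \<tau>. t \<in> {\<tau><..<T}" using \<tau>(2) by (rule eventually_at_right_real)
    then show "\<forall>\<^sub>F t in at_right \<tau>. \<alpha> *\<^sub>R P t = p t" by eventually_elim (use after in simp)
  qed
  then have "pp = \<alpha> *\<^sub>R P \<tau>" using pp by (intro tendsto_unique[of "at_right \<tau>"]) auto
  then have pm_eq: "pm = S1 \<tau>" using jump Q(2) by (simp add: S1_def algebra_simps)
  have before: "p t = S1 t" if t: "t \<in> {0..<\<tau>}" for t
  proof -
    have "((\<lambda>s. 2 * norm (p s - S1 s) * exp (2 * L * T)) \<longlongrightarrow> 2 * norm (pm - S1 \<tau>) * exp (2 * L * T)) (at_left \<tau>)"
      using pm lim[OF S(1)] by (intro tendsto_intros) (auto simp: filterlim_at_split)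
    moreover have "\<forall>\<^sub>F s in at_left \<tau>. s \<in> {t<..<\<tau>}" using t by (intro eventually_at_left_real) auto
    then have "\<forall>\<^sub>F s in at_left \<tau>. norm (p t - S1 t) \<le> 2 * norm (p s - S1 s) * exp (2 * L * T)"
    proof eventually_elim
      case (elim s)
      show ?case using p t elim \<tau>
        by (intro key[OF S(1), of 0 s]) (auto simp: is_costate_def intro: abs_continuous_on_subset)
    qed
    ultimately have "norm (p t - S1 t) \<le> 2 * norm (pm - S1 \<tau>) * exp (2 * L * T)"
      by (rule tendsto_lowerbound) simp
    then show ?thesis by (simp add: pm_eq)
  qed
  then show "t \<in> {0..<\<tau>} \<Longrightarrow> p t = \<alpha> *\<^sub>R P t - \<gamma> *\<^sub>R Q t" by (simp add: S1_def)
qed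

lemma costate_exists:
  assumes f': "\<And>z. (f has_derivative blinfun_apply (f' z)) (at z)"
    and eq: "AE t in lebesgue_on {0<..<T}. ub0 t = ub t"
    and P: "adjoint_arc f' T ub xb P" "P T = gradient \<phi> (xb T)"
    and Q: "adjoint_arc f' T ub xb Q" "Q \<tau> = gradient g (xb \<tau>)"
  shows "is_costate f \<phi> g T ub0 xb \<tau> 1 \<gamma> (\<lambda>t. if t < \<tau> then P t - \<gamma> *\<^sub>R Q t else P t)" (is "is_costate _ _ _ _ _ _ _ _ _ ?p")
proof -
  define S where "S t = 1 *\<^sub>R P t - \<gamma> *\<^sub>R Q t" for t
  have S: "adjoint_arc f' T ub xb S" unfolding S_def by (intro adjoint_arc_scaleR_diff P(1) Q(1))
  obtain C D where CD: "C-lipschitz_on {0..T} S" "D-lipschitz_on {0..T} P"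
    using S P(1) by (auto simp: adjoint_arc_def)
  have "C-lipschitz_on {0..<\<tau>} ?p"
  proof (rule lipschitz_onI)
    fix s t assume "s \<in> {0..<\<tau>}" "t \<in> {0..<\<tau>}"
    then show "dist (?p s) (?p t) \<le> C * dist s t"
      using lipschitz_onD[OF CD(1), of s t] \<tau> by (simp add: S_def)
  qed (rule lipschitz_on_nonneg[OF CD(1)])
  moreover have "D-lipschitz_on {\<tau><..T} ?p"
  proof (rule lipschitz_onI)
    fix s t assume "s \<in> {\<tau><..T}" "t \<in> {\<tau><..T}"
    then show "dist (?p s) (?p t) \<le> D * dist s t"
      using lipschitz_onD[OF CD(2), of s t] \<tau> by simp
  qed (rule lipschitz_on_nonneg[OF CD(2)])
  moreover have "AE t in lebesgue_on {0<..<T}. (?p has_vector_derivative - gradient (\<lambda>x. Ham f x (?p t) (ub0 t)) (xb t)) (at t)"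
  proof -
    have adj: "q = - gradient (\<lambda>x. Ham f x r (ub t)) (xb t)" if "\<forall>h. q \<bullet> h = - (r \<bullet> f' (xb t, ub t) (h, 0))" for q r t
    proof -
      have "\<forall>h. q \<bullet> h = (- gradient (\<lambda>x. Ham f x r (ub t)) (xb t)) \<bullet> h"
        using that Ham_gradient_inner(1)[where f = f and f' = f' and x = "xb t" and u = "ub t" and p = r, OF f'] by simp
      then show ?thesis using vector_eq_rdot by blast
    qed
    have "AE t in lebesgue_on {0<..<\<tau>}. (?p has_vector_derivative - gradient (\<lambda>x. Ham f x (?p t) (ub0 t)) (xb t)) (at t)"
    proof -
      have "AE t in lebesgue_on {0<..<T}. ub0 t = ub t \<and>
          (\<exists>q. (S has_vector_derivative q) (at t) \<and> (\<forall>h. q \<bullet> h = - (S t \<bullet> f' (xb t, ub t) (h, 0))))"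
        using S eq by (auto simp: adjoint_arc_def elim: eventually_elim2)
      then have "AE t in lebesgue_on {0<..<\<tau>}. ub0 t = ub t \<and>
          (\<exists>q. (S has_vector_derivative q) (at t) \<and> (\<forall>h. q \<bullet> h = - (S t \<bullet> f' (xb t, ub t) (h, 0))))"
        by (rule AE_lebesgue_on_subset) (use \<tau> in auto)
      then show ?thesis using AE_lebesgue_on_Ioo[of 0 \<tau>]
      proof eventually_elim
        case (elim t)
        then have "(S has_vector_derivative - gradient (\<lambda>x. Ham f x (S t) (ub0 t)) (xb t)) (at t)"
          using adj by metis
        then have "(?p has_vector_derivative - gradient (\<lambda>x. Ham f x (S t) (ub0 t)) (xb t)) (at t)"
          by (rule has_vector_derivative_transform_within_open[of _ _ _ "{0<..<\<tau>}"]) (use elim in \<open>auto simp: S_def\<close>)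
        then show ?case using elim by (simp add: S_def)
      qed
    qed
    moreover have "AE t in lebesgue_on {\<tau><..<T}. (?p has_vector_derivative - gradient (\<lambda>x. Ham f x (?p t) (ub0 t)) (xb t)) (at t)"
    proof -
      have "AE t in lebesgue_on {0<..<T}. ub0 t = ub t \<and>
          (\<exists>q. (P has_vector_derivative q) (at t) \<and> (\<forall>h. q \<bullet> h = - (P t \<bullet> f' (xb t, ub t) (h, 0))))"
        using P(1) eq by (auto simp: adjoint_arc_def elim: eventually_elim2)
      then have "AE t in lebesgue_on {\<tau><..<T}. ub0 t = ub t \<and>
          (\<exists>q. (P has_vector_derivative q) (at t) \<and> (\<forall>h. q \<bullet> h = - (P t \<bullet> f' (xb t, ub t) (h, 0))))"
        by (rule AE_lebesgue_on_subset) (use \<tau> in auto)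
      then show ?thesis using AE_lebesgue_on_Ioo[of \<tau> T]
      proof eventually_elim
        case (elim t)
        then have "(P has_vector_derivative - gradient (\<lambda>x. Ham f x (P t) (ub0 t)) (xb t)) (at t)"
          using adj by metis
        then have "(?p has_vector_derivative - gradient (\<lambda>x. Ham f x (P t) (ub0 t)) (xb t)) (at t)"
          by (rule has_vector_derivative_transform_within_open[of _ _ _ "{\<tau><..<T}"]) (use elim in auto)
        then show ?case using elim by simp
      qed
    qed
    ultimately show ?thesis by (rule AE_split_at)
  qed
  moreover have "\<exists>pm pp. (?p \<longlongrightarrow> pm) (at_left \<tau>) \<and> (?p \<longlongrightarrow> pp) (at_right \<tau>) \<and> pp - pm = \<gamma> *\<^sub>R gradient g (xb \<tau>)"
  proof (intro exI conjI)
    have lim: "(S \<longlongrightarrow> S \<tau>) (at \<tau>)" if "adjoint_arc f' T ub xb S" for S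
      by (rule continuous_on_tendsto_crossing[OF adjoint_arc_continuous[OF that]])
    have "(S \<longlongrightarrow> S \<tau>) (at_left \<tau>)" "(P \<longlongrightarrow> P \<tau>) (at_right \<tau>)"
      using lim[OF S] lim[OF P(1)] by (auto simp: filterlim_at_split)
    moreover have "\<forall>\<^sub>F t in at_left \<tau>. S t = ?p t"
      using eventually_at_left_real[OF \<tau>(1)] by eventually_elim (simp add: S_def)
    moreover have "\<forall>\<^sub>F t in at_right \<tau>. P t = ?p t"
      using eventually_at_right_real[OF \<tau>(2)] by eventually_elim simp
    ultimately show "(?p \<longlongrightarrow> S \<tau>) (at_left \<tau>)" "(?p \<longlongrightarrow> P \<tau>) (at_right \<tau>)"
      by (auto intro: Lim_transform_eventually)
    show "P \<tau> - S \<tau> = \<gamma> *\<^sub>R gradient g (xb \<tau>)" by (simp add: S_def Q(2))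
  qed
  ultimately show ?thesis
    using P(2) \<tau> unfolding is_costate_def by (auto intro: lipschitz_on_imp_abs_continuous_on)
qed

text \<open>The costate jumps at \<tau>, whereas the Hamiltonian is evaluated along arcs that are
  continuous on all of \<open>{0..T}\<close>. Each side is therefore treated with its own arc,
  continued across \<tau>.\<close>

lemma integral_condition:
  assumes U: "closed U" and f': "\<And>z. (f has_derivative blinfun_apply (f' z)) (at z)"
    and eq: "AE t in lebesgue_on {0<..<T}. ub0 t = ub t"
    and P: "adjoint_arc f' T ub xb P" and Q: "adjoint_arc f' T ub xb Q"
    and p1: "\<And>t. t \<in> {0<..<\<tau>} \<Longrightarrow> p t = \<alpha> *\<^sub>R P t - \<gamma> *\<^sub>R Q t" and p2: "\<And>t. t \<in> {\<tau><..<T} \<Longrightarrow> p t = \<alpha> *\<^sub>R P t"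
    and min: "AE t in lebesgue_on {0<..<T}. \<forall>u\<in>U. Ham f (xb t) (p t) (ub0 t) \<le> Ham f (xb t) (p t) u"
  shows "(LINT t:{0..T}|lebesgue. rho T \<tau> t * Ham f (xb t) (p t) (ub0 t))
    = (\<alpha> *\<^sub>R P \<tau> - \<gamma> *\<^sub>R Q \<tau>) \<bullet> f (xb \<tau>, um) - \<alpha> *\<^sub>R P \<tau> \<bullet> f (xb \<tau>, up)"
proof (rule set_lebesgue_integral_step[OF \<tau>])
  have both: "AE t in lebesgue_on {0<..<T}. ub0 t = ub t \<and> (\<forall>u\<in>U. p t \<bullet> f (xb t, ub t) \<le> p t \<bullet> f (xb t, u))"
    using eq min by eventually_elim (simp add: Ham_def)
  have b1: "AE t in lebesgue_on {0<..<\<tau>}. ub0 t = ub t \<and> (\<forall>u\<in>U. p t \<bullet> f (xb t, ub t) \<le> p t \<bullet> f (xb t, u))"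
    by (rule AE_lebesgue_on_subset[OF both]) (use \<tau> in auto)
  have b2: "AE t in lebesgue_on {\<tau><..<T}. ub0 t = ub t \<and> (\<forall>u\<in>U. p t \<bullet> f (xb t, ub t) \<le> p t \<bullet> f (xb t, u))"
    by (rule AE_lebesgue_on_subset[OF both]) (use \<tau> in auto)
  have "AE t in lebesgue_on {0<..<\<tau>}. \<forall>u\<in>U. (\<alpha> *\<^sub>R P t - \<gamma> *\<^sub>R Q t) \<bullet> f (xb t, ub t) \<le> (\<alpha> *\<^sub>R P t - \<gamma> *\<^sub>R Q t) \<bullet> f (xb t, u)"
    using b1 AE_lebesgue_on_Ioo[of 0 \<tau>] by eventually_elim (use p1 in simp)
  from hamiltonian_before[OF U f' adjoint_arc_scaleR_diff[OF P Q] this]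
  show "AE t in lebesgue_on {0<..<\<tau>}. Ham f (xb t) (p t) (ub0 t) = (\<alpha> *\<^sub>R P \<tau> - \<gamma> *\<^sub>R Q \<tau>) \<bullet> f (xb \<tau>, um)"
    using b1 AE_lebesgue_on_Ioo[of 0 \<tau>] by eventually_elim (use p1 in \<open>simp add: Ham_def\<close>)
  have "AE t in lebesgue_on {\<tau><..<T}. \<forall>u\<in>U. (\<alpha> *\<^sub>R P t - 0 *\<^sub>R Q t) \<bullet> f (xb t, ub t) \<le> (\<alpha> *\<^sub>R P t - 0 *\<^sub>R Q t) \<bullet> f (xb t, u)"
    using b2 AE_lebesgue_on_Ioo[of \<tau> T] by eventually_elim (use p2 in simp)
  from hamiltonian_after[OF U f' adjoint_arc_scaleR_diff[OF P Q] this]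
  show "AE t in lebesgue_on {\<tau><..<T}. Ham f (xb t) (p t) (ub0 t) = \<alpha> *\<^sub>R P \<tau> \<bullet> f (xb \<tau>, up)"
    using b2 AE_lebesgue_on_Ioo[of \<tau> T] by eventually_elim (use p2 in \<open>simp add: Ham_def\<close>)
qed

end

section \<open>Existence and uniqueness of the normalized multiplier\<close>

lemma class_C1_continuous_on:
  assumes "class_C1 f"
  shows "continuous_on UNIV f"
proof (rule continuous_at_imp_continuous_on, rule ballI)
  fix x
  from assms show "isCont f x" unfolding class_C1_def using has_derivative_continuous by blast
qed

lemma complementary_slackness:
  fixes \<nu> c :: "real ^ 'l"
  assumes "\<forall>i. 0 \<le> \<nu> $ i" "\<nu> \<bullet> c = 0" "\<forall>i. c $ i \<le> 0" "c $ i \<noteq> 0"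
  shows "\<nu> $ i = 0"
proof -
  have "(\<Sum>i\<in>UNIV. - (\<nu> $ i * c $ i)) = 0" using assms(2) by (simp add: inner_vec_def sum_negf)
  moreover have "\<And>i. 0 \<le> - (\<nu> $ i * c $ i)" using assms(1,3) by (simp add: mult_nonneg_nonpos)
  ultimately have "- (\<nu> $ i * c $ i) = 0"
    using sum_nonneg_eq_0_iff[of UNIV "\<lambda>i. - (\<nu> $ i * c $ i)"] by auto
  then show ?thesis using assms(4) by simp
qed

lemma constraint_qualification_UNIV:
  fixes c :: "'u::euclidean_space \<Rightarrow> real ^ 'l"
  assumes "constraint_qualification c T ub"
  obtains \<epsilon> \<delta> where "\<epsilon> > 0" "\<delta> > 0" "AE t in lebesgue_on {0<..<T}.
    \<forall>\<xi> :: real ^ 'l. (\<forall>i. i \<notin> {i. - \<delta> \<le> c (ub t) $ i} \<longrightarrow> \<xi> $ i = 0) \<longrightarrow>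
      \<epsilon> * norm \<xi> \<le> norm (\<Sum>i\<in>UNIV. \<xi> $ i *\<^sub>R gradient (\<lambda>u. c u $ i) (ub t))"
proof -
  obtain \<epsilon> \<delta> where ed: "\<epsilon> > 0" "\<delta> > 0" "AE t in lebesgue_on {0<..<T}.
        let I = {i. c (ub t) $ i \<ge> - \<delta>} in
        \<forall>\<xi> :: real ^ 'l. (\<forall>i. i \<notin> I \<longrightarrow> \<xi> $ i = 0) \<longrightarrow>
          \<epsilon> * norm \<xi> \<le> norm (\<Sum>i\<in>I. \<xi> $ i *\<^sub>R gradient (\<lambda>u. c u $ i) (ub t))"
    using assms unfolding constraint_qualification_def by blast
  have "AE t in lebesgue_on {0<..<T}.
    \<forall>\<xi> :: real ^ 'l. (\<forall>i. i \<notin> {i. - \<delta> \<le> c (ub t) $ i} \<longrightarrow> \<xi> $ i = 0) \<longrightarrow>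
      \<epsilon> * norm \<xi> \<le> norm (\<Sum>i\<in>UNIV. \<xi> $ i *\<^sub>R gradient (\<lambda>u. c u $ i) (ub t))"
    using ed(3)
  proof eventually_elim
    case (elim t)
    show ?case
    proof (intro allI impI)
      fix \<xi> :: "real ^ 'l" assume \<xi>: "\<forall>i. i \<notin> {i. - \<delta> \<le> c (ub t) $ i} \<longrightarrow> \<xi> $ i = 0"
      have "(\<Sum>i\<in>{i. - \<delta> \<le> c (ub t) $ i}. \<xi> $ i *\<^sub>R gradient (\<lambda>u. c u $ i) (ub t))
          = (\<Sum>i\<in>UNIV. \<xi> $ i *\<^sub>R gradient (\<lambda>u. c u $ i) (ub t))"
        using \<xi> by (intro sum.mono_neutral_left) auto
      then show "\<epsilon> * norm \<xi> \<le> norm (\<Sum>i\<in>UNIV. \<xi> $ i *\<^sub>R gradient (\<lambda>u. c u $ i) (ub t))"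
        using mp[OF spec[OF elim[unfolded Let_def], of \<xi>] \<xi>] by simp
    qed
  qed
  with ed(1,2) show thesis by (rule that)
qed

text \<open>Every active constraint is nearly active, so the uniform lower bound contains the linear
  independence of the active gradients.\<close>

lemma kkt_multiplier_from_qualification:
  fixes h :: "'u::euclidean_space \<Rightarrow> real" and c :: "'u \<Rightarrow> real ^ 'l"
  assumes h: "(h has_derivative h') (at u0)" and c: "(c has_derivative blinfun_apply c') (at u0)"
    and feas: "\<forall>i. c u0 $ i \<le> 0" and min: "\<And>u. (\<forall>i. c u $ i \<le> 0) \<Longrightarrow> h u0 \<le> h u"
    and ed: "\<epsilon> > 0" "\<delta> > 0" and cq: "\<forall>\<xi> :: real ^ 'l. (\<forall>i. i \<notin> {i. - \<delta> \<le> c u0 $ i} \<longrightarrow> \<xi> $ i = 0) \<longrightarrow>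
      \<epsilon> * norm \<xi> \<le> norm (\<Sum>i\<in>UNIV. \<xi> $ i *\<^sub>R gradient (\<lambda>u. c u $ i) u0)"
  shows "\<exists>\<mu> :: real ^ 'l. (\<forall>i. 0 \<le> \<mu> $ i) \<and> (\<forall>i. c u0 $ i \<noteq> 0 \<longrightarrow> \<mu> $ i = 0) \<and>
    gradient h u0 + (\<Sum>i\<in>UNIV. \<mu> $ i *\<^sub>R gradient (\<lambda>u. c u $ i) u0) = 0"
proof (rule kkt_multiplier_exists[where h = h])
  show "(h has_derivative (\<lambda>d. gradient h u0 \<bullet> d)) (at u0)" by (rule has_derivative_gradient(1)[OF h])
  show "((\<lambda>u. c u $ i) has_derivative (\<lambda>d. gradient (\<lambda>u. c u $ i) u0 \<bullet> d)) (at u0)" for i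
    by (rule gradient_component(1)[OF c])
  show "c u0 $ i \<le> 0" for i using feas by blast
  show "h u0 \<le> h u" if "\<forall>i. c u $ i \<le> 0" for u using that by (rule min)
  fix \<xi> assume \<xi>: "(\<Sum>i\<in>{i. c u0 $ i = 0}. \<xi> i *\<^sub>R gradient (\<lambda>u. c u $ i) u0) = 0"
  define v :: "real ^ 'l" where "v = (\<chi> i. if c u0 $ i = 0 then \<xi> i else 0)"
  have "(\<Sum>i\<in>UNIV. v $ i *\<^sub>R gradient (\<lambda>u. c u $ i) u0) = (\<Sum>i\<in>{i. c u0 $ i = 0}. \<xi> i *\<^sub>R gradient (\<lambda>u. c u $ i) u0)"
    by (intro sum.mono_neutral_cong_right) (auto simp: v_def)
  then have 0: "norm (\<Sum>i\<in>UNIV. v $ i *\<^sub>R gradient (\<lambda>u. c u $ i) u0) = 0" using \<xi> by simp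
  have "\<forall>i. i \<notin> {i. - \<delta> \<le> c u0 $ i} \<longrightarrow> v $ i = 0" using ed(2) by (auto simp: v_def)
  then have "\<epsilon> * norm v \<le> norm (\<Sum>i\<in>UNIV. v $ i *\<^sub>R gradient (\<lambda>u. c u $ i) u0)" using cq by blast
  then have "v = 0" using ed(1) unfolding 0 by (simp add: mult_le_0_iff)
  then show "\<forall>i\<in>{i. c u0 $ i = 0}. \<xi> i = 0" by (auto simp: v_def vec_eq_iff split: if_splits)
qed

theorem proposition4p1:
  fixes T c1 c2 \<tau> :: real
    and x0 :: "real ^ 'n"
    and U :: "(real ^ 'm) set"
    and K :: "(real ^ 'n) set"
    and f :: "(real ^ 'n) \<times> (real ^ 'm) \<Rightarrow> real ^ 'n"
    and \<phi> g :: "real ^ 'n \<Rightarrow> real"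
    and c :: "real ^ 'm \<Rightarrow> real ^ 'l"
    and ub :: "real \<Rightarrow> real ^ 'm"
    and xb :: "real \<Rightarrow> real ^ 'n"
    and um up :: "real ^ 'm"
  assumes "T > 0"
    and "U \<noteq> {}" and "closed U"
    and "class_C2 f"
    and "c1 > 0" and "c2 > 0"
    and "\<And>x u. u \<in> U \<Longrightarrow> norm (f (x, u)) \<le> c1 * norm x + c2"
    and "\<And>x. (\<lambda>u. f (x, u)) ` U \<noteq> {}"
    and "\<And>x. compact ((\<lambda>u. f (x, u)) ` U)"
    and "\<And>x. convex ((\<lambda>u. f (x, u)) ` U)"
    and "class_C2 \<phi>"
    and "closed K" and "interior K \<noteq> {}"
    and "is_global_minimizer f \<phi> K U T x0 ub xb"
    and "essentially_bounded T ub"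
    and "class_C2 c"
    and "U = {u. \<forall>i. c u $ i \<le> 0}"
    and "constraint_qualification c T ub"
    and "class_C1 g"
    and "K = {x. g x \<le> 0}"
    and "0 < \<tau>" and "\<tau> < T"
    and "\<And>t. t \<in> {0<..<T} \<Longrightarrow> crossing_time K T xb t \<longleftrightarrow> t = \<tau>"
    and "crossing_out K T xb \<tau>"
    and "(ub \<longlongrightarrow> um) (at_left \<tau>)" and "(ub \<longlongrightarrow> up) (at_right \<tau>)"
    and "f (xb \<tau>, um) \<bullet> gradient g (xb \<tau>) \<noteq> 0"
    and "f (xb \<tau>, up) \<bullet> gradient g (xb \<tau>) \<noteq> 0"
    and "\<And>t. t \<in> {0..T} \<Longrightarrow> t \<noteq> \<tau> \<Longrightarrow> g (xb t) \<noteq> 0"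
  shows "(\<forall>(\<alpha>, \<gamma>, \<nu>) \<in> pontryagin_multipliers f \<phi> c g U T ub xb \<tau>. \<alpha> > 0) \<and>
    (\<exists>\<gamma> \<nu>. (1, \<gamma>, \<nu>) \<in> pontryagin_multipliers f \<phi> c g U T ub xb \<tau> \<and>
       (\<forall>(\<alpha>', \<gamma>', \<nu>') \<in> pontryagin_multipliers f \<phi> c g U T ub xb \<tau>.
          \<alpha>' = 1 \<longrightarrow> \<gamma>' = \<gamma> \<and> (AE t in lebesgue_on {0<..<T}. \<nu>' t = \<nu> t)))"
proof -
  note T = \<open>T > 0\<close> and \<tau> = \<open>0 < \<tau>\<close> \<open>\<tau> < T\<close> and U_eq = \<open>U = {u. \<forall>i. c u $ i \<le> 0}\<close>
    and closed_U = \<open>closed U\<close> and K_eq = \<open>K = {x. g x \<le> 0}\<close> and C1_g = \<open>class_C1 g\<close>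
    and um_lim = \<open>(ub \<longlongrightarrow> um) (at_left \<tau>)\<close> and up_lim = \<open>(ub \<longlongrightarrow> up) (at_right \<tau>)\<close>
    and minimizer = \<open>is_global_minimizer f \<phi> K U T x0 ub xb\<close>
  have g_nz: "g (xb t) \<noteq> 0" if "t \<in> {0..T}" "t \<noteq> \<tau>" for t using that assms(29) by blast

  \<comment> \<open>Regularity data and the sign of \<open>g\<close> along the trajectory\<close>
  obtain f' where f': "\<And>z. (f has_derivative blinfun_apply (f' z)) (at z)" "class_C1 f'"
    using \<open>class_C2 f\<close> unfolding class_C2_def by blast
  obtain c' where c': "\<And>u. (c has_derivative blinfun_apply (c' u)) (at u)" "class_C1 c'"
    using \<open>class_C2 c\<close> unfolding class_C2_def by blast
  have f'_cont: "continuous_on UNIV f'" and c'_cont: "continuous_on UNIV c'" and g_cont: "continuous_on UNIV g"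
    using class_C1_continuous_on f'(2) c'(2) C1_g by auto
  have f_cont: "continuous_on UNIV f" and c_cont: "continuous_on UNIV c"
    using has_derivative_continuous[OF f'(1)] has_derivative_continuous[OF c'(1)]
    by (simp_all add: continuous_at_imp_continuous_on)
  have \<phi>_deriv: "(\<phi> has_derivative (\<lambda>h. gradient \<phi> (xb T) \<bullet> h)) (at (xb T))"
    using \<open>class_C2 \<phi>\<close> unfolding class_C2_def by (auto intro: has_derivative_gradient(1))
  have ub_adm: "ub \<in> borel_measurable (lebesgue_on {0..T})" "\<And>t. t \<in> {0..T} \<Longrightarrow> ub t \<in> U"
    and xb_state0: "is_state f T x0 ub xb"
    and optimal: "\<forall>w x. w \<in> admissible_controls U T \<longrightarrow> is_state f T x0 w x \<longrightarrow>
      crisis_cost \<phi> K T xb \<le> crisis_cost \<phi> K T x"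
    using minimizer by (auto simp: is_global_minimizer_def admissible_controls_def)
  have xb_cont: "continuous_on {0..T} xb"
    using xb_state0 by (auto simp: is_state_def intro: abs_continuous_on_imp_continuous_on)
  obtain R where R: "\<forall>t\<in>{0..T}. norm (xb t) \<le> R" "R \<ge> 0" using continuous_on_Icc_bounded[OF xb_cont] .
  have gx_cont: "continuous_on S (\<lambda>t. g (xb t))" if "S \<subseteq> {0..T}" for S
    by (rule continuous_on_compose2[OF g_cont continuous_on_subset[OF xb_cont that]]) auto
  obtain \<eta> where \<eta>: "\<eta> > 0" "\<forall>t\<in>{\<tau> - \<eta><..\<tau>}. xb t \<in> K" "\<forall>t\<in>{\<tau><..<\<tau> + \<eta>}. xb t \<in> - K"
    using \<open>crossing_out K T xb \<tau>\<close> unfolding crossing_out_def by blast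
  have g_neg: "\<forall>t. 0 \<le> t \<longrightarrow> t < \<tau> \<longrightarrow> g (xb t) < 0"
  proof (intro allI impI, rule ccontr)
    fix t assume t: "0 \<le> t" "t < \<tau>" "\<not> g (xb t) < 0"
    \<comment> \<open>A nonnegative value at \<open>t\<close> and a nonpositive one at a point
      \<open>r\<close> of the crossing window between \<open>t\<close> and \<tau> would give a zero
      of \<open>g\<close> before \<tau>.\<close>
    define m where "m = max t (\<tau> - \<eta>)"
    have m: "t \<le> m" "\<tau> - \<eta> \<le> m" "m < \<tau>" using t(2) \<eta>(1) by (auto simp: m_def)
    define r where "r = (m + \<tau>) / 2"
    have r: "t \<le> r" "r < \<tau>" "\<tau> - \<eta> < r" using m by (auto simp: r_def field_simps)
    have "xb r \<in> K" using \<eta>(2) r by auto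
    then have "g (xb r) \<le> 0" by (simp add: K_eq)
    moreover have "0 \<le> g (xb t)" using t(3) by simp
    moreover have "continuous_on {t..r} (\<lambda>t. g (xb t))" using t r \<tau> by (intro gx_cont) auto
    ultimately obtain q where "q \<ge> t" "q \<le> r" "g (xb q) = 0"
      using IVT2'[of "\<lambda>t. g (xb t)" r 0 t] r(1) by auto
    then show False using g_nz[of q] t r \<tau> by auto
  qed
  have g_pos: "\<forall>t. \<tau> < t \<longrightarrow> t \<le> T \<longrightarrow> g (xb t) > 0"
  proof (intro allI impI, rule ccontr)
    fix t assume t: "\<tau> < t" "t \<le> T" "\<not> g (xb t) > 0"
    define m where "m = min t (\<tau> + \<eta>)"
    have m: "m \<le> t" "m \<le> \<tau> + \<eta>" "\<tau> < m" using t(1) \<eta>(1) by (auto simp: m_def)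
    define r where "r = (m + \<tau>) / 2"
    have r: "r \<le> t" "\<tau> < r" "r < \<tau> + \<eta>" using m by (auto simp: r_def field_simps)
    have "xb r \<in> - K" using \<eta>(3) r by auto
    then have "0 \<le> g (xb r)" by (simp add: K_eq)
    moreover have "g (xb t) \<le> 0" using t(3) by simp
    moreover have "continuous_on {r..t} (\<lambda>t. g (xb t))" using t r \<tau> by (intro gx_cont) auto
    ultimately obtain q where "q \<ge> r" "q \<le> t" "g (xb q) = 0"
      using IVT2'[of "\<lambda>t. g (xb t)" t 0 r] r(1) by auto
    then show False using g_nz[of q] t r \<tau> by auto
  qed

  \<comment> \<open>A bounded representative of the control\<close>
  obtain Mb where Mb: "AE t in lebesgue_on {0<..<T}. norm (ub t) \<le> Mb"
    using \<open>essentially_bounded T ub\<close> unfolding essentially_bounded_def by blast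
  obtain v0 where v0: "v0 \<in> U" using \<open>U \<noteq> {}\<close> by blast
  \<comment> \<open>The extra 1 leaves room around the one-sided limits: near \<tau> the control
    itself obeys the bound, so truncation does not change these limits.\<close>
  define M0 where "M0 = max Mb (max (norm v0) (max (norm um + 1) (norm up + 1)))"
  have M0: "Mb \<le> M0" "norm v0 \<le> M0" "norm um + 1 \<le> M0" "norm up + 1 \<le> M0" by (auto simp: M0_def)
  define ut where "ut t = (if norm (ub t) \<le> M0 then ub t else v0)" for t
  have eq: "AE t in lebesgue_on {0<..<T}. ub t = ut t"
    using Mb by eventually_elim (use M0(1) in \<open>auto simp: ut_def\<close>)
  have ut_meas: "ut \<in> borel_measurable (lebesgue_on {0..T})"
    unfolding ut_def using ub_adm(1) by measurable
  have ut_U: "\<forall>t. t \<in> {0..T} \<longrightarrow> ut t \<in> U" using ub_adm(2) v0 by (simp add: ut_def)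
  have ut_M0: "norm (ut t) \<le> M0" for t using M0(2) by (simp add: ut_def)
  have ut_lim: "(ut \<longlongrightarrow> l) F" if "(ub \<longlongrightarrow> l) F" "norm l + 1 \<le> M0" for l F
  proof (rule Lim_transform_eventually[OF that(1)])
    have "\<forall>\<^sub>F t in F. dist (ub t) l < 1" using that(1) by (rule tendstoD) simp
    then show "\<forall>\<^sub>F t in F. ub t = ut t"
    proof eventually_elim
      case (elim t)
      then have "norm (ub t) \<le> M0" using that(2) norm_triangle_sub[of "ub t" l] by (simp add: dist_norm)
      then show ?case by (simp add: ut_def)
    qed
  qed
  have ut_um: "(ut \<longlongrightarrow> um) (at_left \<tau>)" and ut_up: "(ut \<longlongrightarrow> up) (at_right \<tau>)"
    using ut_lim um_lim up_lim M0 by auto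
  have um: "um \<in> U" and up: "up \<in> U"
  proof -
    have "\<forall>\<^sub>F t in at_left \<tau>. ub t \<in> U"
      using eventually_at_left_real[OF \<tau>(1)] by eventually_elim (use ub_adm(2) \<tau> in auto)
    then show "um \<in> U" using closed_U um_lim by (intro Lim_in_closed_set[of U ub "at_left \<tau>"]) auto
    have "\<forall>\<^sub>F t in at_right \<tau>. ub t \<in> U"
      using eventually_at_right_real[OF \<tau>(2)] by eventually_elim (use ub_adm(2) \<tau> in auto)
    then show "up \<in> U" using closed_U up_lim by (intro Lim_in_closed_set[of U ub "at_right \<tau>"]) auto
  qed
  have xb_state: "is_state f T x0 ut xb"
    unfolding is_state_def
  proof (intro conjI)
    have "AE t in lebesgue_on {0<..<T}. (xb has_vector_derivative f (xb t, ub t)) (at t)"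
      using xb_state0 by (simp add: is_state_def)
    then show "AE t in lebesgue_on {0<..<T}. (xb has_vector_derivative f (xb t, ut t)) (at t)"
      using eq by eventually_elim simp
  qed (use xb_state0 in \<open>auto simp: is_state_def\<close>)
  \<comment> \<open>\<open>M\<close> stays a parameter because a needle value may be any element of
    the possibly unbounded set \<open>U\<close>, and \<open>L\<close> depends on \<open>M\<close>.
    The notion of an adjoint arc mentions neither constant, so the same arcs serve all
    instances.\<close>
  have crossing: "\<exists>L. crossing_trajectory f f' U T M R L x0 ut xb \<phi> g (gradient \<phi> (xb T)) (gradient g (xb \<tau>)) \<tau> um up K"
    if M: "M0 \<le> M" for M
  proof (rule C2_local_bounds[OF f', of "R + 1" M])
    fix L assume L: "L > 0"
      "\<And>x u. norm x \<le> R + 1 \<Longrightarrow> norm u \<le> M \<Longrightarrow> norm (f (x, u)) \<le> L"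
      "\<And>x u. norm x \<le> R + 1 \<Longrightarrow> norm u \<le> M \<Longrightarrow> norm (f' (x, u)) \<le> L"
      "\<And>x y u. norm x \<le> R + 1 \<Longrightarrow> norm y \<le> R + 1 \<Longrightarrow> norm u \<le> M \<Longrightarrow> norm (f (y, u) - f (x, u)) \<le> L * norm (y - x)"
      "\<And>x y u. norm x \<le> R + 1 \<Longrightarrow> norm y \<le> R + 1 \<Longrightarrow> norm u \<le> M \<Longrightarrow>
        norm (f (y, u) - f (x, u) - f' (x, u) (y - x, 0)) \<le> L * (norm (y - x))\<^sup>2"
    have MM: "\<forall>t. t \<in> {0..T} \<longrightarrow> norm (ut t) \<le> M" "norm um \<le> M" "norm up \<le> M"
      using ut_M0 M M0 by (auto intro: order.trans)
    have "reference_trajectory f f' U T M R L x0 ut xb"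
      by (rule reference_trajectory.intro)
        (rule T f_cont L ut_meas xb_state | (assumption | use ut_U MM R in blast)+)+
    moreover have "crossing_trajectory_axioms f U T M x0 ut xb \<phi> g (gradient \<phi> (xb T)) (gradient g (xb \<tau>)) \<tau> um up K"
      by (rule crossing_trajectory_axioms.intro)
        (rule \<phi>_deriv C1_strictly_differentiable[OF C1_g] g_cont K_eq \<tau> ut_um ut_up um up MM
          | assumption | use g_neg g_pos optimal assms(27) in \<open>simp add: inner_commute\<close>)+
    ultimately show ?thesis by (blast intro: crossing_trajectory.intro)
  qed
  obtain L0 where C0: "crossing_trajectory f f' U T M0 R L0 x0 ut xb \<phi> g (gradient \<phi> (xb T)) (gradient g (xb \<tau>)) \<tau> um up K"
    using crossing[OF order_refl] by blast
  interpret C0: crossing_trajectory f f' U T M0 R L0 x0 ut xb \<phi> g "gradient \<phi> (xb T)" "gradient g (xb \<tau>)" \<tau> um up K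
    by (rule C0)

  \<comment> \<open>Adjoint arcs and the normalized costate\<close>
  have mem: "T \<in> {0..T}" "\<tau> \<in> {0..T}" using T \<tau> by auto
  obtain P where P: "adjoint_arc f' T ut xb P" "P T = gradient \<phi> (xb T)"
    using C0.adjoint_exists[OF f'_cont mem(1), where y = "gradient \<phi> (xb T)"] .
  obtain Q where Q: "adjoint_arc f' T ut xb Q" "Q \<tau> = gradient g (xb \<tau>)"
    using C0.adjoint_exists[OF f'_cont mem(2), where y = "gradient g (xb \<tau>)"] .
  define fm where "fm = f (xb \<tau>, um)"
  define fp where "fp = f (xb \<tau>, up)"
  define a where "a = gradient g (xb \<tau>) \<bullet> fm"
  have a: "a > 0" using C0.transversal by (simp add: a_def fm_def)
  \<comment> \<open>For this value condition (iv) will hold with right-hand side 1; it is also the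
    value that the needle variations before \<tau> produce.\<close>
  define \<gamma>0 where "\<gamma>0 = (P \<tau> \<bullet> (fm - fp) - 1) / a"
  define p0 where "p0 t = (if t < \<tau> then P t - \<gamma>0 *\<^sub>R Q t else P t)" for t
  have ne: "AE t in lebesgue_on {0<..<T}. 0 < t \<and> t < T \<and> t \<noteq> \<tau>"
  proof -
    have "negligible {t \<in> {0<..<T}. \<not> (0 < t \<and> t < T \<and> t \<noteq> \<tau>)}"
      by (rule negligible_subset[of "{\<tau>}"]) auto
    then show ?thesis by (simp only: AE_lebesgue_on_iff_negligible[of "{0<..<T}"] sets_completionI_sets sets_lborel open_greaterThanLessThan borel_open)
  qed
  \<comment> \<open>The exceptional times are \<tau> and those at which \<open>xb\<close> fails to
    have velocity \<open>f (xb t, ut t)\<close>. They do not depend on \<open>u\<close>, so the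
    quantifier over all of \<open>U\<close> can stay inside the almost-everywhere statement.\<close>
  have min0: "AE t in lebesgue_on {0<..<T}. \<forall>u\<in>U. p0 t \<bullet> f (xb t, ut t) \<le> p0 t \<bullet> f (xb t, u)"
  proof -
    have "AE t in lebesgue_on {0<..<T}. (xb has_vector_derivative f (xb t, ut t)) (at t)"
      using xb_state by (simp add: is_state_def)
    then show ?thesis using ne
    proof eventually_elim
      case (elim t)
      show ?case
      proof
        fix u assume u: "u \<in> U"
        have M: "M0 \<le> max M0 (norm u)" "norm u \<le> max M0 (norm u)" by auto
        obtain L where C: "crossing_trajectory f f' U T (max M0 (norm u)) R L x0 ut xb \<phi> g
            (gradient \<phi> (xb T)) (gradient g (xb \<tau>)) \<tau> um up K" using crossing[OF M(1)] by blast
        show "p0 t \<bullet> f (xb t, ut t) \<le> p0 t \<bullet> f (xb t, u)"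
        proof (cases "t < \<tau>")
          case True
          have "\<gamma>0 * (gradient g (xb \<tau>) \<bullet> f (xb \<tau>, um)) = - (1 + P \<tau> \<bullet> (f (xb \<tau>, up) - f (xb \<tau>, um)))"
            using a by (simp add: \<gamma>0_def a_def fm_def fp_def inner_diff_right)
          from crossing_trajectory.before_crossing_minimum[OF C P Q _ True elim(1) u M(2) this]
          show ?thesis using elim(2) True by (simp add: p0_def)
        next
          case False
          then have "\<tau> < t" using elim(2) by simp
          from crossing_trajectory.after_crossing_minimum[OF C P this _ elim(1) u M(2)]
          show ?thesis using elim(2) False by (simp add: p0_def)
        qed
      qed
    qed
  qed
  obtain \<epsilon> \<delta> where ed: "\<epsilon> > 0" "\<delta> > 0" and cq: "AE t in lebesgue_on {0<..<T}.
    \<forall>\<xi> :: real ^ 'l. (\<forall>i. i \<notin> {i. - \<delta> \<le> c (ub t) $ i} \<longrightarrow> \<xi> $ i = 0) \<longrightarrow>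
      \<epsilon> * norm \<xi> \<le> norm (\<Sum>i\<in>UNIV. \<xi> $ i *\<^sub>R gradient (\<lambda>u. c u $ i) (ub t))"
    using constraint_qualification_UNIV[OF \<open>constraint_qualification c T ub\<close>] .

  \<comment> \<open>Uniqueness and positivity\<close>
  have aug: "gradient (\<lambda>u. Ham_aug f c x p u \<nu>) u
    = gradient (\<lambda>v. p \<bullet> f (x, v)) u + (\<Sum>i\<in>UNIV. \<nu> $ i *\<^sub>R gradient (\<lambda>u. c u $ i) u)" for x p u and \<nu> :: "real ^ 'l"
    by (rule gradient_Ham_aug[where f' = f' and c' = "c' u", OF f'(1) c'(1)])
  \<comment> \<open>Complementary slackness makes both multipliers vanish off the nearly active set.
    With equal costates the gradients combine to zero under the difference, and the qualification
    bound forces this difference to be zero.\<close>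
  have unique: "AE t in lebesgue_on {0<..<T}. \<nu> t = \<nu>' t"
    if s: "AE t in lebesgue_on {0<..<T}. (\<forall>i. 0 \<le> \<nu> t $ i) \<and> \<nu> t \<bullet> c (ub t) = 0"
        "AE t in lebesgue_on {0<..<T}. (\<forall>i. 0 \<le> \<nu>' t $ i) \<and> \<nu>' t \<bullet> c (ub t) = 0"
      and z: "AE t in lebesgue_on {0<..<T}. gradient (\<lambda>u. Ham_aug f c (xb t) (p t) u (\<nu> t)) (ub t) = 0"
        "AE t in lebesgue_on {0<..<T}. gradient (\<lambda>u. Ham_aug f c (xb t) (p' t) u (\<nu>' t)) (ub t) = 0"
      and p: "\<And>t. 0 < t \<Longrightarrow> t < T \<Longrightarrow> t \<noteq> \<tau> \<Longrightarrow> p t = p' t"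
    for \<nu> \<nu>' :: "real \<Rightarrow> real ^ 'l" and p p'
    using s z cq ne
  proof eventually_elim
    case (elim t)
    have cU: "\<forall>i. c (ub t) $ i \<le> 0" using ub_adm(2)[of t] elim(6) by (auto simp: U_eq)
    have off: "\<forall>i. i \<notin> {i. - \<delta> \<le> c (ub t) $ i} \<longrightarrow> (\<nu> t - \<nu>' t) $ i = 0"
    proof (intro allI impI)
      fix i assume "i \<notin> {i. - \<delta> \<le> c (ub t) $ i}"
      then have "c (ub t) $ i \<noteq> 0" using ed(2) by auto
      then show "(\<nu> t - \<nu>' t) $ i = 0"
        using complementary_slackness[of "\<nu> t" "c (ub t)" i] complementary_slackness[of "\<nu>' t" "c (ub t)" i]
          elim(1,2) cU by simp
    qed
    have pt: "p t = p' t" using p elim(6) by blast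
    have "gradient (\<lambda>v. p' t \<bullet> f (xb t, v)) (ub t) + (\<Sum>i\<in>UNIV. \<nu> t $ i *\<^sub>R gradient (\<lambda>u. c u $ i) (ub t)) = 0"
      using elim(3) unfolding aug pt .
    then have z1: "(\<Sum>i\<in>UNIV. \<nu> t $ i *\<^sub>R gradient (\<lambda>u. c u $ i) (ub t)) = - gradient (\<lambda>v. p' t \<bullet> f (xb t, v)) (ub t)"
      by (rule minus_unique[symmetric])
    have "gradient (\<lambda>v. p' t \<bullet> f (xb t, v)) (ub t) + (\<Sum>i\<in>UNIV. \<nu>' t $ i *\<^sub>R gradient (\<lambda>u. c u $ i) (ub t)) = 0"
      using elim(4) unfolding aug .
    then have z2: "(\<Sum>i\<in>UNIV. \<nu>' t $ i *\<^sub>R gradient (\<lambda>u. c u $ i) (ub t)) = - gradient (\<lambda>v. p' t \<bullet> f (xb t, v)) (ub t)"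
      by (rule minus_unique[symmetric])
    have z: "(\<Sum>i\<in>UNIV. (\<nu> t - \<nu>' t) $ i *\<^sub>R gradient (\<lambda>u. c u $ i) (ub t)) = 0"
      unfolding vector_minus_component scaleR_diff_left sum_subtractf z1 z2 by (rule diff_self)
    have "\<epsilon> * norm (\<nu> t - \<nu>' t) \<le> 0"
      using mp[OF spec[OF elim(5), of "\<nu> t - \<nu>' t"] off] unfolding z by simp
    then show ?case using ed(1) by (simp add: mult_le_0_iff)
  qed
  \<comment> \<open>With the costate in its forced form, condition (iv) is a linear equation for
    \<gamma> with the positive coefficient \<open>a\<close>.\<close>
  have relation: "\<gamma> * a = \<alpha> * (P \<tau> \<bullet> (fm - fp) - 1) \<and> 
      (\<exists>p. lagrange_costate f \<phi> c g T ub xb \<tau> \<alpha> \<gamma> \<nu> p \<and>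
        (\<forall>t. 0 < t \<longrightarrow> t < T \<longrightarrow> t \<noteq> \<tau> \<longrightarrow> p t = (if t < \<tau> then \<alpha> *\<^sub>R P t - \<gamma> *\<^sub>R Q t else \<alpha> *\<^sub>R P t)))"
    if m: "(\<alpha>, \<gamma>, \<nu>) \<in> pontryagin_multipliers f \<phi> c g U T ub xb \<tau>" for \<alpha> \<gamma> \<nu>
  proof -
    from m obtain p where p: "lagrange_costate f \<phi> c g T ub xb \<tau> \<alpha> \<gamma> \<nu> p"
      and min: "AE t in lebesgue_on {0<..<T}. \<forall>u\<in>U. Ham f (xb t) (p t) (ub t) \<le> Ham f (xb t) (p t) u"
      unfolding pontryagin_multipliers_def by blast
    have co: "is_costate f \<phi> g T ub xb \<tau> \<alpha> \<gamma> p" using p by (simp add: lagrange_costate_def)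
    note ce = C0.costate_eq[OF f'(1) eq P Q co]
    have p1: "p t = \<alpha> *\<^sub>R P t - \<gamma> *\<^sub>R Q t" if "t \<in> {0<..<\<tau>}" for t using ce(1)[of t] that by simp
    have p2: "p t = \<alpha> *\<^sub>R P t" if "t \<in> {\<tau><..<T}" for t using ce(2)[of t] that by simp
    have "\<alpha> = (\<alpha> *\<^sub>R P \<tau> - \<gamma> *\<^sub>R Q \<tau>) \<bullet> f (xb \<tau>, um) - \<alpha> *\<^sub>R P \<tau> \<bullet> f (xb \<tau>, up)"
      using C0.integral_condition[OF closed_U f'(1) eq P(1) Q(1) p1 p2 min] p
      by (simp add: lagrange_costate_def)
    then have "\<gamma> * a = \<alpha> * (P \<tau> \<bullet> (fm - fp) - 1)"
      by (simp add: a_def fm_def fp_def Q(2) inner_diff_left inner_diff_right algebra_simps)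
    moreover have "\<forall>t. 0 < t \<longrightarrow> t < T \<longrightarrow> t \<noteq> \<tau> \<longrightarrow> p t = (if t < \<tau> then \<alpha> *\<^sub>R P t - \<gamma> *\<^sub>R Q t else \<alpha> *\<^sub>R P t)"
      using p1 p2 by auto
    ultimately show ?thesis using p by blast
  qed
  have slack: "AE t in lebesgue_on {0<..<T}. (\<forall>i. 0 \<le> \<nu> t $ i) \<and> \<nu> t \<bullet> c (ub t) = 0"
    if "(\<alpha>, \<gamma>, \<nu>) \<in> pontryagin_multipliers f \<phi> c g U T ub xb \<tau>" for \<alpha> \<gamma> \<nu>
    using that by (simp add: pontryagin_multipliers_def lagrange_multipliers_def)
  have stat: "AE t in lebesgue_on {0<..<T}. gradient (\<lambda>u. Ham_aug f c (xb t) (p t) u (\<nu> t)) (ub t) = 0"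
    if "lagrange_costate f \<phi> c g T ub xb \<tau> \<alpha> \<gamma> \<nu> p" for \<alpha> \<gamma> \<nu> p
    using that by (simp add: lagrange_costate_def)
  have pos: "\<alpha> > 0" if m: "(\<alpha>, \<gamma>, \<nu>) \<in> pontryagin_multipliers f \<phi> c g U T ub xb \<tau>" for \<alpha> \<gamma> \<nu>
  proof (rule ccontr)
    assume "\<not> \<alpha> > 0"
    then have \<alpha>: "\<alpha> = 0" using m by (auto simp: pontryagin_multipliers_def lagrange_multipliers_def)
    then have \<gamma>: "\<gamma> = 0" using relation[OF m] a by simp
    obtain p where p: "lagrange_costate f \<phi> c g T ub xb \<tau> \<alpha> \<gamma> \<nu> p"
      "\<forall>t. 0 < t \<longrightarrow> t < T \<longrightarrow> t \<noteq> \<tau> \<longrightarrow> p t = (if t < \<tau> then \<alpha> *\<^sub>R P t - \<gamma> *\<^sub>R Q t else \<alpha> *\<^sub>R P t)"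
      using relation[OF m] by blast
    have grad0: "gradient (\<lambda>v. 0 :: real) u = 0" for u :: "real ^ 'm"
    proof -
      have "gradient (\<lambda>v. 0 :: real) u \<bullet> h = 0 \<bullet> h" for h
        using has_derivative_gradient(2)[OF has_derivative_const[of 0 "at u"]] by simp
      then show ?thesis using vector_eq_rdot by blast
    qed
    \<comment> \<open>When the costate vanishes, the zero function also satisfies stationarity and
      slackness, so it can be compared with \<nu>.\<close>
    have "AE t in lebesgue_on {0<..<T}. \<nu> t = 0"
      by (rule unique[OF slack[OF m] _ stat[OF p(1)], where p' = "\<lambda>_. 0"])
        (use p(2) \<alpha> \<gamma> in \<open>simp_all add: aug grad0\<close>)
    then show False using m \<alpha> \<gamma> by (auto simp: pontryagin_multipliers_def lagrange_multipliers_def)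
  qed

  \<comment> \<open>Construction of the normalized multiplier\<close>
  obtain \<nu>0 :: "real \<Rightarrow> real ^ 'l" where \<nu>0_meas: "\<nu>0 \<in> borel_measurable (lebesgue_on {0..T})"
    and \<nu>0: "AE t in lebesgue_on {0<..<T}. (\<forall>i. 0 \<le> \<nu>0 t $ i) \<and> \<nu>0 t \<bullet> c (ub t) = 0 \<and>
      gradient (\<lambda>u. Ham_aug f c (xb t) (p0 t) u (\<nu>0 t)) (ub t) = 0 \<and>
      \<epsilon> * norm (\<nu>0 t) \<le> norm (gradient (\<lambda>v. p0 t \<bullet> f (xb t, v)) (ub t))"
  proof -
    define G where "G t i = gradient (\<lambda>u. c u $ i) (ut t)" for t i
    define dH where "dH t = gradient (\<lambda>v. p0 t \<bullet> f (xb t, v)) (ut t)" for t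
    define I where "I t = {i. - \<delta> \<le> c (ut t) $ i}" for t
    \<comment> \<open>In coordinates the gradients become continuous expressions in the state, the
      control and the costate, which makes them measurable in time.\<close>
    have G_eq: "G t i = (\<Sum>b\<in>Basis. (c' (ut t) b $ i) *\<^sub>R b)" for t i
      unfolding G_def gradient_component(2)[OF c'(1), symmetric] by (rule euclidean_representation[symmetric])
    have dH_eq: "dH t = (\<Sum>b\<in>Basis. (p0 t \<bullet> f' (xb t, ut t) (0, b)) *\<^sub>R b)" for t
    proof -
      have "dH t \<bullet> b = p0 t \<bullet> f' (xb t, ut t) (0, b)" for b
        unfolding dH_def
        by (rule has_derivative_gradient(2)[OF Ham_gradient_inner(2)[where f = f and f' = f' and x = "xb t" and u = "ut t" and p = "p0 t", OF f'(1)]])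
      then show ?thesis using euclidean_representation[of "dH t"] by simp
    qed
    have G_meas: "(\<lambda>t. G t i) \<in> borel_measurable (lebesgue_on {0..T})" for i
    proof -
      have "continuous_on UNIV (\<lambda>z :: (real ^ 'n) \<times> (real ^ 'm). \<Sum>b\<in>Basis. (c' (snd z) b $ i) *\<^sub>R b)"
        by (intro continuous_intros continuous_on_compose2[OF c'_cont]) auto
      from C0.measurable_dynamics[OF this xb_cont ut_meas] show ?thesis unfolding G_eq by simp
    qed
    have [measurable]: "P \<in> borel_measurable (lebesgue_on {0..T})" "Q \<in> borel_measurable (lebesgue_on {0..T})"
      "(\<lambda>t. t) \<in> borel_measurable (lebesgue_on {0..T})"
      by (intro continuous_on_borel_measurable_lebesgue_on_Icc C0.adjoint_arc_continuous P(1) Q(1) continuous_on_id)+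
    have [measurable]: "(\<lambda>t. f' (xb t, ut t) (0, b)) \<in> borel_measurable (lebesgue_on {0..T})" for b
      by (rule C0.measurable_dynamics[OF _ xb_cont ut_meas]) (intro continuous_intros f'_cont)
    have p0_meas [measurable]: "p0 \<in> borel_measurable (lebesgue_on {0..T})"
      unfolding p0_def by measurable
    have dH_meas: "dH \<in> borel_measurable (lebesgue_on {0..T})"
      unfolding dH_eq[abs_def] by measurable
    have I_meas: "{t \<in> space (lebesgue_on {0..T}). i \<in> I t} \<in> sets (lebesgue_on {0..T})" for i
    proof -
      have "continuous_on UNIV (\<lambda>z :: (real ^ 'n) \<times> (real ^ 'm). c (snd z) $ i)"
        by (intro continuous_intros continuous_on_compose2[OF c_cont]) auto
      from C0.measurable_dynamics[OF this xb_cont ut_meas]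
      have [measurable]: "(\<lambda>t. c (ut t) $ i) \<in> borel_measurable (lebesgue_on {0..T})" by simp
      show ?thesis unfolding I_def mem_Collect_eq by measurable
    qed
    show thesis
    proof (rule measurable_multiplier[of G "lebesgue_on {0..T}" dH I, OF G_meas dH_meas I_meas])
      fix \<nu> :: "real \<Rightarrow> real ^ 'l" assume \<nu>: "\<nu> \<in> borel_measurable (lebesgue_on {0..T})"
        "\<And>t \<mu> \<epsilon>. \<epsilon> > 0 \<Longrightarrow> \<forall>\<xi> :: real ^ 'l. (\<forall>i. i \<notin> I t \<longrightarrow> \<xi> $ i = 0) \<longrightarrow> \<epsilon> * norm \<xi> \<le> norm (\<Sum>i\<in>UNIV. \<xi> $ i *\<^sub>R G t i) \<Longrightarrow>
          (\<forall>i. i \<notin> I t \<longrightarrow> \<mu> $ i = 0) \<Longrightarrow> dH t + (\<Sum>i\<in>UNIV. \<mu> $ i *\<^sub>R G t i) = 0 \<Longrightarrow> \<nu> t = \<mu>"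
      have "AE t in lebesgue_on {0<..<T}. (\<forall>i. 0 \<le> \<nu> t $ i) \<and> \<nu> t \<bullet> c (ub t) = 0 \<and>
        gradient (\<lambda>u. Ham_aug f c (xb t) (p0 t) u (\<nu> t)) (ub t) = 0 \<and>
        \<epsilon> * norm (\<nu> t) \<le> norm (gradient (\<lambda>v. p0 t \<bullet> f (xb t, v)) (ub t))"
        using cq eq min0 ne
      proof eventually_elim
        case (elim t)
        note et = elim(2)
        have feas: "\<forall>i. c (ut t) $ i \<le> 0" using ut_U elim(4) by (auto simp: U_eq)
        have cq': "\<forall>\<xi> :: real ^ 'l. (\<forall>i. i \<notin> I t \<longrightarrow> \<xi> $ i = 0) \<longrightarrow> \<epsilon> * norm \<xi> \<le> norm (\<Sum>i\<in>UNIV. \<xi> $ i *\<^sub>R G t i)"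
          using elim(1) unfolding I_def G_def et .
        \<comment> \<open>At this time \<open>ut t\<close> minimizes the Hamiltonian over
          \<open>U\<close>, which yields a multiplier pointwise; since it solves the linear system,
          it coincides with the measurable function.\<close>
        have "\<exists>\<mu> :: real ^ 'l. (\<forall>i. 0 \<le> \<mu> $ i) \<and> (\<forall>i. c (ut t) $ i \<noteq> 0 \<longrightarrow> \<mu> $ i = 0) \<and>
            gradient (\<lambda>v. p0 t \<bullet> f (xb t, v)) (ut t) + (\<Sum>i\<in>UNIV. \<mu> $ i *\<^sub>R gradient (\<lambda>u. c u $ i) (ut t)) = 0"
        proof (rule kkt_multiplier_from_qualification[OF _ c'(1) feas _ ed])
          show "((\<lambda>v. p0 t \<bullet> f (xb t, v)) has_derivative (\<lambda>h. p0 t \<bullet> f' (xb t, ut t) (0, h))) (at (ut t))"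
            by (rule Ham_gradient_inner(2)[where f = f and f' = f' and x = "xb t" and u = "ut t" and p = "p0 t", OF f'(1)])
          show "p0 t \<bullet> f (xb t, ut t) \<le> p0 t \<bullet> f (xb t, u)" if "\<forall>i. c u $ i \<le> 0" for u
            using elim(3) that by (simp add: U_eq)
        qed (use cq' in \<open>simp add: I_def G_def\<close>)
        then obtain \<mu> :: "real ^ 'l" where \<mu>: "\<forall>i. 0 \<le> \<mu> $ i" "\<forall>i. c (ut t) $ i \<noteq> 0 \<longrightarrow> \<mu> $ i = 0"
            "dH t + (\<Sum>i\<in>UNIV. \<mu> $ i *\<^sub>R G t i) = 0" by (auto simp: dH_def G_def)
        have off: "\<forall>i. i \<notin> I t \<longrightarrow> \<mu> $ i = 0"
        proof (intro allI impI)
          fix i assume "i \<notin> I t"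
          then have "c (ut t) $ i \<noteq> 0" using ed(2) by (auto simp: I_def)
          then show "\<mu> $ i = 0" using \<mu>(2) by blast
        qed
        have eqn: "\<nu> t = \<mu>" by (rule \<nu>(2)[OF ed(1) cq' off \<mu>(3)])
        have \<mu>c: "\<mu> $ i * c (ut t) $ i = 0" for i using \<mu>(2) by (cases "c (ut t) $ i = 0") auto
        have "\<mu> \<bullet> c (ut t) = 0"
          unfolding inner_vec_def inner_real_def by (rule sum.neutral) (use \<mu>c in blast)
        moreover have "\<epsilon> * norm \<mu> \<le> norm (dH t)"
        proof -
          have "\<epsilon> * norm \<mu> \<le> norm (\<Sum>i\<in>UNIV. \<mu> $ i *\<^sub>R G t i)" using cq' off by blast
          also have "(\<Sum>i\<in>UNIV. \<mu> $ i *\<^sub>R G t i) = - dH t" using \<mu>(3) by (simp add: eq_neg_iff_add_eq_0 add.commute)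
          finally show ?thesis by simp
        qed
        ultimately show ?case using \<mu>(1,3) unfolding eqn et aug by (simp add: dH_def G_def)
      qed
      with \<nu>(1) show thesis by (rule that)
    qed
  qed
  have bounded: "essentially_bounded T \<nu>0"
  proof -
    obtain BP BQ where B: "\<forall>t\<in>{0..T}. norm (P t) \<le> BP" "BP \<ge> 0" "\<forall>t\<in>{0..T}. norm (Q t) \<le> BQ" "BQ \<ge> 0"
      using continuous_on_Icc_bounded[OF C0.adjoint_arc_continuous[OF P(1)]]
        continuous_on_Icc_bounded[OF C0.adjoint_arc_continuous[OF Q(1)]] by metis
    define B where "B = BP + \<bar>\<gamma>0\<bar> * BQ"
    have p0_le: "norm (p0 t) \<le> B" if "t \<in> {0..T}" for t
    proof -
      have "norm (\<gamma>0 *\<^sub>R Q t) \<le> \<bar>\<gamma>0\<bar> * BQ" using B(3) that by (auto intro: mult_left_mono)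
      moreover have "0 \<le> \<bar>\<gamma>0\<bar> * BQ" using B(4) by simp
      moreover have "norm (P t) \<le> BP" using B(1) that by blast
      ultimately have "norm (P t - \<gamma>0 *\<^sub>R Q t) \<le> B" "norm (P t) \<le> B"
        using norm_triangle_ineq4[of "P t" "\<gamma>0 *\<^sub>R Q t"] unfolding B_def by linarith+
      then show ?thesis by (simp add: p0_def)
    qed
    \<comment> \<open>The qualification bound controls the multiplier by the control gradient of the
      Hamiltonian, which is at most \<open>B * L0\<close> along the bounded arcs.\<close>
    have "AE t in lebesgue_on {0<..<T}. norm (\<nu>0 t) \<le> B * L0 / \<epsilon>"
      using \<nu>0 eq ne
    proof eventually_elim
      case (elim t)
      define d where "d = gradient (\<lambda>v. p0 t \<bullet> f (xb t, v)) (ub t)"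
      have tT: "t \<in> {0..T}" using elim(3) by simp
      have d: "d \<bullet> h = p0 t \<bullet> f' (xb t, ub t) (0, h)" for h
        unfolding d_def
        by (rule has_derivative_gradient(2)[OF Ham_gradient_inner(2)[where f = f and f' = f' and x = "xb t" and u = "ub t" and p = "p0 t", OF f'(1)]])
      have "norm (f' (xb t, ub t)) \<le> L0"
      proof -
        have "norm (xb t) \<le> R + 1" using bspec[OF R(1) tT] by linarith
        from C0.f'_bound[OF this ut_M0[of t]] show ?thesis using elim(2) by simp
      qed
      then have "norm (f' (xb t, ub t) (0, d)) \<le> L0 * norm d"
        using norm_blinfun[of "f' (xb t, ub t)" "(0, d)"] mult_right_mono[of "norm (f' (xb t, ub t))" L0 "norm d"]
        by (simp add: norm_Pair)
      then have "norm (p0 t) * norm (f' (xb t, ub t) (0, d)) \<le> B * (L0 * norm d)"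
        by (intro mult_mono p0_le[OF tT] order.trans[OF norm_ge_zero p0_le[OF tT]] norm_ge_zero)
      moreover have "norm d * norm d \<le> norm (p0 t) * norm (f' (xb t, ub t) (0, d))"
        using d[of d] norm_cauchy_schwarz[of "p0 t" "f' (xb t, ub t) (0, d)"]
        by (simp add: power2_norm_eq_inner[symmetric] power2_eq_square)
      ultimately have dd: "norm d * norm d \<le> (B * L0) * norm d" by (simp add: mult.assoc)
      have "0 \<le> B" using p0_le[OF tT] norm_ge_zero[of "p0 t"] by linarith
      then have "norm d \<le> B * L0"
        using dd C0.L by (cases "d = 0") auto
      then have "\<epsilon> * norm (\<nu>0 t) \<le> B * L0" using elim(1) by (simp add: d_def)
      then show ?case using ed(1) by (simp add: pos_le_divide_eq mult.commute)
    qed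
    then show ?thesis by (auto simp: essentially_bounded_def)
  qed
  have co0: "is_costate f \<phi> g T ub xb \<tau> 1 \<gamma>0 p0"
    using C0.costate_exists[OF f'(1) eq P Q, of \<gamma>0] by (simp add: p0_def[abs_def])
  have minH: "AE t in lebesgue_on {0<..<T}. \<forall>u\<in>U. Ham f (xb t) (p0 t) (ub t) \<le> Ham f (xb t) (p0 t) u"
    using min0 eq by eventually_elim (simp add: Ham_def)
  have int0: "(LINT t:{0..T}|lebesgue. rho T \<tau> t * Ham f (xb t) (p0 t) (ub t)) = 1"
  proof -
    have q1: "p0 t = 1 *\<^sub>R P t - \<gamma>0 *\<^sub>R Q t" if "t \<in> {0<..<\<tau>}" for t using that by (simp add: p0_def)
    have q2: "p0 t = 1 *\<^sub>R P t" if "t \<in> {\<tau><..<T}" for t using that by (simp add: p0_def)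
    have "(LINT t:{0..T}|lebesgue. rho T \<tau> t * Ham f (xb t) (p0 t) (ub t))
        = (1 *\<^sub>R P \<tau> - \<gamma>0 *\<^sub>R Q \<tau>) \<bullet> f (xb \<tau>, um) - 1 *\<^sub>R P \<tau> \<bullet> f (xb \<tau>, up)"
      by (rule C0.integral_condition[OF closed_U f'(1) eq P(1) Q(1) q1 q2 minH])
    also have "\<dots> = P \<tau> \<bullet> (fm - fp) - \<gamma>0 * a"
      by (simp add: a_def fm_def fp_def Q(2) inner_diff_left inner_diff_right)
    also have "\<dots> = 1" using a by (simp add: \<gamma>0_def)
    finally show ?thesis .
  qed
  have lag: "lagrange_costate f \<phi> c g T ub xb \<tau> 1 \<gamma>0 \<nu>0 p0"
    unfolding lagrange_costate_def
  proof (intro conjI co0 int0)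
    show "AE t in lebesgue_on {0<..<T}. gradient (\<lambda>u. Ham_aug f c (xb t) (p0 t) u (\<nu>0 t)) (ub t) = 0"
      using \<nu>0 by eventually_elim blast
  qed
  have exist: "(1, \<gamma>0, \<nu>0) \<in> pontryagin_multipliers f \<phi> c g U T ub xb \<tau>"
  proof -
    have "\<nu>0 \<in> borel_measurable (lebesgue_on {0<..<T})"
      by (rule measurable_restrict_mono[OF \<nu>0_meas]) auto
    moreover have "AE t in lebesgue_on {0<..<T}. (\<forall>i. 0 \<le> \<nu>0 t $ i) \<and> \<nu>0 t \<bullet> c (ub t) = 0"
      using \<nu>0 by eventually_elim blast
    ultimately show ?thesis
      unfolding pontryagin_multipliers_def lagrange_multipliers_def using bounded lag minH by auto
  qed
  have uniq: "\<gamma>' = \<gamma>0 \<and> (AE t in lebesgue_on {0<..<T}. \<nu>' t = \<nu>0 t)"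
    if m: "(1, \<gamma>', \<nu>') \<in> pontryagin_multipliers f \<phi> c g U T ub xb \<tau>" for \<gamma>' \<nu>'
  proof -
    have \<gamma>: "\<gamma>' = \<gamma>0" using relation[OF m] a by (simp add: \<gamma>0_def eq_divide_eq)
    obtain p where p: "lagrange_costate f \<phi> c g T ub xb \<tau> 1 \<gamma>' \<nu>' p"
      "\<forall>t. 0 < t \<longrightarrow> t < T \<longrightarrow> t \<noteq> \<tau> \<longrightarrow> p t = (if t < \<tau> then 1 *\<^sub>R P t - \<gamma>' *\<^sub>R Q t else 1 *\<^sub>R P t)"
      using relation[OF m] by blast
    have "p t = p0 t" if "0 < t" "t < T" "t \<noteq> \<tau>" for t
      using p(2) that \<gamma> by (simp add: p0_def)
    then have "AE t in lebesgue_on {0<..<T}. \<nu>' t = \<nu>0 t"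
      by (rule unique[OF slack[OF m] slack[OF exist] stat[OF p(1)] stat[OF lag]])
    then show ?thesis using \<gamma> by blast
  qed
  show ?thesis
  proof (intro conjI)
    show "\<forall>(\<alpha>, \<gamma>, \<nu>) \<in> pontryagin_multipliers f \<phi> c g U T ub xb \<tau>. \<alpha> > 0"
      using pos by blast
    show "\<exists>\<gamma> \<nu>. (1, \<gamma>, \<nu>) \<in> pontryagin_multipliers f \<phi> c g U T ub xb \<tau> \<and>
       (\<forall>(\<alpha>', \<gamma>', \<nu>') \<in> pontryagin_multipliers f \<phi> c g U T ub xb \<tau>.
          \<alpha>' = 1 \<longrightarrow> \<gamma>' = \<gamma> \<and> (AE t in lebesgue_on {0<..<T}. \<nu>' t = \<nu> t))"
    proof (intro exI[of _ \<gamma>0] exI[of _ \<nu>0] conjI exist ballI, clarify)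
      fix \<gamma>' \<nu>' assume "(1, \<gamma>', \<nu>') \<in> pontryagin_multipliers f \<phi> c g U T ub xb \<tau>"
      then show "\<gamma>' = \<gamma>0 \<and> (AE t in lebesgue_on {0<..<T}. \<nu>' t = \<nu>0 t)" by (rule uniq)
    qed
  qed
qed

end
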